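(* Define the Munthe-Kaas–Wright coproduct on $\mathcal{EF}$ by $$\Delta_{MKW}(\pi)=(\mathrm{id}\otimes B^-)\sum_{c}P^c(B^+(\pi))\otimes R^c(B^+(\pi)),\qquad\pi\in EF,$$ where the sum is over admissible cuts $c$ of the tree $B^+(\pi)$. Then $(\mathcal{EF},\sqcup\!\sqcup,\Delta_{MKW})$ is a Hopf algebra, dual to the planar Grossman–Larson Hopf algebra $(\mathcal{EF},\diamond,\Delta_{\sqcup\!\sqcup})$ (with respect to the pairing for which the exotic forests form an orthonormal basis).
   Context: Exotic forests. A planar forest is an ordered, possibly empty, sequence of planar rooted trees (children ordered left to right); $\mathbf 1$ is the empty forest. An exotic forest is a planar forest whose nodes are each decorated by $\bullet$ or by a positive integer, such that integers only decorate leaves (nodes without children; a one-node tree's root is a leaf) and every integer used decorates exactly two leaves (such a pair is a liana). Exotic forests differing by a renumbering of the integers are identified. $EF$ is the set of exotic forests, $\mathcal{EF}$ its linear span, graded by $|\pi|=\#\{\text{black nodes}\}+\frac12\#\{\text{numbered nodes}\}$. In products, the integers of the two factors are chosen disjoint. $B^+(\pi)$ is the tree obtained by attaching the roots of $\pi$, in order, to a new black root; $B^-$ removes the root of a tree, returning the forest of its branches. Shuffle product $\sqcup\!\sqcup$: $\pi\sqcup\!\sqcup\,\eta$ is the sum over all interleavings of the sequence of trees of $\pi$ with that of $\eta$, preserving the order inside each. Deshuffle coproduct: call $\pi\in EF\setminus\{\mathbf 1\}$ connected if the sequence of its trees cannot be split into two non-empty complementary subsequences each of which is an exotic forest (i.e.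 with no liana joining the two). Every $\pi$ decomposes uniquely into connected components (subsequences of trees), and $\Delta_{\sqcup\!\sqcup}(\pi)=\sum_S\pi_S\otimes\pi_{S^c}$, the sum over all subsets $S$ of the set of connected components of $\pi$, where $\pi_S$ is the exotic forest formed by the trees in components of $S$ in their original order. Grossman–Larson product $\diamond$: $\pi\diamond\eta$ is the sum over all maps sending each root of $\pi$ either to "stay" or to a black node of $\eta$: trees of $\pi$ that stay are concatenated, in order, to the left of $\eta$; trees sent to a black node $v$ of $\eta$ are attached, in order, as new children of $v$ to the left of the existing ones. Admissible cuts: an admissible cut $c$ of an exotic planar tree $\tau$ is a (possibly empty) set of edges such that: each path from a leaf to the root contains at most one edge of $c$; if an edge $e$ joining a child to its parent $v$ is in $c$, then all edges joining children of $v$ to the left of $e$ to $v$ are in $c$; and for each liana $\{v_1,v_2\}$, if the path from $v_1$ to the root contains an edge of $c$, so does the path from $v_2$ to the root. $R^c(\tau)$ is the component of $\tau\setminus c$ containing the root. $P^c(\tau)$ is the linear combination of exotic forests obtained by shuffling the other components: the trees cut off from the same node form a sequence (in their original order), and $P^c(\tau)$ is the sum, with multiplicity, over all interleavings of these sequences. *)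

theory Defs
  imports Complex_Main "HOL-Library.Poly_Mapping" "HOL-Library.Sublist" "HOL-Library.FuncSet"
begin

section \<open>Free vector spaces and Hopf algebras\<close>

text \<open>
  The vector space over a field \<open>'k\<close> with basis \<open>'b\<close> is \<open>'b \<Rightarrow>\<^sub>0 'k\<close>. The tensor product of the
  spaces with bases \<open>'a\<close> and \<open>'b\<close> is the space with basis \<open>'a \<times> 'b\<close>; a bilinear map is a linear map
  on that tensor product.
\<close>

definition scale :: "'k::field \<Rightarrow> ('b \<Rightarrow>\<^sub>0 'k) \<Rightarrow> ('b \<Rightarrow>\<^sub>0 'k)" where
  "scale c = Poly_Mapping.map ((*) c)"

definition basis :: "'b \<Rightarrow> ('b \<Rightarrow>\<^sub>0 'k::field)" where
  "basis b = Poly_Mapping.single b 1"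

text \<open>Linear extension of a map given on the basis.\<close>

definition lin_ext :: "('a \<Rightarrow> ('b \<Rightarrow>\<^sub>0 'k::field)) \<Rightarrow> ('a \<Rightarrow>\<^sub>0 'k) \<Rightarrow> ('b \<Rightarrow>\<^sub>0 'k)" where
  "lin_ext f x = (\<Sum>a\<in>Poly_Mapping.keys x. scale (Poly_Mapping.lookup x a) (f a))"

definition tensor :: "('a \<Rightarrow>\<^sub>0 'k::field) \<Rightarrow> ('b \<Rightarrow>\<^sub>0 'k) \<Rightarrow> ('a \<times> 'b \<Rightarrow>\<^sub>0 'k)"  (infixr "\<otimes>" 70) where
  "x \<otimes> y = lin_ext (\<lambda>a. lin_ext (\<lambda>b. basis (a, b)) y) x"

text \<open>Tensor product of two linear maps.\<close>

definition tensor_map ::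
  "(('a \<Rightarrow>\<^sub>0 'k::field) \<Rightarrow> ('c \<Rightarrow>\<^sub>0 'k)) \<Rightarrow> (('b \<Rightarrow>\<^sub>0 'k) \<Rightarrow> ('d \<Rightarrow>\<^sub>0 'k)) \<Rightarrow> ('a \<times> 'b \<Rightarrow>\<^sub>0 'k) \<Rightarrow> ('c \<times> 'd \<Rightarrow>\<^sub>0 'k)"
  where "tensor_map f g = lin_ext (\<lambda>(a, b). f (basis a) \<otimes> g (basis b))"

definition reassoc :: "(('a \<times> 'b) \<times> 'c \<Rightarrow>\<^sub>0 'k::field) \<Rightarrow> ('a \<times> ('b \<times> 'c) \<Rightarrow>\<^sub>0 'k)" where
  "reassoc = lin_ext (\<lambda>((a, b), c). basis (a, (b, c)))"

definition interchange ::
  "(('a \<times> 'b) \<times> ('c \<times> 'd) \<Rightarrow>\<^sub>0 'k::field) \<Rightarrow> (('a \<times> 'c) \<times> ('b \<times> 'd) \<Rightarrow>\<^sub>0 'k)" where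
  "interchange = lin_ext (\<lambda>((a, b), (c, d)). basis ((a, c), (b, d)))"

locale hopf_algebra =
  fixes mult :: "('b \<times> 'b \<Rightarrow>\<^sub>0 'k::field) \<Rightarrow> ('b \<Rightarrow>\<^sub>0 'k)"
    and unit :: "'b \<Rightarrow>\<^sub>0 'k"
    and comult :: "('b \<Rightarrow>\<^sub>0 'k) \<Rightarrow> ('b \<times> 'b \<Rightarrow>\<^sub>0 'k)"
    and counit :: "('b \<Rightarrow>\<^sub>0 'k) \<Rightarrow> 'k"
    and antipode :: "('b \<Rightarrow>\<^sub>0 'k) \<Rightarrow> ('b \<Rightarrow>\<^sub>0 'k)"
  assumes linear_mult: "Vector_Spaces.linear scale scale mult"
    and linear_comult: "Vector_Spaces.linear scale scale comult"
    and linear_counit: "Vector_Spaces.linear scale (*) counit"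
    and linear_antipode: "Vector_Spaces.linear scale scale antipode"
    and mult_assoc: "mult (mult (x \<otimes> y) \<otimes> z) = mult (x \<otimes> mult (y \<otimes> z))"
    and mult_unit_left: "mult (unit \<otimes> x) = x"
    and mult_unit_right: "mult (x \<otimes> unit) = x"
    and comult_coassoc: "reassoc (tensor_map comult id (comult x)) = tensor_map id comult (comult x)"
    and counit_left: "lin_ext (\<lambda>(a, b). scale (counit (basis a)) (basis b)) (comult x) = x"
    and counit_right: "lin_ext (\<lambda>(a, b). scale (counit (basis b)) (basis a)) (comult x) = x"
    and comult_mult: "comult (mult (x \<otimes> y)) = tensor_map mult mult (interchange (comult x \<otimes> comult y))"
    and comult_unit: "comult unit = unit \<otimes> unit"
    and counit_mult: "counit (mult (x \<otimes> y)) = counit x * counit y"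
    and counit_unit: "counit unit = 1"
    and antipode_left: "mult (tensor_map antipode id (comult x)) = scale (counit x) unit"
    and antipode_right: "mult (tensor_map id antipode (comult x)) = scale (counit x) unit"

text \<open>
  The pairing for which the basis is orthonormal. At a product type it is the induced pairing of
  tensors: \<open>pairing (a \<otimes> b) (c \<otimes> d) = pairing a c * pairing b d\<close>.
\<close>

definition pairing :: "('b \<Rightarrow>\<^sub>0 'k::field) \<Rightarrow> ('b \<Rightarrow>\<^sub>0 'k) \<Rightarrow> 'k" where
  "pairing x y = (\<Sum>b\<in>Poly_Mapping.keys x. Poly_Mapping.lookup x b * Poly_Mapping.lookup y b)"

text \<open>
  Two Hopf algebras on the same based space are dual with respect to \<open>pairing\<close> if every structure map of
  one is adjoint to the corresponding structure map of the other.
\<close>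

locale dual_hopf_algebras =
  H: hopf_algebra mult unit comult counit antipode +
  H': hopf_algebra mult' unit' comult' counit' antipode'
  for mult :: "('b \<times> 'b \<Rightarrow>\<^sub>0 'k::field) \<Rightarrow> ('b \<Rightarrow>\<^sub>0 'k)" and unit comult counit antipode
    and mult' :: "('b \<times> 'b \<Rightarrow>\<^sub>0 'k) \<Rightarrow> ('b \<Rightarrow>\<^sub>0 'k)" and unit' comult' counit' antipode' +
  assumes pairing_mult: "pairing (mult t) x = pairing t (comult' x)"
    and pairing_comult: "pairing (comult x) t = pairing x (mult' t)"
    and pairing_unit: "pairing unit x = counit' x"
    and pairing_counit: "counit x = pairing x unit'"
    and pairing_antipode: "pairing (antipode x) y = pairing x (antipode' y)"


section \<open>Exotic forests\<close>

datatype 'd ptree = Node (decoration: 'd) (children: "'d ptree list")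

text \<open>Decorations: \<open>None\<close> is a black node, \<open>Some i\<close> a node numbered \<open>i\<close>.\<close>

type_synonym dtree = "nat option ptree"
type_synonym dforest = "dtree list"

text \<open>
  A node of a tree is addressed by the list of child indices leading to it from the root. An edge is
  identified with the address of its lower end.
\<close>

fun is_node :: "'d ptree \<Rightarrow> nat list \<Rightarrow> bool" where
  "is_node t [] \<longleftrightarrow> True"
| "is_node t (i # p) \<longleftrightarrow> i < length (children t) \<and> is_node (children t ! i) p"

fun subtree :: "'d ptree \<Rightarrow> nat list \<Rightarrow> 'd ptree" where
  "subtree t [] = t"
| "subtree t (i # p) = subtree (children t ! i) p"

definition nodes :: "'d ptree \<Rightarrow> nat list set" where
  "nodes t = {p. is_node t p}"

definition edges :: "'d ptree \<Rightarrow> nat list set" where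
  "edges t = nodes t - {[]}"

definition leaves :: "'d ptree \<Rightarrow> nat list set" where
  "leaves t = {p \<in> nodes t. children (subtree t p) = []}"

definition deco :: "'d ptree \<Rightarrow> nat list \<Rightarrow> 'd" where
  "deco t p = decoration (subtree t p)"

definition Bplus :: "dforest \<Rightarrow> dtree" where
  "Bplus f = Node None f"

definition Bminus :: "dtree \<Rightarrow> dforest" where
  "Bminus t = children t"

text \<open>The nodes of a forest \<open>f\<close> are the nodes of \<open>Bplus f\<close> other than its (black) root.\<close>

definition exotic :: "dforest \<Rightarrow> bool" where
  "exotic f \<longleftrightarrow> (\<forall>p \<in> nodes (Bplus f). \<forall>i. deco (Bplus f) p = Some i \<longrightarrow>
     0 < i \<and> p \<in> leaves (Bplus f) \<and> card {q \<in> nodes (Bplus f). deco (Bplus f) q = Some i} = 2)"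

definition renumber :: "(nat \<Rightarrow> nat) \<Rightarrow> dforest \<Rightarrow> dforest" where
  "renumber \<sigma> = map (map_ptree (map_option \<sigma>))"

definition renumber_equiv :: "dforest \<Rightarrow> dforest \<Rightarrow> bool" where
  "renumber_equiv f g \<longleftrightarrow> exotic f \<and> exotic g \<and> (\<exists>\<sigma>. bij \<sigma> \<and> g = renumber \<sigma> f)"

lemma renumber_comp: "renumber \<sigma> (renumber \<tau> f) = renumber (\<sigma> \<circ> \<tau>) f"
  by (simp add: renumber_def ptree.map_comp option.map_comp comp_def)

lemma renumber_id: "renumber id f = f"
  by (simp add: renumber_def option.map_id0 ptree.map_id0)

lemma exotic_Nil: "exotic []"
proof -
  have "p = []" if "p \<in> nodes (Bplus [])" for p
    using that by (cases p) (auto simp: nodes_def Bplus_def)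
  moreover have "deco (Bplus []) [] = None"
    by (simp add: deco_def Bplus_def)
  ultimately show ?thesis
    unfolding exotic_def by (metis option.distinct(1))
qed

quotient_type ef = "dforest" / partial: renumber_equiv
proof (rule part_equivpI)
  show "\<exists>f. renumber_equiv f f"
    unfolding renumber_equiv_def
    by (intro exI[of _ "[]"] exI[of _ id] conjI exotic_Nil bij_id renumber_id[symmetric])
  show "symp renumber_equiv"
  proof (rule sympI)
    fix f g
    assume "renumber_equiv f g"
    then obtain \<sigma> where \<sigma>: "exotic f" "exotic g" "bij \<sigma>" "g = renumber \<sigma> f"
      unfolding renumber_equiv_def by blast
    have "renumber (inv \<sigma>) g = f"
      unfolding \<sigma>(4) renumber_comp inv_o_cancel[OF bij_is_inj[OF \<sigma>(3)]] by (rule renumber_id)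
    then show "renumber_equiv g f"
      unfolding renumber_equiv_def using \<sigma>(1,2) bij_imp_bij_inv[OF \<sigma>(3)] by blast
  qed
  show "transp renumber_equiv"
  proof (rule transpI)
    fix f g h
    assume "renumber_equiv f g" "renumber_equiv g h"
    then obtain \<sigma> \<tau> where "exotic f" "exotic h" "bij \<sigma>" "bij \<tau>" "h = renumber \<tau> (renumber \<sigma> f)"
      unfolding renumber_equiv_def by blast
    then show "renumber_equiv f h"
      unfolding renumber_equiv_def renumber_comp by (blast intro: bij_comp)
  qed
qed

text \<open>
  The operations below are defined on an arbitrary representative \<open>rep_ef \<pi>\<close>; \<open>abs_ef\<close> is the class of
  an exotic planar forest. In products, the representatives are renumbered by even and by odd
  integers respectively, so that their integers are disjoint.
\<close>

definition rep_even :: "ef \<Rightarrow> dforest" where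
  "rep_even \<pi> = renumber (\<lambda>i. 2 * i) (rep_ef \<pi>)"

definition rep_odd :: "ef \<Rightarrow> dforest" where
  "rep_odd \<pi> = renumber (\<lambda>i. 2 * i + 1) (rep_ef \<pi>)"

definition empty_forest :: ef where
  "empty_forest = abs_ef []"


subsection \<open>Shuffle product\<close>

text \<open>Shuffling the (distinct) positions of the trees keeps track of multiplicities.\<close>

definition shuffle_basis :: "ef \<Rightarrow> ef \<Rightarrow> (ef \<Rightarrow>\<^sub>0 'k::field)" where
  "shuffle_basis \<pi> \<eta> = (let f = rep_even \<pi>; g = rep_odd \<eta> in
     \<Sum>l \<in> shuffles [0..<length f] [length f..<length f + length g]. basis (abs_ef (map ((!) (f @ g)) l)))"

definition shuffle_prod :: "(ef \<times> ef \<Rightarrow>\<^sub>0 'k::field) \<Rightarrow> (ef \<Rightarrow>\<^sub>0 'k)" where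
  "shuffle_prod = lin_ext (\<lambda>(\<pi>, \<eta>). shuffle_basis \<pi> \<eta>)"


subsection \<open>Deshuffle coproduct\<close>

text \<open>A subsequence of the trees of \<open>f\<close> is given by its set \<open>I\<close> of positions, as \<open>nths f I\<close>.\<close>

definition connected_forest :: "dforest \<Rightarrow> bool" where
  "connected_forest f \<longleftrightarrow> exotic f \<and> f \<noteq> [] \<and>
     \<not> (\<exists>I J. I \<noteq> {} \<and> J \<noteq> {} \<and> I \<inter> J = {} \<and> I \<union> J = {..<length f} \<and>
            exotic (nths f I) \<and> exotic (nths f J))"

text \<open>
  For exotic \<open>f\<close> these position sets partition \<open>{..<length f}\<close>, and this is the unique partition of it
  into positions of connected forests.
\<close>

definition components :: "dforest \<Rightarrow> nat set set" where
  "components f = {I. I \<subseteq> {..<length f} \<and> connected_forest (nths f I)}"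

definition deshuffle_basis :: "ef \<Rightarrow> (ef \<times> ef \<Rightarrow>\<^sub>0 'k::field)" where
  "deshuffle_basis \<pi> = (let f = rep_ef \<pi> in
     \<Sum>S \<in> Pow (components f).
       basis (abs_ef (nths f (\<Union>S))) \<otimes> basis (abs_ef (nths f (\<Union>(components f - S)))))"

definition deshuffle :: "(ef \<Rightarrow>\<^sub>0 'k::field) \<Rightarrow> (ef \<times> ef \<Rightarrow>\<^sub>0 'k)" where
  "deshuffle = lin_ext deshuffle_basis"


subsection \<open>Grossman--Larson product\<close>

text \<open>\<open>graft a t\<close> attaches to every node \<open>v\<close> of \<open>t\<close> the trees \<open>a v\<close>, to the left of the existing children.\<close>

lemma size_child: "i < length ts \<Longrightarrow> size (ts ! i) < size (Node d ts)"
  using size_list_estimation'[of "ts ! i" ts "size (ts ! i)" size] by (simp add: less_Suc_eq_le)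

function graft :: "(nat list \<Rightarrow> 'd ptree list) \<Rightarrow> 'd ptree \<Rightarrow> 'd ptree" where
  "graft a (Node d ts) = Node d (a [] @ map (\<lambda>i. graft (\<lambda>p. a (i # p)) (ts ! i)) [0..<length ts])"
  by pat_completeness auto
termination
  by (relation "measure (\<lambda>(a, t). size t)")
    (simp_all only: wf_measure in_measure case_prod_conv set_upt set_filter mem_Collect_eq atLeastLessThan_iff size_child)

definition black_nodes :: "dtree \<Rightarrow> nat list set" where
  "black_nodes t = {p \<in> nodes t. deco t p = None}"

text \<open>
  The sum is over the maps \<open>\<phi>\<close> from the roots of \<open>f\<close> to the black nodes of \<open>Bplus g\<close>: the added root \<open>[]\<close>
  stands for ``stay'', the other black nodes are the black nodes of \<open>g\<close>. Trees attached to the left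
  of the children of the added root end up concatenated to the left of \<open>g\<close>.
\<close>

definition GL_basis :: "ef \<Rightarrow> ef \<Rightarrow> (ef \<Rightarrow>\<^sub>0 'k::field)" where
  "GL_basis \<pi> \<eta> = (let f = rep_even \<pi>; g = rep_odd \<eta> in
     \<Sum>\<phi> \<in> {..<length f} \<rightarrow>\<^sub>E black_nodes (Bplus g).
       basis (abs_ef (Bminus (graft (\<lambda>v. nths f {i. i < length f \<and> \<phi> i = v}) (Bplus g)))))"

definition GL_prod :: "(ef \<times> ef \<Rightarrow>\<^sub>0 'k::field) \<Rightarrow> (ef \<Rightarrow>\<^sub>0 'k)" where
  "GL_prod = lin_ext (\<lambda>(\<pi>, \<eta>). GL_basis \<pi> \<eta>)"


subsection \<open>Munthe-Kaas--Wright coproduct\<close>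

definition liana :: "dtree \<Rightarrow> nat list \<Rightarrow> nat list \<Rightarrow> bool" where
  "liana t v w \<longleftrightarrow> v \<in> nodes t \<and> w \<in> nodes t \<and> v \<noteq> w \<and> (\<exists>i. deco t v = Some i \<and> deco t w = Some i)"

text \<open>The edges on the path from \<open>v\<close> to the root are the non-empty prefixes of \<open>v\<close>.\<close>

definition admissible :: "dtree \<Rightarrow> nat list set \<Rightarrow> bool" where
  "admissible t c \<longleftrightarrow> c \<subseteq> edges t \<and>
     (\<forall>l \<in> leaves t. card {e \<in> c. prefix e l} \<le> 1) \<and>
     (\<forall>v i j. v @ [i] \<in> c \<and> j < i \<longrightarrow> v @ [j] \<in> c) \<and>
     (\<forall>v w. liana t v w \<and> (\<exists>e \<in> c. prefix e v) \<longrightarrow> (\<exists>e \<in> c. prefix e w))"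

text \<open>\<open>root_part c t\<close> is \<open>R\<^sup>c(t)\<close>, the component of the root after deletion of the edges in \<open>c\<close>.\<close>

function root_part :: "nat list set \<Rightarrow> 'd ptree \<Rightarrow> 'd ptree" where
  "root_part c (Node d ts) =
     Node d (map (\<lambda>i. root_part {p. i # p \<in> c} (ts ! i)) (filter (\<lambda>i. [i] \<notin> c) [0..<length ts]))"
  by pat_completeness auto
termination
  by (relation "measure (\<lambda>(c, t). size t)")
    (simp_all only: wf_measure in_measure case_prod_conv set_upt set_filter mem_Collect_eq atLeastLessThan_iff size_child)

text \<open>
  The enumerations of \<open>c\<close> in which edges below the same node occur from left to right, that is, the
  interleavings of the sequences of edges of \<open>c\<close> below the various nodes.
\<close>

definition cut_orders :: "nat list set \<Rightarrow> nat list list set" where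
  "cut_orders c = {l. distinct l \<and> set l = c \<and>
     sorted_wrt (\<lambda>e e'. butlast e = butlast e' \<longrightarrow> last e < last e') l}"

text \<open>
  \<open>P\<^sup>c(t)\<close>. Since an admissible cut has at most one edge on each path to the root, the component
  cut off by \<open>e\<close> is the whole subtree below \<open>e\<close>.
\<close>

definition pruned_part :: "nat list set \<Rightarrow> dtree \<Rightarrow> (ef \<Rightarrow>\<^sub>0 'k::field)" where
  "pruned_part c t = (\<Sum>l \<in> cut_orders c. basis (abs_ef (map (subtree t) l)))"

definition MKW_basis :: "ef \<Rightarrow> (ef \<times> ef \<Rightarrow>\<^sub>0 'k::field)" where
  "MKW_basis \<pi> = (let t = Bplus (rep_ef \<pi>) in
     \<Sum>c | admissible t c. pruned_part c t \<otimes> basis (abs_ef (Bminus (root_part c t))))"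

definition MKW :: "(ef \<Rightarrow>\<^sub>0 'k::field) \<Rightarrow> (ef \<times> ef \<Rightarrow>\<^sub>0 'k)" where
  "MKW = lin_ext MKW_basis"


subsection \<open>Unit and counit\<close>

definition EF_unit :: "ef \<Rightarrow>\<^sub>0 'k::field" where
  "EF_unit = basis empty_forest"

text \<open>The coefficient of the empty forest.\<close>

definition EF_counit :: "(ef \<Rightarrow>\<^sub>0 'k::field) \<Rightarrow> 'k" where
  "EF_counit x = Poly_Mapping.lookup x empty_forest"

end

theory Submission
  imports Defs "HOL-Library.Multiset"
begin

text \<open>
  Label the nodes of a forest by distinct labels, and let \<open>gr a\<close> attach the forest \<open>a x\<close> below the node
  labelled \<open>x\<close>, to the left of its children. Then \<open>gr a \<circ> gr b\<close> is again of the form \<open>gr c\<close>, so both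
  bracketings of a triple Grossman--Larson product are indexed by the same pairs of maps. The
  deshuffle coproduct sums over the sets of roots closed under lianas, and such a set for a grafting
  of \<open>\<pi>\<close> onto \<open>\<eta>\<close> amounts to closed sets for \<open>\<pi>\<close> and \<open>\<eta>\<close> compatible with the grafting map. This makes
  the Grossman--Larson product and the deshuffle coproduct a bialgebra. An ordered admissible cut of
  \<open>\<zeta>\<close> into \<open>\<pi>\<close> and \<open>\<eta>\<close> is the same as a grafting of \<open>\<pi>\<close> onto \<open>\<eta>\<close> with result \<open>\<zeta>\<close>, because planar forests have
  no automorphisms; likewise for shuffles and closed sets. Hence shuffle product and
  Munthe-Kaas--Wright coproduct are the transposes of deshuffle coproduct and Grossman--Larson
  product, and the bialgebra axioms transfer. The antipode is the alternating sum of the convolution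
  powers of \<open>J = id - unit \<circ> counit\<close>; this sum is locally finite because the number of nodes is a
  grading, and each convolution power of \<open>J\<close> in one bialgebra is the transpose of that in the other.
\<close>

subsection \<open>Linear maps between free vector spaces\<close>

text \<open>The obstacle is multiplicity over a quotient: a basis element is a class of forests up
  to renumbering, and one class arises from several grafting maps, cuts or interleavings. As the
  field is arbitrary, symmetry factors cannot be divided out, so every identity of coefficients has
  to come from a bijection of index sets. Labels are names of nodes that survive grafting and
  cutting; the second component of a label pair keeps the lianas visible. Each operation is first
  freed from the representative chosen in its definition, after which any labelled representatives
  that are disjoint in labels and numbers may be used. The axioms are checked on the
  Grossman--Larson side because iterated grafting is described by maps on roots alone, whereas
  iterated cuts would have to be recombined with shuffles. Attaching to the left of existing
  children corresponds to cuts being closed to the left, and disjointness of the numbers of two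
  factors corresponds to the liana condition on cuts.\<close>

abbreviation coeff :: "('b \<Rightarrow>\<^sub>0 'k::zero) \<Rightarrow> 'b \<Rightarrow> 'k" where
  "coeff \<equiv> Poly_Mapping.lookup"

abbreviation supp :: "('b \<Rightarrow>\<^sub>0 'k::zero) \<Rightarrow> 'b set" where
  "supp \<equiv> Poly_Mapping.keys"

lemma lookup_scale [simp]: "coeff (scale c x) b = c * coeff x b"
  by (simp add: scale_def Poly_Mapping.map.rep_eq when_def)

lemma lookup_basis: "coeff (basis a) b = (if a = b then 1 else 0)"
  by (simp add: basis_def lookup_single when_def)

lemma vector_space_scale: "vector_space (scale :: 'k::field \<Rightarrow> ('b \<Rightarrow>\<^sub>0 'k) \<Rightarrow> _)"
  by unfold_locales (auto intro!: poly_mapping_eqI simp: lookup_add algebra_simps)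

text \<open>Linearity as two bare equations, convenient for rewriting; \<open>lin_linear\<close>
  identifies it with the notion that \<open>hopf_algebra\<close> demands.\<close>

definition lin :: "(('a \<Rightarrow>\<^sub>0 'k::field) \<Rightarrow> ('b \<Rightarrow>\<^sub>0 'k)) \<Rightarrow> bool" where
  "lin f \<longleftrightarrow> (\<forall>x y. f (x + y) = f x + f y) \<and> (\<forall>c x. f (scale c x) = scale c (f x))"

lemma linI: "(\<And>x y. f (x + y) = f x + f y) \<Longrightarrow> (\<And>c x. f (scale c x) = scale c (f x)) \<Longrightarrow> lin f"
  by (simp add: lin_def)

lemma lin_add: "lin f \<Longrightarrow> f (x + y) = f x + f y"
  and lin_scale: "lin f \<Longrightarrow> f (scale c x) = scale c (f x)"
  by (simp_all add: lin_def)

lemma scale_zero [simp]: "scale 0 x = 0" "scale c 0 = 0"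
  and scale_one [simp]: "scale 1 x = x"
  and scale_scale [simp]: "scale a (scale b x) = scale (a * b) x"
  and scale_add: "scale c (x + y) = scale c x + scale c y" "scale (a + b) x = scale a x + scale b x"
  by (auto intro!: poly_mapping_eqI simp: lookup_add algebra_simps)

lemma scale_minus_one: "scale (- 1) x = - x"
  by (auto intro!: poly_mapping_eqI)

lemma lin_zero: "lin f \<Longrightarrow> f 0 = 0"
  using lin_scale[of f 0 0] by simp

lemma lin_minus: "lin f \<Longrightarrow> f (- x) = - f x"
  by (metis lin_scale scale_minus_one)

lemma lin_diff: "lin f \<Longrightarrow> f (x - y) = f x - f y"
  by (metis (no_types) diff_conv_add_uminus lin_add lin_minus)

lemma lin_sum: "lin f \<Longrightarrow> f (sum g A) = (\<Sum>a\<in>A. f (g a))"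
  by (induction A rule: infinite_finite_induct) (auto simp: lin_zero lin_add)

lemma lin_linear: "Vector_Spaces.linear scale scale f \<longleftrightarrow> lin f"
  by (simp add: Vector_Spaces.linear_iff vector_space_scale lin_def)

lemma lin_comp: "lin f \<Longrightarrow> lin g \<Longrightarrow> lin (\<lambda>x. f (g x))"
  by (simp add: lin_def)

lemma lin_id: "lin id" "lin (\<lambda>x. x)"
  by (simp_all add: lin_def)

lemma lin_scale_comp: "lin f \<Longrightarrow> lin (\<lambda>x. scale c (f x))"
  by (simp add: lin_def scale_add mult.commute)

lemma lin_plus: "lin f \<Longrightarrow> lin g \<Longrightarrow> lin (\<lambda>x. f x + g x)"
  by (simp add: lin_def scale_add algebra_simps)

lemma lin_minus_fun: "lin f \<Longrightarrow> lin g \<Longrightarrow> lin (\<lambda>x. f x - g x)"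
  by (auto simp: lin_def intro!: poly_mapping_eqI simp: lookup_add lookup_minus algebra_simps)

lemma lin_sum_fun: "(\<And>a. a \<in> A \<Longrightarrow> lin (f a)) \<Longrightarrow> lin (\<lambda>x. \<Sum>a\<in>A. f a x)"
  by (induction A rule: infinite_finite_induct) (auto simp: lin_plus, simp_all add: lin_def)

text \<open>Any finite superset of the support may serve as index set, so that the sums for
  \<open>x\<close>, \<open>y\<close> and \<open>x + y\<close> can be compared termwise.\<close>

lemma lookup_lin_ext:
  assumes "finite A" "supp x \<subseteq> A"
  shows "coeff (lin_ext f x) b =
    (\<Sum>a\<in>A. coeff x a * coeff (f a) b)"
proof -
  have "coeff (lin_ext f x) b =
    (\<Sum>a\<in>supp x. coeff x a * coeff (f a) b)"
    by (simp add: lin_ext_def lookup_sum)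
  also have "\<dots> = (\<Sum>a\<in>A. coeff x a * coeff (f a) b)"
    using assms by (intro sum.mono_neutral_left) (auto simp: in_keys_iff)
  finally show ?thesis .
qed

lemma lin_lin_ext [simp]: "lin (lin_ext f)"
proof (rule linI; rule poly_mapping_eqI)
  fix x y :: "'a \<Rightarrow>\<^sub>0 'b" and b
  let ?A = "supp x \<union> supp y"
  have "supp (x + y) \<subseteq> ?A" by (rule Poly_Mapping.keys_add)
  then show "coeff (lin_ext f (x + y)) b = coeff (lin_ext f x + lin_ext f y) b"
    using lookup_lin_ext[of ?A "x + y" f b] lookup_lin_ext[of ?A x f b] lookup_lin_ext[of ?A y f b]
    by (simp add: lookup_add sum.distrib algebra_simps)
next
  fix x :: "'a \<Rightarrow>\<^sub>0 'b" and c b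
  have "supp (scale c x) \<subseteq> supp x"
    by (auto simp: in_keys_iff)
  then show "coeff (lin_ext f (scale c x)) b = coeff (scale c (lin_ext f x)) b"
    using lookup_lin_ext[of "supp x" "scale c x" f b] lookup_lin_ext[of "supp x" x f b]
    by (simp add: sum_distrib_left algebra_simps)
qed

lemma lin_ext_basis [simp]: "lin_ext f (basis a) = f a"
  by (simp add: lin_ext_def basis_def)

lemma basis_expansion: "(\<Sum>a\<in>supp x. scale (coeff x a) (basis a)) = x"
  by (rule poly_mapping_eqI) (simp add: lookup_sum lookup_basis if_distrib in_keys_iff cong: if_cong)

lemma lin_eqI:
  assumes "lin f" "lin g" "\<And>a. f (basis a) = g (basis a)"
  shows "f x = g x"
proof -
  have "f (\<Sum>a\<in>supp x. scale (coeff x a) (basis a)) =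
      g (\<Sum>a\<in>supp x. scale (coeff x a) (basis a))"
    by (simp only: lin_sum[OF assms(1)] lin_sum[OF assms(2)] lin_scale[OF assms(1)]
        lin_scale[OF assms(2)] assms(3))
  then show ?thesis by (simp only: basis_expansion)
qed

lemma lin_ext_fun_lin:
  assumes "\<And>a. lin (\<lambda>y. f y a)"
  shows "lin (\<lambda>y. lin_ext (f y) x)"
  unfolding lin_ext_def by (intro lin_sum_fun lin_scale_comp assms)

lemma lin_tensor [simp]: "lin (\<lambda>x. x \<otimes> y)" "lin (\<lambda>y. x \<otimes> y)" "lin ((\<otimes>) x)"
proof -
  show "lin (\<lambda>x. x \<otimes> y)" unfolding tensor_def by simp
  show "lin (\<lambda>y. x \<otimes> y)"
    unfolding tensor_def by (rule lin_ext_fun_lin) simp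
  then show "lin ((\<otimes>) x)" .
qed

lemma basis_tensor [simp]: "basis a \<otimes> basis b = basis (a, b)"
  by (simp add: tensor_def)

lemmas tensor_simps = lin_add[OF lin_tensor(1)] lin_add[OF lin_tensor(2)]
  lin_scale[OF lin_tensor(1)] lin_scale[OF lin_tensor(2)]
  lin_diff[OF lin_tensor(1)] lin_diff[OF lin_tensor(2)]

lemma bilin_eqI:
  assumes "\<And>y. lin (\<lambda>x. f x y)" "\<And>x. lin (f x)" "\<And>y. lin (\<lambda>x. g x y)" "\<And>x. lin (g x)"
    and "\<And>a b. f (basis a) (basis b) = g (basis a) (basis b)"
  shows "f x y = g x y"
proof (rule lin_eqI[where f = "\<lambda>x. f x y" and g = "\<lambda>x. g x y"])
  fix a show "f (basis a) y = g (basis a) y"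
    by (rule lin_eqI[where f = "f (basis a)" and g = "g (basis a)"]) (use assms in auto)
qed (use assms in auto)

lemma lin_tensor_map [simp]: "lin (tensor_map f g)"
  by (simp add: tensor_map_def)

lemma tensor_map_basis [simp]: "tensor_map f g (basis (a, b)) = f (basis a) \<otimes> g (basis b)"
  by (simp add: tensor_map_def)

text \<open>\<open>tensor_map\<close> sees only the values of \<open>f\<close> and \<open>g\<close>
  on basis vectors; linearity recovers the formula on arbitrary pure tensors.\<close>

lemma tensor_map_tensor:
  assumes "lin f" "lin g"
  shows "tensor_map f g (x \<otimes> y) = f x \<otimes> g y"
  by (rule bilin_eqI[where f = "\<lambda>x y. tensor_map f g (x \<otimes> y)" and g = "\<lambda>x y. f x \<otimes> g y"])
    (auto intro: lin_comp[OF lin_tensor_map] lin_comp[OF lin_tensor(1)] lin_comp[OF lin_tensor(2)] assms)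

lemma lin_reassoc [simp]: "lin reassoc"
  and lin_interchange [simp]: "lin interchange"
  by (simp_all add: reassoc_def interchange_def)

lemma reassoc_basis [simp]: "reassoc (basis ((a, b), c)) = basis (a, (b, c))"
  by (simp add: reassoc_def)

lemma interchange_basis [simp]: "interchange (basis ((a, b), (c, d))) = basis ((a, c), (b, d))"
  by (simp add: interchange_def)

lemma reassoc_tensor [simp]: "reassoc ((x \<otimes> y) \<otimes> z) = x \<otimes> (y \<otimes> z)"
proof (rule lin_eqI[where f = "\<lambda>z. reassoc ((x \<otimes> y) \<otimes> z)" and g = "\<lambda>z. x \<otimes> (y \<otimes> z)"])
  fix c
  show "reassoc ((x \<otimes> y) \<otimes> basis c) = x \<otimes> (y \<otimes> basis c)"
    by (rule bilin_eqI[where f = "\<lambda>x y. reassoc ((x \<otimes> y) \<otimes> basis c)" and g = "\<lambda>x y. x \<otimes> (y \<otimes> basis c)"])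
      (auto intro!: lin_comp[OF lin_reassoc] lin_comp[OF lin_tensor(1)] lin_comp[OF lin_tensor(2)] lin_id)
qed (auto intro!: lin_comp[OF lin_reassoc] lin_comp[OF lin_tensor(2)] lin_id)

subsection \<open>The pairing\<close>

lemma pairing_superset:
  assumes "finite A" "supp x \<subseteq> A"
  shows "pairing x y = (\<Sum>b\<in>A. coeff x b * coeff y b)"
  unfolding pairing_def using assms by (intro sum.mono_neutral_left) (auto simp: in_keys_iff)

lemma pairing_commute: "pairing x y = pairing y x"
  using pairing_superset[of "supp x \<union> supp y" x y]
    pairing_superset[of "supp x \<union> supp y" y x]
  by (simp add: mult.commute)

lemma pairing_basis [simp]: "pairing (basis b) x = coeff x b"
  "pairing x (basis b) = coeff x b"
proof -
  show *: "pairing (basis b) x = coeff x b" for x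
    by (simp add: pairing_def basis_def)
  then show "pairing x (basis b) = coeff x b"
    by (simp add: pairing_commute[of x])
qed

lemma pairing_add_right: "pairing x (y + z) = pairing x y + pairing x z"
  and pairing_scale_right: "pairing x (scale c y) = c * pairing x y"
  by (simp_all add: pairing_def lookup_add sum.distrib sum_distrib_left algebra_simps)

lemma pairing_zero [simp]: "pairing x 0 = 0" "pairing 0 x = 0"
  by (simp_all add: pairing_def)

lemma pairing_add_left: "pairing (y + z) x = pairing y x + pairing z x"
  and pairing_scale_left: "pairing (scale c y) x = c * pairing y x"
  by (simp_all only: pairing_commute[of _ x] pairing_add_right pairing_scale_right)

lemma pairing_diff_right: "pairing x (y - z) = pairing x y - pairing x z"
  by (simp add: pairing_def lookup_minus sum_subtractf algebra_simps)

lemma pairing_diff_left: "pairing (y - z) x = pairing y x - pairing z x"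
  by (simp only: pairing_commute[of _ x] pairing_diff_right)

lemma pairing_sum_right: "pairing x (sum f A) = (\<Sum>a\<in>A. pairing x (f a))"
  by (induction A rule: infinite_finite_induct) (auto simp: pairing_add_right)

lemma pairing_sum_left: "pairing (sum f A) x = (\<Sum>a\<in>A. pairing (f a) x)"
  by (simp only: pairing_commute[of _ x] pairing_sum_right)

lemma pairing_eqI: "(\<And>z. pairing x z = pairing y z) \<Longrightarrow> x = y"
  by (metis pairing_basis(2) poly_mapping_eqI)

lemma pairing_tensor_eqI:
  fixes x y :: "'a \<times> 'b \<Rightarrow>\<^sub>0 'k::field"
  shows "(\<And>s t. pairing x (s \<otimes> t) = pairing y (s \<otimes> t)) \<Longrightarrow> x = y"
proof (rule poly_mapping_eqI)
  fix k :: "'a \<times> 'b"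
  assume "\<And>s t. pairing x (s \<otimes> t) = pairing y (s \<otimes> t)"
  from this[of "basis (fst k)" "basis (snd k)"]
  show "coeff x k = coeff y k" by simp
qed

text \<open>In infinite dimension a linear map need not have a transpose on the same space. For
  linear maps, \<open>adj\<close> asserts that it has one, which means that the matrix of
  \<open>f\<close> has finite rows as well as finite columns.\<close>

definition adj :: "(('a \<Rightarrow>\<^sub>0 'k::field) \<Rightarrow> ('b \<Rightarrow>\<^sub>0 'k)) \<Rightarrow> (('b \<Rightarrow>\<^sub>0 'k) \<Rightarrow> ('a \<Rightarrow>\<^sub>0 'k)) \<Rightarrow> bool" where
  "adj f g \<longleftrightarrow> (\<forall>x y. pairing (f x) y = pairing x (g y))"

lemma adjD: "adj f g \<Longrightarrow> pairing (f x) y = pairing x (g y)"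
  by (simp add: adj_def)

lemma adj_sym: "adj f g \<Longrightarrow> adj g f"
  by (simp add: adj_def pairing_commute)

lemma adjI_basis:
  fixes f :: "('a \<Rightarrow>\<^sub>0 'k::field) \<Rightarrow> ('b \<Rightarrow>\<^sub>0 'k)"
  assumes "lin f" "lin g"
    and "\<And>a b. coeff (f (basis a)) b = coeff (g (basis b)) a"
  shows "adj f g"
  unfolding adj_def
proof (intro allI)
  fix x :: "'a \<Rightarrow>\<^sub>0 'k" and y :: "'b \<Rightarrow>\<^sub>0 'k"
  let ?X = "supp x" and ?Y = "supp y"
  have "pairing (f x) y = pairing (f (\<Sum>a\<in>?X. scale (coeff x a) (basis a)))
      (\<Sum>b\<in>?Y. scale (coeff y b) (basis b))"
    by (simp only: basis_expansion)
  also have "\<dots> = pairing (\<Sum>a\<in>?X. scale (coeff x a) (basis a))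
      (g (\<Sum>b\<in>?Y. scale (coeff y b) (basis b)))"
    by (simp add: lin_sum[OF assms(1)] lin_sum[OF assms(2)] lin_scale[OF assms(1)] lin_scale[OF assms(2)]
        pairing_sum_left pairing_sum_right pairing_scale_left pairing_scale_right lookup_sum assms(3))
  also have "\<dots> = pairing x (g y)" by (simp only: basis_expansion)
  finally show "pairing (f x) y = pairing x (g y)" .
qed

lemma adj_id: "adj id id" "adj (\<lambda>x. x) (\<lambda>x. x)"
  by (simp_all add: adj_def)

lemma lookup_tensor: "coeff (x \<otimes> y) (a, b) = coeff x a * coeff y b"
proof -
  have inner: "coeff (lin_ext (\<lambda>b. basis (a', b)) y) (a, b) =
      (if a' = a then coeff y b else 0)" for a'
    by (subst lookup_lin_ext[OF finite_keys order_refl])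
      (auto simp: lookup_basis if_distrib in_keys_iff cong: if_cong)
  show ?thesis
    unfolding tensor_def
    by (subst lookup_lin_ext[OF finite_keys order_refl])
      (simp add: inner if_distrib in_keys_iff cong: if_cong)
qed

text \<open>The matrix of a tensor product of maps is a Kronecker product, which is transposed
  factorwise.\<close>

lemma adj_tensor_map:
  assumes "lin f" "lin f'" "lin g" "lin g'" "adj f f'" "adj g g'"
  shows "adj (tensor_map f g) (tensor_map f' g')"
proof (rule adjI_basis)
  have f: "coeff (f (basis a)) b = coeff (f' (basis b)) a" for a b
    using adjD[OF assms(5), of "basis a" "basis b"] by simp
  have g: "coeff (g (basis a)) b = coeff (g' (basis b)) a" for a b
    using adjD[OF assms(6), of "basis a" "basis b"] by simp
  show "coeff (tensor_map f g (basis a)) b = coeff (tensor_map f' g' (basis b)) a"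
    for a b
    by (cases a; cases b) (simp add: lookup_tensor f g)
qed simp_all

text \<open>The inverse of \<open>reassoc\<close>, and also its transpose, because
  \<open>reassoc\<close> permutes basis vectors.\<close>

definition unassoc :: "('a \<times> ('b \<times> 'c) \<Rightarrow>\<^sub>0 'k::field) \<Rightarrow> (('a \<times> 'b) \<times> 'c \<Rightarrow>\<^sub>0 'k)" where
  "unassoc = lin_ext (\<lambda>(a, (b, c)). basis ((a, b), c))"

lemma lin_unassoc [simp]: "lin unassoc"
  by (simp add: unassoc_def)

lemma unassoc_basis [simp]: "unassoc (basis (a, (b, c))) = basis ((a, b), c)"
  by (simp add: unassoc_def)

lemma unassoc_reassoc [simp]: "unassoc (reassoc x) = x"
  by (rule lin_eqI[where f = "\<lambda>x. unassoc (reassoc x)" and g = "\<lambda>x. x"])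
    (auto intro: lin_comp[OF lin_unassoc] lin_id)

lemma adj_reassoc: "adj reassoc unassoc"
  by (rule adjI_basis) (auto simp: lookup_basis)

lemma adj_interchange: "adj interchange interchange"
  by (rule adjI_basis) (auto simp: lookup_basis)

subsection \<open>Bialgebras\<close>

text \<open>The axioms of \<open>hopf_algebra\<close> that precede the antipode. They are isolated
  because the list is self-dual: transposition exchanges associativity with coassociativity and unit
  with counit, and keeps the compatibility of product and coproduct.\<close>

locale bialgebra =
  fixes mult :: "('b \<times> 'b \<Rightarrow>\<^sub>0 'k::field) \<Rightarrow> ('b \<Rightarrow>\<^sub>0 'k)"
    and unit :: "'b \<Rightarrow>\<^sub>0 'k"
    and comult :: "('b \<Rightarrow>\<^sub>0 'k) \<Rightarrow> ('b \<times> 'b \<Rightarrow>\<^sub>0 'k)"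
    and counit :: "('b \<Rightarrow>\<^sub>0 'k) \<Rightarrow> 'k"
  assumes lin_mult: "lin mult"
    and lin_comult: "lin comult"
    and counit_add: "counit (x + y) = counit x + counit y"
    and counit_scale: "counit (scale c x) = c * counit x"
    and mult_assoc: "mult (mult (x \<otimes> y) \<otimes> z) = mult (x \<otimes> mult (y \<otimes> z))"
    and mult_unit_left: "mult (unit \<otimes> x) = x"
    and mult_unit_right: "mult (x \<otimes> unit) = x"
    and comult_coassoc: "reassoc (tensor_map comult id (comult x)) = tensor_map id comult (comult x)"
    and counit_left: "lin_ext (\<lambda>(a, b). scale (counit (basis a)) (basis b)) (comult x) = x"
    and counit_right: "lin_ext (\<lambda>(a, b). scale (counit (basis b)) (basis a)) (comult x) = x"
    and comult_mult: "comult (mult (x \<otimes> y)) = tensor_map mult mult (interchange (comult x \<otimes> comult y))"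
    and comult_unit: "comult unit = unit \<otimes> unit"
    and counit_mult: "counit (mult (x \<otimes> y)) = counit x * counit y"
    and counit_unit: "counit unit = 1"

lemma pairing_tensor: "pairing (x \<otimes> y) (s \<otimes> t) = pairing x s * pairing y t"
proof -
  have sub: "supp (x \<otimes> y) \<subseteq> supp x \<times> supp y"
    by (auto simp: in_keys_iff lookup_tensor)
  have "pairing (x \<otimes> y) (s \<otimes> t) = (\<Sum>(a, b)\<in>supp x \<times> supp y.
      (coeff x a * coeff s a) * (coeff y b * coeff t b))"
    by (subst pairing_superset[OF _ sub]) (auto simp: lookup_tensor mult_ac intro!: sum.cong)
  also have "\<dots> = pairing x s * pairing y t"
    unfolding pairing_def sum_product sum.cartesian_product ..
  finally show ?thesis .
qed

text \<open>Tensoring with \<open>u\<close> is the transpose of contracting with the functional that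
  \<open>u\<close> represents; this turns counit laws into unit laws.\<close>

lemma pairing_contract_left:
  assumes "\<And>a. c (basis a) = coeff u a"
  shows "pairing (u \<otimes> x) t = pairing x (lin_ext (\<lambda>(a, b). scale (c (basis a)) (basis b)) t)"
proof -
  have "adj (\<lambda>x. u \<otimes> x) (lin_ext (\<lambda>(a, b). scale (c (basis a)) (basis b)))"
    by (rule adjI_basis) (auto simp: lookup_tensor lookup_basis assms)
  then show ?thesis by (rule adjD)
qed

lemma pairing_contract_right:
  assumes "\<And>a. c (basis a) = coeff u a"
  shows "pairing (x \<otimes> u) t = pairing x (lin_ext (\<lambda>(a, b). scale (c (basis b)) (basis a)) t)"
proof -
  have "adj (\<lambda>x. x \<otimes> u) (lin_ext (\<lambda>(a, b). scale (c (basis b)) (basis a)))"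
    by (rule adjI_basis) (auto simp: lookup_tensor lookup_basis assms)
  then show ?thesis by (rule adjD)
qed

text \<open>Each axiom is tested against an arbitrary vector or pure tensor and moved across the
  pairing, where it becomes the dual axiom of the other bialgebra.\<close>

lemma bialgebra_transpose:
  fixes mult :: "('b \<times> 'b \<Rightarrow>\<^sub>0 'k::field) \<Rightarrow> ('b \<Rightarrow>\<^sub>0 'k)"
  assumes B: "bialgebra mult' unit' comult' counit'"
    and lin: "lin mult" "lin comult"
    and adj: "adj mult comult'" "adj comult mult'"
    and unit: "\<And>x. pairing unit x = counit' x"
    and counit: "\<And>x. counit x = pairing x unit'"
  shows "bialgebra mult unit comult counit"
proof -
  interpret B: bialgebra mult' unit' comult' counit' by (rule B)
  note m = adjD[OF adj(1)] and d = adjD[OF adj(2)]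
  have mi: "adj (tensor_map mult id) (tensor_map comult' id)"
    and im: "adj (tensor_map id mult) (tensor_map id comult')"
    and di: "adj (tensor_map comult id) (tensor_map mult' id)"
    and id: "adj (tensor_map id comult) (tensor_map id mult')"
    and mm: "adj (tensor_map mult mult) (tensor_map comult' comult')"
    and dd: "adj (tensor_map comult comult) (tensor_map mult' mult')"
    by (intro adj_tensor_map lin adj adj_id lin_id B.lin_mult B.lin_comult)+
  note tm = tensor_map_tensor[OF _ lin_id(1)] tensor_map_tensor[OF lin_id(1)]
  have counit_basis: "counit (basis a) = coeff unit' a" for a
    by (simp add: counit)
  have counit'_basis: "counit' (basis a) = coeff unit a" for a
    by (simp add: unit[symmetric])
  show ?thesis
  proof
    show "lin mult" "lin comult" by (rule lin)+
    show "counit (x + y) = counit x + counit y" for x y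
      by (simp add: counit pairing_add_left)
    show "counit (scale c x) = c * counit x" for c x
      by (simp add: counit pairing_scale_left)
    show "mult (mult (x \<otimes> y) \<otimes> z) = mult (x \<otimes> mult (y \<otimes> z))" for x y z
    proof (rule pairing_eqI)
      fix w
      have "pairing (mult (mult (x \<otimes> y) \<otimes> z)) w = pairing (tensor_map mult id ((x \<otimes> y) \<otimes> z)) (comult' w)"
        by (simp add: m tm lin)
      \<comment> \<open>Inserting \<open>unassoc\<close> after \<open>reassoc\<close> produces the
        left-hand side of coassociativity.\<close>
      also have "\<dots> = pairing ((x \<otimes> y) \<otimes> z) (unassoc (reassoc (tensor_map comult' id (comult' w))))"
        by (simp add: adjD[OF mi])
      also have "\<dots> = pairing (reassoc ((x \<otimes> y) \<otimes> z)) (tensor_map id comult' (comult' w))"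
        by (simp only: adjD[OF adj_reassoc] B.comult_coassoc)
      also have "\<dots> = pairing (mult (x \<otimes> mult (y \<otimes> z))) w"
        by (simp add: adjD[OF im, symmetric] m tm lin)
      finally show "pairing (mult (mult (x \<otimes> y) \<otimes> z)) w = pairing (mult (x \<otimes> mult (y \<otimes> z))) w" .
    qed
    show "mult (unit \<otimes> x) = x" for x
      by (rule pairing_eqI)
        (simp only: m pairing_contract_left[where c = counit', OF counit'_basis] B.counit_left)
    show "mult (x \<otimes> unit) = x" for x
      by (rule pairing_eqI)
        (simp only: m pairing_contract_right[where c = counit', OF counit'_basis] B.counit_right)
    show "reassoc (tensor_map comult id (comult x)) = tensor_map id comult (comult x)" for x
    proof (rule pairing_eqI)
      fix w
      show "pairing (reassoc (tensor_map comult id (comult x))) w = pairing (tensor_map id comult (comult x)) w"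
      proof (simp only: adjD[OF adj_reassoc] adjD[OF di] adjD[OF id] d)
        \<comment> \<open>Associativity is an axiom about pure tensors; linearity extends it to
          every \<open>w\<close>.\<close>
        have "mult' (tensor_map mult' id (unassoc w)) = mult' (tensor_map id mult' w)"
        proof (rule lin_eqI[where f = "\<lambda>w. mult' (tensor_map mult' id (unassoc w))"])
          fix a show "mult' (tensor_map mult' id (unassoc (basis a))) = mult' (tensor_map id mult' (basis a))"
            using B.mult_assoc[of "basis (fst a)" "basis (fst (snd a))" "basis (snd (snd a))"]
            by (cases a) auto
        qed (intro lin_comp[OF B.lin_mult] lin_comp[OF lin_tensor_map] lin_unassoc lin_tensor_map lin_id)+
        then show "pairing x (mult' (tensor_map mult' id (unassoc w))) = pairing x (mult' (tensor_map id mult' w))"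
          by simp
      qed
    qed
    show "lin_ext (\<lambda>(a, b). scale (counit (basis a)) (basis b)) (comult x) = x" for x
      by (rule pairing_eqI)
        (subst pairing_commute, subst pairing_contract_left[where c = counit, OF counit_basis, symmetric],
          simp only: pairing_commute[of _ "comult x"] d B.mult_unit_left)
    show "lin_ext (\<lambda>(a, b). scale (counit (basis b)) (basis a)) (comult x) = x" for x
      by (rule pairing_eqI)
        (subst pairing_commute, subst pairing_contract_right[where c = counit, OF counit_basis, symmetric],
          simp only: pairing_commute[of _ "comult x"] d B.mult_unit_right)
    show "comult (mult (x \<otimes> y)) = tensor_map mult mult (interchange (comult x \<otimes> comult y))" for x y
    proof (rule pairing_tensor_eqI)
      fix s t
      have "pairing (comult (mult (x \<otimes> y))) (s \<otimes> t) =
          pairing (x \<otimes> y) (tensor_map mult' mult' (interchange (comult' s \<otimes> comult' t)))"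
        by (simp only: d m B.comult_mult)
      also have "\<dots> = pairing (comult x \<otimes> comult y) (interchange (comult' s \<otimes> comult' t))"
        by (simp only: adjD[OF dd, symmetric] tensor_map_tensor lin)
      also have "\<dots> = pairing (interchange (comult x \<otimes> comult y)) (tensor_map comult' comult' (s \<otimes> t))"
        by (simp only: adjD[OF adj_interchange] tensor_map_tensor B.lin_comult)
      also have "\<dots> = pairing (tensor_map mult mult (interchange (comult x \<otimes> comult y))) (s \<otimes> t)"
        by (simp only: adjD[OF mm])
      finally show "pairing (comult (mult (x \<otimes> y))) (s \<otimes> t) =
        pairing (tensor_map mult mult (interchange (comult x \<otimes> comult y))) (s \<otimes> t)" .
    qed
    show "comult unit = unit \<otimes> unit"
      by (rule pairing_tensor_eqI) (simp only: d unit B.counit_mult pairing_tensor)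
    show "counit (mult (x \<otimes> y)) = counit x * counit y" for x y
      by (simp only: counit m B.comult_unit pairing_tensor)
    show "counit unit = 1"
      by (simp only: counit unit B.counit_unit)
  qed
qed

lemma lin_eq_sum: "lin f \<Longrightarrow>
    f x = (\<Sum>a\<in>supp x. scale (coeff x a) (f (basis a)))"
  using lin_sum[of f "\<lambda>a. scale (coeff x a) (basis a)" "supp x"]
  by (simp add: basis_expansion lin_scale)

section \<open>Convolution and the antipode of a connected graded bialgebra\<close>

context bialgebra
begin

definition conv :: "(('b \<Rightarrow>\<^sub>0 'k) \<Rightarrow> ('b \<Rightarrow>\<^sub>0 'k)) \<Rightarrow> (('b \<Rightarrow>\<^sub>0 'k) \<Rightarrow> ('b \<Rightarrow>\<^sub>0 'k)) \<Rightarrow> ('b \<Rightarrow>\<^sub>0 'k) \<Rightarrow> ('b \<Rightarrow>\<^sub>0 'k)"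
  where "conv f g x = mult (tensor_map f g (comult x))"

definition conv_unit :: "('b \<Rightarrow>\<^sub>0 'k) \<Rightarrow> ('b \<Rightarrow>\<^sub>0 'k)" where
  "conv_unit x = scale (counit x) unit"

lemma lin_conv_unit: "lin conv_unit"
  by (rule linI) (simp_all add: conv_unit_def counit_add counit_scale scale_add)

lemma lin_conv: "lin (conv f g)"
  unfolding conv_def by (intro lin_comp[OF lin_mult] lin_comp[OF lin_tensor_map] lin_comult)

text \<open>Both bracketings are the threefold coproduct, then \<open>f\<close>, \<open>g\<close>,
  \<open>h\<close> on the factors, then the threefold product; the three auxiliary facts bring them
  to this form on basis vectors.\<close>

lemma conv_assoc:
  assumes "lin f" "lin g" "lin h"
  shows "conv (conv f g) h x = conv f (conv g h) x"
proof -
  have l: "tensor_map (conv f g) h y =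
      tensor_map mult id (tensor_map (tensor_map f g) h (tensor_map comult id y))" for y
  proof (rule lin_eqI[where f = "tensor_map (conv f g) h"])
    fix a show "tensor_map (conv f g) h (basis a) =
      tensor_map mult id (tensor_map (tensor_map f g) h (tensor_map comult id (basis a)))"
      using assms by (cases a) (simp add: tensor_map_tensor lin_mult lin_id(1) conv_def)
  qed (intro lin_comp[OF lin_tensor_map] lin_tensor_map lin_id)+
  have r: "tensor_map f (conv g h) y =
      tensor_map id mult (tensor_map f (tensor_map g h) (tensor_map id comult y))" for y
  proof (rule lin_eqI[where f = "tensor_map f (conv g h)"])
    fix a show "tensor_map f (conv g h) (basis a) =
      tensor_map id mult (tensor_map f (tensor_map g h) (tensor_map id comult (basis a)))"
      using assms by (cases a) (simp add: tensor_map_tensor lin_mult lin_id(1) conv_def)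
  qed (intro lin_comp[OF lin_tensor_map] lin_tensor_map lin_id)+
  have mid: "mult (tensor_map mult id (tensor_map (tensor_map f g) h y)) =
      mult (tensor_map id mult (tensor_map f (tensor_map g h) (reassoc y)))" for y
  proof (rule lin_eqI[where f = "\<lambda>y. mult (tensor_map mult id (tensor_map (tensor_map f g) h y))"])
    fix a :: "('b \<times> 'b) \<times> 'b"
    obtain b c d where a: "a = ((b, c), d)" by (cases a) auto
    show "mult (tensor_map mult id (tensor_map (tensor_map f g) h (basis a))) =
      mult (tensor_map id mult (tensor_map f (tensor_map g h) (reassoc (basis a))))"
      by (simp add: a tensor_map_tensor lin_mult lin_id(1) mult_assoc)
  qed (intro lin_comp[OF lin_tensor_map] lin_comp[OF lin_mult] lin_tensor_map lin_reassoc lin_id)+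
  show ?thesis
    by (subst conv_def[of "conv f g"], subst conv_def[of f]) (simp only: l r mid comult_coassoc)
qed

lemma conv_unit_left:
  assumes "lin f" shows "conv conv_unit f x = f x"
proof -
  have "mult (tensor_map conv_unit f y) = f (lin_ext (\<lambda>(a, b). scale (counit (basis a)) (basis b)) y)" for y
  proof (rule lin_eqI[where f = "\<lambda>y. mult (tensor_map conv_unit f y)"])
    fix a show "mult (tensor_map conv_unit f (basis a)) =
      f (lin_ext (\<lambda>(a, b). scale (counit (basis a)) (basis b)) (basis a))"
      by (cases a) (simp add: conv_unit_def tensor_simps lin_scale lin_mult assms mult_unit_left)
  qed (intro lin_comp[OF lin_mult] lin_comp[OF assms] lin_tensor_map lin_lin_ext)+
  then show ?thesis by (simp add: conv_def counit_left)
qed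

lemma conv_unit_right:
  assumes "lin f" shows "conv f conv_unit x = f x"
proof -
  have "mult (tensor_map f conv_unit y) = f (lin_ext (\<lambda>(a, b). scale (counit (basis b)) (basis a)) y)" for y
  proof (rule lin_eqI[where f = "\<lambda>y. mult (tensor_map f conv_unit y)"])
    fix a show "mult (tensor_map f conv_unit (basis a)) =
      f (lin_ext (\<lambda>(a, b). scale (counit (basis b)) (basis a)) (basis a))"
      by (cases a) (simp add: conv_unit_def tensor_simps lin_scale lin_mult assms mult_unit_right)
  qed (intro lin_comp[OF lin_mult] lin_comp[OF assms] lin_tensor_map lin_lin_ext)+
  then show ?thesis by (simp add: conv_def counit_right)
qed

text \<open>Expansion along the terms of the coproduct, which makes the degrees of the two factors
  accessible.\<close>

lemma conv_basis: "conv f g x = (\<Sum>(b, c)\<in>supp (comult x).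
    scale (coeff (comult x) (b, c)) (mult (f (basis b) \<otimes> g (basis c))))"
proof -
  have "lin (\<lambda>y. mult (tensor_map f g y))" by (intro lin_comp[OF lin_mult] lin_tensor_map)
  from lin_eq_sum[OF this, of "comult x"] show ?thesis
    unfolding conv_def by (rule trans) (rule sum.cong, auto)
qed

text \<open>The convolution powers of \<open>J\<close>, with the neutral element of convolution as
  zeroth power.\<close>

primrec redpow :: "nat \<Rightarrow> ('b \<Rightarrow>\<^sub>0 'k) \<Rightarrow> ('b \<Rightarrow>\<^sub>0 'k)" where
  "redpow 0 = conv_unit"
| "redpow (Suc n) = conv (\<lambda>x. x - conv_unit x) (redpow n)"

lemma lin_red: "lin (\<lambda>x. x - conv_unit x)"
  by (intro lin_minus_fun lin_id lin_conv_unit)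

lemma lin_redpow: "lin (redpow n)"
  by (induction n) (auto simp: lin_conv_unit lin_conv)

text \<open>Splitting off \<open>J\<close> on the right is what the identity for the antipode as
  left factor needs.\<close>

lemma redpow_Suc_right: "redpow (Suc n) x = conv (redpow n) (\<lambda>x. x - conv_unit x) x"
proof (induction n arbitrary: x)
  case 0
  then show ?case by (simp add: conv_unit_left conv_unit_right lin_red)
next
  case (Suc n)
  then have "redpow (Suc n) = conv (redpow n) (\<lambda>x. x - conv_unit x)" by (rule ext)
  then have "redpow (Suc (Suc n)) = conv (\<lambda>x. x - conv_unit x) (conv (redpow n) (\<lambda>x. x - conv_unit x))"
    by (metis redpow.simps(2))
  then show ?case by (simp add: conv_assoc[OF lin_red lin_redpow lin_red])
qed

text \<open>\<open>id\<close> is the sum of \<open>J\<close> and \<open>conv_unit\<close>, and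
  \<open>conv_unit\<close> is neutral for convolution.\<close>

lemma conv_id_left: "lin f \<Longrightarrow> conv id f x = conv (\<lambda>x. x - conv_unit x) f x + f x"
proof -
  assume f: "lin f"
  have "tensor_map id f y = tensor_map (\<lambda>x. x - conv_unit x) f y + tensor_map conv_unit f y" for y
  proof (rule lin_eqI[where f = "tensor_map id f"])
    fix a show "tensor_map id f (basis a) =
        tensor_map (\<lambda>x. x - conv_unit x) f (basis a) + tensor_map conv_unit f (basis a)"
      by (cases a) (simp add: lin_diff[OF lin_tensor(1)])
  qed (intro lin_plus lin_tensor_map)+
  then have "conv id f x = conv (\<lambda>x. x - conv_unit x) f x + conv conv_unit f x"
    by (simp add: conv_def lin_add[OF lin_mult])
  then show ?thesis by (simp add: conv_unit_left f)
qed

lemma conv_id_right: "lin f \<Longrightarrow> conv f id x = conv f (\<lambda>x. x - conv_unit x) x + f x"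
proof -
  assume f: "lin f"
  have "tensor_map f id y = tensor_map f (\<lambda>x. x - conv_unit x) y + tensor_map f conv_unit y" for y
  proof (rule lin_eqI[where f = "tensor_map f id"])
    fix a show "tensor_map f id (basis a) =
        tensor_map f (\<lambda>x. x - conv_unit x) (basis a) + tensor_map f conv_unit (basis a)"
      by (cases a) (simp add: lin_diff[OF lin_tensor(2)])
  qed (intro lin_plus lin_tensor_map)+
  then have "conv f id x = conv f (\<lambda>x. x - conv_unit x) x + conv f conv_unit x"
    by (simp add: conv_def lin_add[OF lin_mult])
  then show ?thesis by (simp add: conv_unit_right f)
qed

end

text \<open>Homogeneity is imposed on the coproduct, because the iterated coproduct is what exhausts
  the degree under powers of \<open>J\<close>.\<close>

locale connected_bialgebra = bialgebra mult unit comult counit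
  for mult :: "('b \<times> 'b \<Rightarrow>\<^sub>0 'k::field) \<Rightarrow> ('b \<Rightarrow>\<^sub>0 'k)" and unit comult counit +
  fixes deg :: "'b \<Rightarrow> nat" and one :: 'b
  assumes unit_one: "unit = basis one"
    and counit_basis: "counit (basis a) = (if a = one then 1 else 0)"
    and deg_pos: "a \<noteq> one \<Longrightarrow> 0 < deg a"
    and deg_one: "deg one = 0"
    and deg_comult: "(b, c) \<in> supp (comult (basis a)) \<Longrightarrow> deg b + deg c = deg a"
begin

text \<open>\<open>J\<close> kills \<open>one\<close>, and every other left factor has positive
  degree, so each further convolution with \<open>J\<close> uses up at least one degree.\<close>

lemma redpow_vanish: "deg a < n \<Longrightarrow> redpow n (basis a) = 0"
proof (induction n arbitrary: a)
  case (Suc n)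
  have "mult ((basis b - conv_unit (basis b)) \<otimes> redpow n (basis c)) = 0"
    if bc: "(b, c) \<in> supp (comult (basis a))" for b c
  proof (cases "b = one")
    case True
    have J: "basis b - conv_unit (basis b) = 0"
      unfolding True conv_unit_def counit_basis by (simp add: unit_one[symmetric])
    show ?thesis by (simp only: J lin_zero[OF lin_tensor(1)] lin_zero[OF lin_mult])
  next
    case False
    then have "deg c < n" using deg_comult[OF bc] deg_pos[of b] Suc.prems by simp
    then show ?thesis by (simp only: Suc.IH lin_zero[OF lin_tensor(2)] lin_zero[OF lin_mult])
  qed
  then show ?case unfolding redpow.simps conv_basis by (intro sum.neutral) auto
qed simp

text \<open>The geometric series for the convolution inverse of \<open>id\<close>, read as neutral
  element plus \<open>J\<close>. On \<open>basis a\<close> it may stop at \<open>deg a\<close> by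
  \<open>redpow_vanish\<close>.\<close>

definition antipode :: "('b \<Rightarrow>\<^sub>0 'k) \<Rightarrow> ('b \<Rightarrow>\<^sub>0 'k)" where
  "antipode = lin_ext (\<lambda>a. \<Sum>n\<le>deg a. scale ((- 1) ^ n) (redpow n (basis a)))"

lemma antipode_basis:
  assumes "deg a \<le> N"
  shows "antipode (basis a) = (\<Sum>n\<le>N. scale ((- 1) ^ n) (redpow n (basis a)))"
  unfolding antipode_def lin_ext_basis
  using assms by (intro sum.mono_neutral_left) (auto simp: redpow_vanish)

lemma lin_antipode: "lin antipode"
  by (simp add: antipode_def)

lemma lin_partial: "lin (\<lambda>x. \<Sum>n\<le>N. scale ((- 1) ^ n) (redpow n x))"
  by (intro lin_sum_fun lin_scale_comp lin_redpow)

text \<open>The telescoping identity for a finite geometric series: multiplying the partial sum by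
  one plus \<open>J\<close> leaves the neutral element and one remainder of order
  \<open>Suc N\<close>.\<close>

lemma conv_partial:
  fixes N and x
  defines "f \<equiv> \<lambda>x. \<Sum>n\<le>N. scale ((- 1) ^ n) (redpow n x)"
  shows "conv id f x = conv_unit x + scale ((- 1) ^ N) (redpow (Suc N) x)"
    and "conv f id x = conv_unit x + scale ((- 1) ^ N) (redpow (Suc N) x)"
proof -
  have f: "lin f" unfolding f_def by (rule lin_partial)
  have 1: "conv id f x = (\<Sum>n\<le>N. scale ((- 1) ^ n) (redpow (Suc n) x)) + f x"
  proof -
    have "tensor_map (\<lambda>x. x - conv_unit x) f y =
        (\<Sum>n\<le>N. scale ((- 1) ^ n) (tensor_map (\<lambda>x. x - conv_unit x) (redpow n) y))" for y
    proof (rule lin_eqI[where f = "tensor_map (\<lambda>x. x - conv_unit x) f"])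
      fix a show "tensor_map (\<lambda>x. x - conv_unit x) f (basis a) =
        (\<Sum>n\<le>N. scale ((- 1) ^ n) (tensor_map (\<lambda>x. x - conv_unit x) (redpow n) (basis a)))"
        by (cases a) (simp add: f_def lin_sum[OF lin_tensor(2)] lin_scale[OF lin_tensor(2)])
    qed (intro lin_sum_fun lin_scale_comp lin_tensor_map)+
    then have "conv (\<lambda>x. x - conv_unit x) f x = (\<Sum>n\<le>N. scale ((- 1) ^ n) (redpow (Suc n) x))"
      by (simp add: conv_def lin_sum[OF lin_mult] lin_scale[OF lin_mult])
    then show ?thesis using conv_id_left[OF f] by simp
  qed
  have 2: "conv f id x = (\<Sum>n\<le>N. scale ((- 1) ^ n) (redpow (Suc n) x)) + f x"
  proof -
    have "tensor_map f (\<lambda>x. x - conv_unit x) y =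
        (\<Sum>n\<le>N. scale ((- 1) ^ n) (tensor_map (redpow n) (\<lambda>x. x - conv_unit x) y))" for y
    proof (rule lin_eqI[where f = "tensor_map f (\<lambda>x. x - conv_unit x)"])
      fix a show "tensor_map f (\<lambda>x. x - conv_unit x) (basis a) =
        (\<Sum>n\<le>N. scale ((- 1) ^ n) (tensor_map (redpow n) (\<lambda>x. x - conv_unit x) (basis a)))"
        by (cases a) (simp add: f_def lin_sum[OF lin_tensor(1)] lin_scale[OF lin_tensor(1)])
    qed (intro lin_sum_fun lin_scale_comp lin_tensor_map)+
    then have "conv f (\<lambda>x. x - conv_unit x) x = (\<Sum>n\<le>N. scale ((- 1) ^ n) (redpow (Suc n) x))"
      by (simp add: conv_def lin_sum[OF lin_mult] lin_scale[OF lin_mult] redpow_Suc_right del: redpow.simps(2))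
    then show ?thesis using conv_id_right[OF f] by simp
  qed
  have 3: "(\<Sum>n\<le>N. scale ((- 1) ^ n) (redpow (Suc n) x)) + f x =
      conv_unit x + scale ((- 1) ^ N) (redpow (Suc N) x)"
    unfolding f_def
  proof (induction N)
    case (Suc N)
    have "scale ((- 1) ^ Suc N) y = - scale ((- 1) ^ N) y" for y :: "'b \<Rightarrow>\<^sub>0 'k"
      by (auto intro!: poly_mapping_eqI)
    with Suc show ?case by (simp add: algebra_simps del: redpow.simps)
  qed simp
  show "conv id f x = conv_unit x + scale ((- 1) ^ N) (redpow (Suc N) x)" unfolding 1 3 ..
  show "conv f id x = conv_unit x + scale ((- 1) ^ N) (redpow (Suc N) x)" unfolding 2 3 ..
qed

lemma antipode_conv: "conv antipode id x = conv_unit x" "conv id antipode x = conv_unit x"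
proof -
  have "conv antipode id (basis a) = conv_unit (basis a) \<and> conv id antipode (basis a) = conv_unit (basis a)" for a
  proof -
    \<comment> \<open>The series truncated at \<open>deg a\<close> is one fixed combination of
      powers, to which \<open>conv_partial\<close> applies. Tensor factors in the coproduct of
      \<open>basis a\<close> have degree at most \<open>deg a\<close>, so \<open>f\<close> and
      \<open>antipode\<close> agree on them, and the remainder vanishes on
      \<open>basis a\<close>.\<close>
    define f where "f = (\<lambda>x. \<Sum>n\<le>deg a. scale ((- 1) ^ n) (redpow n x))"
    have f: "antipode (basis b) = f (basis b)" if "deg b \<le> deg a" for b
      unfolding f_def using that by (rule antipode_basis)
    have "conv antipode id (basis a) = conv f id (basis a)"
      unfolding conv_basis
      by (intro sum.cong refl) (auto simp: case_prod_unfold f dest!: deg_comult)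
    moreover have "conv id antipode (basis a) = conv id f (basis a)"
      unfolding conv_basis
      by (intro sum.cong refl) (auto simp: case_prod_unfold f dest!: deg_comult)
    ultimately show ?thesis
      unfolding f_def by (simp add: conv_partial redpow_vanish del: redpow.simps)
  qed
  then have "conv antipode id (basis a) = conv_unit (basis a)" "conv id antipode (basis a) = conv_unit (basis
      a)" for a
    by blast+
  note * = this
  show "conv antipode id x = conv_unit x" "conv id antipode x = conv_unit x"
    by (rule lin_eqI[OF lin_conv lin_conv_unit], rule *)+
qed

lemma hopf: "hopf_algebra mult unit comult counit antipode"
proof (rule hopf_algebra.intro)
  show "Vector_Spaces.linear scale scale mult" "Vector_Spaces.linear scale scale comult"
    "Vector_Spaces.linear scale scale antipode"
    by (simp_all add: lin_linear lin_mult lin_comult lin_antipode)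
  have "vector_space ((*) :: 'k \<Rightarrow> 'k \<Rightarrow> 'k)" by unfold_locales (auto simp: algebra_simps)
  then show "Vector_Spaces.linear scale (*) counit"
    by (simp add: Vector_Spaces.linear_iff vector_space_scale counit_add counit_scale)
  show "mult (tensor_map antipode id (comult x)) = scale (counit x) unit"
    "mult (tensor_map id antipode (comult x)) = scale (counit x) unit" for x
    using antipode_conv[of x] by (simp_all add: conv_def conv_unit_def)
qed (rule mult_assoc mult_unit_left mult_unit_right comult_coassoc counit_left counit_right comult_mult
    comult_unit counit_mult counit_unit)+

end

text \<open>The transpose of a convolution is the convolution of the transposes, since product and
  coproduct are exchanged; and \<open>J\<close> of one side is transposed to \<open>J\<close> of the
  other.\<close>

lemma adj_redpow:
  fixes mult mult' :: "('b \<times> 'b \<Rightarrow>\<^sub>0 'k::field) \<Rightarrow> ('b \<Rightarrow>\<^sub>0 'k)"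
  assumes B: "bialgebra mult unit comult counit" and B': "bialgebra mult' unit' comult' counit'"
    and adj: "adj mult comult'" "adj comult mult'"
    and unit: "\<And>x. pairing unit x = counit' x"
    and counit: "\<And>x. counit x = pairing x unit'"
  shows "adj (bialgebra.redpow mult unit comult counit n) (bialgebra.redpow mult' unit' comult' counit' n)"
proof -
  interpret B: bialgebra mult unit comult counit by (rule B)
  interpret B': bialgebra mult' unit' comult' counit' by (rule B')
  have 0: "adj B.conv_unit B'.conv_unit"
    unfolding adj_def B.conv_unit_def B'.conv_unit_def
    by (simp add: pairing_scale_left pairing_scale_right unit counit mult.commute)
  then have J: "adj (\<lambda>x. x - B.conv_unit x) (\<lambda>x. x - B'.conv_unit x)"
    by (simp add: adj_def pairing_diff_left pairing_diff_right)
  show ?thesis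
  proof (induction n)
    case (Suc n)
    have "adj (tensor_map (\<lambda>x. x - B.conv_unit x) (B.redpow n)) (tensor_map (\<lambda>x. x - B'.conv_unit x) (B'.redpow n))"
      by (intro adj_tensor_map B.lin_red B'.lin_red B.lin_redpow B'.lin_redpow J Suc)
    then show ?case
      by (simp add: adj_def B.conv_def B'.conv_def adjD[OF adj(1)] adjD[OF adj(2)])
  qed (simp add: 0)
qed

lemma adj_antipode:
  fixes mult mult' :: "('b \<times> 'b \<Rightarrow>\<^sub>0 'k::field) \<Rightarrow> ('b \<Rightarrow>\<^sub>0 'k)"
  assumes C: "connected_bialgebra mult unit comult counit deg one"
    and C': "connected_bialgebra mult' unit' comult' counit' deg one"
    and adj: "adj mult comult'" "adj comult mult'"
    and unit: "\<And>x. pairing unit x = counit' x"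
    and counit: "\<And>x. counit x = pairing x unit'"
  shows "adj (connected_bialgebra.antipode mult unit comult counit deg)
    (connected_bialgebra.antipode mult' unit' comult' counit' deg)"
proof -
  interpret C: connected_bialgebra mult unit comult counit deg one by (rule C)
  interpret C': connected_bialgebra mult' unit' comult' counit' deg one by (rule C')
  show ?thesis
  proof (rule adjI_basis)
    fix a b
    have r: "coeff (C.redpow n (basis a)) b = coeff (C'.redpow n (basis b)) a" for n
      using adjD[OF adj_redpow[OF C.bialgebra_axioms C'.bialgebra_axioms adj unit counit], of n "basis a" "basis b"]
      by simp
    show "coeff (C.antipode (basis a)) b = coeff (C'.antipode (basis b)) a"
      \<comment> \<open>The two series stop at \<open>deg a\<close> and at \<open>deg b\<close>; the
        sum is a common bound that permits comparison term by term.\<close>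
      using C.antipode_basis[of a "deg a + deg b"] C'.antipode_basis[of b "deg a + deg b"]
      by (simp add: lookup_sum r)
  qed (rule C.lin_antipode C'.lin_antipode)+
qed

lemma dual_hopf:
  fixes mult mult' :: "('b \<times> 'b \<Rightarrow>\<^sub>0 'k::field) \<Rightarrow> ('b \<Rightarrow>\<^sub>0 'k)"
  assumes C: "connected_bialgebra mult unit comult counit deg one"
    and C': "connected_bialgebra mult' unit' comult' counit' deg one"
    and adj: "adj mult comult'" "adj comult mult'"
    and unit: "\<And>x. pairing unit x = counit' x"
    and counit: "\<And>x. counit x = pairing x unit'"
  shows "dual_hopf_algebras mult unit comult counit (connected_bialgebra.antipode mult unit comult counit deg)
    mult' unit' comult' counit' (connected_bialgebra.antipode mult' unit' comult' counit' deg)"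
  by (intro dual_hopf_algebras.intro dual_hopf_algebras_axioms.intro connected_bialgebra.hopf[OF C]
      connected_bialgebra.hopf[OF C'] adjD[OF adj(1)] adjD[OF adj(2)] unit counit
      adjD[OF adj_antipode[OF C C' adj unit counit]])

subsection \<open>Subtrees and grafting by decoration\<close>

abbreviation relabel :: "('d \<Rightarrow> 'e) \<Rightarrow> 'd ptree list \<Rightarrow> 'e ptree list" where
  "relabel h \<equiv> map (map_ptree h)"

primrec subs_tree :: "'d ptree \<Rightarrow> 'd ptree list" where
  "subs_tree (Node x ts) = Node x ts # concat (map subs_tree ts)"

definition subs :: "'d ptree list \<Rightarrow> 'd ptree list" where
  "subs F = concat (map subs_tree F)"

text \<open>Nodes are referred to by their decorations. The list keeps repetitions, so that
  distinctness of \<open>labels F\<close> expresses that this naming is unambiguous.\<close>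

definition labels :: "'d ptree list \<Rightarrow> 'd list" where
  "labels F = map decoration (subs F)"

definition roots :: "'d ptree list \<Rightarrow> 'd set" where
  "roots F = decoration ` set F"

lemma subs_simps [simp]:
  "subs [] = []"
  "subs (t # us) = subs_tree t @ subs us"
  "subs (F @ G) = subs F @ subs G"
  by (simp_all add: subs_def)

lemma subs_tree_Node [simp]: "subs_tree (Node x ts) = Node x ts # subs ts"
  by (simp add: subs_def)

declare subs_tree.simps [simp del]

definition labels_tree :: "'d ptree \<Rightarrow> 'd list" where
  "labels_tree t = map decoration (subs_tree t)"

lemma labels_simps [simp]:
  "labels [] = []"
  "labels (t # us) = labels_tree t @ labels us"
  "labels (F @ G) = labels F @ labels G"
  by (simp_all add: labels_def labels_tree_def)

lemma labels_tree_Node [simp]: "labels_tree (Node x ts) = x # labels ts"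
  by (simp add: labels_def labels_tree_def)

lemma roots_simps [simp]: "roots [] = {}" "roots (t # us) = insert (decoration t) (roots us)"
  "roots (F @ G) = roots F \<union> roots G"
  by (auto simp: roots_def)

lemma finite_roots [simp]: "finite (roots F)"
  by (simp add: roots_def)

text \<open>Forests, not trees, are the objects of the induction: the first tree is opened into its
  branches, which avoids a nested induction over lists of children.\<close>

lemma forest_induct [case_names Nil Node]:
  assumes "P []" "\<And>x ts us. P ts \<Longrightarrow> P us \<Longrightarrow> P (Node x ts # us)"
  shows "P F"
proof (induction F rule: measure_induct_rule[where f = "size_list size"])
  case (less F)
  show ?case
  proof (cases F)
    case (Cons t us)
    then show ?thesis using assms(2) less by (cases t) simp
  qed (simp add: assms(1))
qed

lemma subs_self: "set F \<subseteq> set (subs F)"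
proof (induction F)
  case (Cons t us)
  then show ?case by (cases t) auto
qed simp

lemma roots_labels: "roots F \<subseteq> set (labels F)"
  using subs_self[of F] by (auto simp: roots_def labels_def)

lemma labels_root: "decoration t \<in> set (labels_tree t)"
  by (cases t) simp

lemma subs_trans: "t \<in> set (subs F) \<Longrightarrow> set (subs (children t)) \<subseteq> set (subs F)"
  by (induction F rule: forest_induct) auto

lemma set_labels: "set (labels F) = (\<Union>t\<in>set F. set (labels_tree t))"
proof (induction F)
  case (Cons t F)
  then show ?case by simp
qed simp

lemma labels_subs: "t \<in> set (subs F) \<Longrightarrow> set (labels_tree t) \<subseteq> set (labels F)"
proof -
  assume t: "t \<in> set (subs F)"
  have "set (subs_tree t) = insert t (set (subs (children t)))"
    by (cases t) simp
  then have "set (subs_tree t) \<subseteq> set (subs F)"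
    using subs_trans[OF t] t by simp
  then show ?thesis by (auto simp: labels_def labels_tree_def)
qed

lemma labels_mem: "t \<in> set F \<Longrightarrow> set (labels_tree t) \<subseteq> set (labels F)"
  using subs_self labels_subs by blast

lemma subs_map: "subs (relabel h F) = relabel h (subs F)"
  by (induction F rule: forest_induct) auto

lemma decoration_map [simp]: "decoration (map_ptree h t) = h (decoration t)"
  by (cases t) simp

lemma children_map [simp]: "children (map_ptree h t) = relabel h (children t)"
  by (cases t) simp

lemma labels_map [simp]: "labels (relabel h F) = map h (labels F)"
  by (simp add: labels_def subs_map)

lemma labels_tree_map [simp]: "labels_tree (map_ptree h t) = map h (labels_tree t)"
  using labels_map[of h "[t]"] by simp

lemma roots_map [simp]: "roots (relabel h F) = h ` roots F"
  by (simp add: roots_def image_image)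

text \<open>The implication from left to right is the absence of automorphisms: every node keeps its
  place, so the result determines the relabelling on the labels.\<close>

lemma map_forest_cong_iff:
  "relabel f F = relabel g F \<longleftrightarrow> (\<forall>x\<in>set (labels F). f x = g x)"
  by (induction F rule: forest_induct) auto

lemmas map_forest_cong = iffD2[OF map_forest_cong_iff, rule_format]

lemma distinct_labels_distinct: "distinct (labels F) \<Longrightarrow> distinct F"
proof (induction F)
  case (Cons t F)
  then have d: "distinct (labels_tree t @ labels F)" by simp
  moreover have "t \<notin> set F"
    using d labels_mem[of t F] labels_root[of t] by auto
  ultimately show ?case using Cons.IH by simp
qed simp

lemma roots_disjoint:
  assumes "distinct (labels F)" "t \<in> set F" "u \<in> set F" "x \<in> set (labels_tree t)" "x \<in> set (labels_tree u)"
  shows "t = u"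
  using assms
proof (induction F)
  case (Cons v F)
  then have d: "distinct (labels_tree v @ labels F)" by simp
  then show ?case using Cons labels_mem[of t F] labels_mem[of u F] by auto
qed simp

lemma root_inj:
  assumes "distinct (labels F)" "t \<in> set F" "u \<in> set F" "decoration t = decoration u"
  shows "t = u"
  using roots_disjoint[OF assms(1-3)] labels_root[of t] labels_root[of u] assms(4) by simp

lemma subs_inj:
  assumes "distinct (labels F)" "t \<in> set (subs F)" "u \<in> set (subs F)" "decoration t = decoration u"
  shows "t = u"
  using assms by (simp add: labels_def distinct_map inj_on_def)

primrec gr :: "('d \<Rightarrow> 'd ptree list) \<Rightarrow> 'd ptree \<Rightarrow> 'd ptree" where
  "gr a (Node x ts) = Node x (a x @ map (gr a) ts)"

lemma decoration_gr [simp]: "decoration (gr a t) = decoration t"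
  by (cases t) simp

lemma roots_gr [simp]: "roots (map (gr a) F) = roots F"
  by (simp add: roots_def image_image)

lemma children_gr [simp]: "children (gr a t) = a (decoration t) @ map (gr a) (children t)"
  by (cases t) simp

text \<open>The trees attached by the inner grafting become targets of the outer one, whose own
  trees end up further to the left.\<close>

lemma gr_gr: "map (gr a) (map (gr b) F) = map (gr (\<lambda>x. a x @ map (gr a) (b x))) F"
  by (induction F rule: forest_induct) auto

lemma gr_cong: "(\<And>x. x \<in> set (labels F) \<Longrightarrow> a x = b x) \<Longrightarrow> map (gr a) F = map (gr b) F"
  by (induction F rule: forest_induct) auto

lemma gr_map:
  assumes "\<And>x. x \<in> set (labels F) \<Longrightarrow> relabel h (a x) = b (h x)"
  shows "relabel h (map (gr a) F) = map (gr b) (relabel h F)"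
  using assms by (induction F rule: forest_induct) auto

lemma gr_empty: "(\<And>x. x \<in> set (labels F) \<Longrightarrow> a x = []) \<Longrightarrow> map (gr a) F = F"
  by (induction F rule: forest_induct) auto

lemma subs_gr: "set (subs (map (gr a) F)) = gr a ` set (subs F) \<union> (\<Union>x\<in>set (labels F). set (subs (a x)))"
  by (induction F rule: forest_induct) auto

lemma mset_labels_gr: "mset (labels (map (gr a) F)) =
    mset (labels F) + (\<Sum>x\<in>#mset (labels F). mset (labels (a x)))"
  by (induction F rule: forest_induct) auto

text \<open>
  The assignment sends the roots of the grafted forest to the labels of the nodes of the other one,
  and to \<open>None\<close> those which stay.
\<close>

definition fiber :: "('d \<Rightarrow> 'd option) \<Rightarrow> 'd ptree list \<Rightarrow> 'd option \<Rightarrow> 'd ptree list" where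
  "fiber \<phi> F v = filter (\<lambda>t. \<phi> (decoration t) = v) F"

text \<open>One term of the Grossman--Larson product of \<open>F\<close> and \<open>G\<close>,
  indexed by the assignment \<open>\<phi>\<close>.\<close>

definition glue :: "('d \<Rightarrow> 'd option) \<Rightarrow> 'd ptree list \<Rightarrow> 'd ptree list \<Rightarrow> 'd ptree list" where
  "glue \<phi> F G = fiber \<phi> F None @ map (gr (\<lambda>x. fiber \<phi> F (Some x))) G"

lemma mset_labels_filter:
  "mset (labels (filter P F)) + mset (labels (filter (\<lambda>t. \<not> P t) F)) = mset (labels F)"
proof (induction F)
  case (Cons t F)
  then show ?case by (auto simp: algebra_simps)
qed simp

lemma mset_labels_fiber:
  assumes "finite V" "\<phi> ` roots F \<subseteq> V"
  shows "(\<Sum>v\<in>V. mset (labels (fiber \<phi> F v))) = mset (labels F)"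
  using assms(2)
proof (induction F)
  case (Cons t F)
  have "(\<Sum>v\<in>V. mset (labels (fiber \<phi> (t # F) v))) =
      (\<Sum>v\<in>V. (if v = \<phi> (decoration t) then mset (labels_tree t) else {#}) + mset (labels (fiber \<phi> F v)))"
    by (intro sum.cong refl) (auto simp: fiber_def)
  also have "\<dots> = mset (labels_tree t) + (\<Sum>v\<in>V. mset (labels (fiber \<phi> F v)))"
    using Cons.prems assms(1) by (simp add: sum.distrib)
  also have "\<dots> = mset (labels (t # F))"
    using Cons by (simp add:)
  finally show ?case .
qed (simp add: fiber_def)

text \<open>Every tree of \<open>F\<close> lies in exactly one fibre, and distinctness of the labels
  of \<open>G\<close> ensures that every fibre is inserted only once.\<close>

lemma mset_labels_glue:
  assumes "distinct (labels G)" "\<phi> ` roots F \<subseteq> insert None (Some ` set (labels G))"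
  shows "mset (labels (glue \<phi> F G)) = mset (labels F) + mset (labels G)"
proof -
  have "mset (labels F) = (\<Sum>v\<in>insert None (Some ` set (labels G)). mset (labels (fiber \<phi> F v)))"
    using mset_labels_fiber[OF _ assms(2)] by simp
  also have "\<dots> = mset (labels (fiber \<phi> F None)) + (\<Sum>x\<in>set (labels G). mset (labels (fiber \<phi> F (Some x))))"
    by (simp add: image_iff sum.reindex)
  also have "(\<Sum>x\<in>set (labels G). mset (labels (fiber \<phi> F (Some x)))) =
      (\<Sum>x\<in>#mset (labels G). mset (labels (fiber \<phi> F (Some x))))"
    using assms(1) by (simp add: sum_unfold_sum_mset mset_set_set)
  finally show ?thesis by (simp add: glue_def mset_labels_gr add_ac)
qed

lemma fiber_map:
  assumes "\<And>x. x \<in> roots F \<Longrightarrow> \<psi> (h x) = w \<longleftrightarrow> \<phi> x = v"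
  shows "fiber \<psi> (relabel h F) w = relabel h (fiber \<phi> F v)"
  using assms by (auto simp: fiber_def filter_map roots_def intro!: arg_cong[where f = "map _"] filter_cong)

lemma labels_fiber: "set (labels (fiber \<phi> F v)) \<subseteq> set (labels F)"
  using set_labels[of "fiber \<phi> F v"] set_labels[of F] by (auto simp: fiber_def)

subsection \<open>Labelled exotic forests\<close>

text \<open>
  Forests are labelled so that all pairs (label, original decoration) are distinct; operations
  addressing nodes then refer to the decorations themselves.
\<close>

type_synonym 'a lforest = "('a \<times> nat option) ptree list"

abbreviation forget :: "'a lforest \<Rightarrow> dforest" where
  "forget F \<equiv> relabel snd F"

definition nums :: "'a lforest \<Rightarrow> nat set" where
  "nums F = {i. Some i \<in> snd ` set (labels F)}"

text \<open>Exoticness phrased by multiplicities, which add up under concatenation and ignore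
  rearrangement; \<open>valid_iff\<close> compares it with \<open>exotic\<close>.\<close>

definition valid :: "'a lforest \<Rightarrow> bool" where
  "valid F \<longleftrightarrow> distinct (labels F) \<and> 0 \<notin> nums F \<and>
     (\<forall>t\<in>set (subs F). snd (decoration t) \<noteq> None \<longrightarrow> children t = []) \<and>
     (\<forall>i. count (image_mset snd (mset (labels F))) (Some i) \<in> {0, 2})"

definition cls :: "'a lforest \<Rightarrow> ef" where
  "cls F = abs_ef (forget F)"

text \<open>Nodes with different labels may still carry the same number, so the numbers are
  separated as well; otherwise concatenation would merge lianas.\<close>

definition apart :: "'a lforest \<Rightarrow> 'a lforest \<Rightarrow> bool" where
  "apart F G \<longleftrightarrow> set (labels F) \<inter> set (labels G) = {} \<and> nums F \<inter> nums G = {}"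

lemma nums_count: "i \<in> nums F \<longleftrightarrow> 0 < count (image_mset snd (mset (labels F))) (Some i)"
  by (simp only: nums_def mem_Collect_eq count_greater_zero_iff set_image_mset set_mset_mset)

lemma nums_append [simp]: "nums (F @ G) = nums F \<union> nums G"
  by (auto simp: nums_def)

lemma finite_nums [simp]: "finite (nums F)"
proof -
  have "nums F \<subseteq> the ` snd ` set (labels F)"
    by (auto simp: nums_def) (metis image_eqI option.sel snd_conv)
  then show ?thesis by (rule finite_subset) simp
qed

lemma valid_distinct: "valid F \<Longrightarrow> distinct (labels F)"
  by (simp add: valid_def)

lemma valid_append:
  assumes "valid F" "valid G" "apart F G"
  shows "valid (F @ G)"
proof -
  let ?m = "\<lambda>F. image_mset snd (mset (labels F))"
  have "count (?m F) (Some i) = 0 \<or> count (?m G) (Some i) = 0" for i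
    using assms(3) nums_count[of i F] nums_count[of i G] by (auto simp: apart_def)
  then have "count (?m F) (Some i) + count (?m G) (Some i) \<in> {0, 2}" for i
    using assms(1,2)[unfolded valid_def] by (metis add.left_neutral add.right_neutral)
  then show ?thesis using assms by (auto simp: valid_def apart_def)
qed

text \<open>Apart from the leaf condition, validity depends on the multiset of labels alone, which
  grafting and shuffling preserve.\<close>

lemma valid_mset_cong:
  assumes "valid F" "mset (labels G) = mset (labels F)"
    and "\<And>t. t \<in> set (subs G) \<Longrightarrow> snd (decoration t) \<noteq> None \<Longrightarrow> children t = []"
  shows "valid G"
proof -
  have "set (labels G) = set (labels F)" using assms(2) by (metis set_mset_mset)
  then have "nums G = nums F" by (simp add: nums_def)
  moreover have "distinct (labels G)"
    using assms(1,2) by (metis valid_distinct mset_eq_imp_distinct_iff)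
  ultimately show ?thesis using assms by (simp add: valid_def)
qed

text \<open>The functions are extensional, so that they are finite in number and each assignment of
  roots is counted once.\<close>

definition maps :: "'a lforest \<Rightarrow> 'a lforest \<Rightarrow>
    ('a \<times> nat option \<Rightarrow> ('a \<times> nat option) option) set" where
  "maps F G = roots F \<rightarrow>\<^sub>E insert None (Some ` {x \<in> set (labels G). snd x = None})"

lemma finite_maps [simp]: "finite (maps F G)"
  unfolding maps_def by (intro finite_PiE) auto

lemma maps_range: "\<phi> \<in> maps F G \<Longrightarrow> \<phi> ` roots F \<subseteq> insert None (Some ` set (labels G))"
  by (auto simp: maps_def PiE_iff)

lemma maps_mset: "\<phi> \<in> maps F G \<Longrightarrow> distinct (labels G) \<Longrightarrow>
    mset (labels (glue \<phi> F G)) = mset (labels F) + mset (labels G)"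
  by (rule mset_labels_glue[OF _ maps_range])

lemma set_labels_glue:
  assumes "\<phi> \<in> maps F G" "distinct (labels G)"
  shows "set (labels (glue \<phi> F G)) = set (labels F) \<union> set (labels G)"
  using maps_mset[OF assms] by (metis set_mset_mset set_mset_union)

text \<open>Only black nodes are targets, so numbered nodes remain leaves; the multiset of labels is
  that of \<open>F @ G\<close>.\<close>

lemma valid_glue:
  assumes "valid F" "valid G" "apart F G" "\<phi> \<in> maps F G"
  shows "valid (glue \<phi> F G)"
proof (rule valid_mset_cong[OF valid_append[OF assms(1-3)]])
  show "mset (labels (glue \<phi> F G)) = mset (labels (F @ G))"
    using maps_mset[OF assms(4) valid_distinct[OF assms(2)]] by simp
  fix t assume t: "t \<in> set (subs (glue \<phi> F G))" and d: "snd (decoration t) \<noteq> None"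
  have sub: "set (subs (fiber \<phi> F v)) \<subseteq> set (subs F)" for v
    by (auto simp: subs_def fiber_def)
  have "t \<in> set (subs F) \<or> t \<in> gr (\<lambda>x. fiber \<phi> F (Some x)) ` set (subs G)"
    using t sub unfolding glue_def by (auto simp: subs_gr)
  then show "children t = []"
  proof
    assume "t \<in> set (subs F)"
    then show ?thesis using assms(1) d by (simp add: valid_def)
  next
    assume "t \<in> gr (\<lambda>x. fiber \<phi> F (Some x)) ` set (subs G)"
    then obtain u where u: "u \<in> set (subs G)" "t = gr (\<lambda>x. fiber \<phi> F (Some x)) u" by auto
    have "children u = []" using assms(2) u d by (simp add: valid_def)
    moreover have "fiber \<phi> F (Some (decoration u)) = []"
      using assms(4) d u(2) by (force simp: fiber_def maps_def filter_empty_conv PiE_iff roots_def)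
    ultimately show ?thesis using u(2) by simp
  qed
qed

subsection \<open>Labelling by addresses\<close>

text \<open>Labels are the addresses by which the given definitions of grafting and cuts refer to
  nodes. The prefix \<open>p\<close> allows disjoint copies and makes subtrees carry their addresses
  in the whole tree.\<close>

function label_tree :: "nat list \<Rightarrow> 'd ptree \<Rightarrow> (nat list \<times> 'd) ptree" where
  "label_tree p (Node d ts) = Node (p, d) (map (\<lambda>i. label_tree (p @ [i]) (ts ! i)) [0..<length ts])"
  by pat_completeness auto
termination
  by (relation "measure (\<lambda>(p, t). size t)")
    (simp_all only: wf_measure in_measure case_prod_conv set_upt set_filter mem_Collect_eq atLeastLessThan_iff
        size_child)

definition label_forest :: "nat list \<Rightarrow> 'd ptree list \<Rightarrow> (nat list \<times> 'd) ptree list" where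
  "label_forest p ts = map (\<lambda>i. label_tree (p @ [i]) (ts ! i)) [0..<length ts]"

lemma label_tree_Node [simp]: "label_tree p (Node d ts) = Node (p, d) (label_forest p ts)"
  by (simp add: label_forest_def)

declare label_tree.simps [simp del]

lemma length_label_forest [simp]: "length (label_forest p ts) = length ts"
  by (simp add: label_forest_def)

lemma nth_label_forest [simp]: "i < length ts \<Longrightarrow> label_forest p ts ! i = label_tree (p @ [i]) (ts ! i)"
  by (simp add: label_forest_def)

lemma decoration_label_tree [simp]: "decoration (label_tree p t) = (p, decoration t)"
  by (cases t) simp

lemma children_label_tree [simp]: "children (label_tree p t) = label_forest p (children t)"
  by (cases t) simp

lemma forget_label_tree [simp]: "map_ptree snd (label_tree p t) = t"
proof (induction t arbitrary: p)
  case (Node d ts)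
  have "relabel snd (label_forest p ts) = ts"
    using Node by (intro nth_equalityI) auto
  then show ?case by simp
qed

lemma forget_label_forest [simp]: "relabel snd (label_forest p ts) = ts"
  by (intro nth_equalityI) auto

lemma nodes_Node: "nodes (Node d ts) = insert [] (\<Union>i<length ts. (#) i ` nodes (ts ! i))"
proof (intro set_eqI)
  fix p show "p \<in> nodes (Node d ts) \<longleftrightarrow> p \<in> insert [] (\<Union>i<length ts. (#) i ` nodes (ts ! i))"
    by (cases p) (auto simp: nodes_def)
qed

lemma set_subs_label_tree:
  "set (subs_tree (label_tree p t)) = (\<lambda>q. label_tree (p @ q) (subtree t q)) ` nodes t"
proof (induction t arbitrary: p)
  case (Node d ts)
  have "set (subs (label_forest p ts)) = (\<Union>i<length ts. set (subs_tree (label_tree (p @ [i]) (ts ! i))))"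
    by (auto simp: subs_def label_forest_def atLeast0LessThan)
  also have "\<dots> = (\<Union>i<length ts. (\<lambda>q. label_tree (p @ i # q) (subtree (ts ! i) q)) ` nodes (ts ! i))"
    using Node by (intro SUP_cong refl) simp
  finally show ?case
    by (simp add: nodes_Node image_UN image_image)
qed

lemma set_labels_label_tree:
  "set (labels_tree (label_tree p t)) = (\<lambda>q. (p @ q, deco t q)) ` nodes t"
  by (simp add: labels_tree_def set_subs_label_tree image_image deco_def)

lemma distinct_label_tree: "distinct (map fst (labels_tree (label_tree p t)))"
proof (induction t arbitrary: p)
  case (Node d ts)
  have pre: "\<exists>r. q = p @ i # r" if "q \<in> fst ` set (labels_tree (label_tree (p @ [i]) (ts ! i)))" for q i
    using that by (auto simp: set_labels_label_tree)
  \<comment> \<open>The induction adds the children one at a time. The last conjunct records the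
    first index after \<open>p\<close> of each address, which separates the next child from the
    earlier ones.\<close>
  have "distinct (map fst (labels (map (\<lambda>i. label_tree (p @ [i]) (ts ! i)) [0..<n]))) \<and>
      p \<notin> fst ` set (labels (map (\<lambda>i. label_tree (p @ [i]) (ts ! i)) [0..<n])) \<and>
      (\<forall>q\<in>fst ` set (labels (map (\<lambda>i. label_tree (p @ [i]) (ts ! i)) [0..<n])). \<exists>i<n. \<exists>r. q = p @ i # r)"
    if "n \<le> length ts" for n
    using that
  proof (induction n)
    case (Suc n)
    let ?F = "map (\<lambda>i. label_tree (p @ [i]) (ts ! i)) [0..<n]" and ?t = "label_tree (p @ [n]) (ts ! n)"
    have eq: "labels (map (\<lambda>i. label_tree (p @ [i]) (ts ! i)) [0..<Suc n]) = labels ?F @ labels_tree ?t"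
      by simp
    have d: "distinct (map fst (labels_tree ?t))" using Node Suc.prems by simp
    have IH: "distinct (map fst (labels ?F))" "p \<notin> fst ` set (labels ?F)"
      "\<And>q. q \<in> fst ` set (labels ?F) \<Longrightarrow> \<exists>i<n. \<exists>r. q = p @ i # r"
      using Suc.IH Suc.prems by (simp_all only: Suc_leD) auto
    have dis: "fst ` set (labels ?F) \<inter> fst ` set (labels_tree ?t) = {}"
    proof (rule ccontr)
      assume "\<not> ?thesis"
      then obtain q where "q \<in> fst ` set (labels ?F)" "q \<in> fst ` set (labels_tree ?t)" by auto
      with IH(3)[of q] pre[of q n] show False by auto
    qed
    have np: "p \<notin> fst ` set (labels_tree ?t)"
    proof
      assume "p \<in> fst ` set (labels_tree ?t)"
      from pre[OF this] show False by simp
    qed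
    have bd: "\<exists>i<Suc n. \<exists>r. q = p @ i # r" if "q \<in> fst ` set (labels ?F @ labels_tree ?t)" for q
    proof (cases "q \<in> fst ` set (labels ?F)")
      case True
      from IH(3)[OF this] show ?thesis by (metis less_SucI)
    next
      case False
      then have "q \<in> fst ` set (labels_tree ?t)" using that by auto
      from pre[OF this] show ?thesis by auto
    qed
    show ?case unfolding eq using IH(1,2) d dis np bd by (simp add: image_Un)
  qed simp
  from this[of "length ts"] show ?case
    by (simp add: label_forest_def)
qed

lemma finite_nodes [simp]: "finite (nodes t)"
proof -
  have "finite ((\<lambda>q. ([] @ q, deco t q)) ` nodes t)"
    unfolding set_labels_label_tree[symmetric] by simp
  then show ?thesis by (rule finite_imageD) (simp add: inj_on_def)
qed

lemma count_map_distinct: "distinct L \<Longrightarrow> count (mset (map f L)) d = card {y \<in> set L. f y = d}"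
proof (induction L)
  case (Cons a L)
  have "{y \<in> set (a # L). f y = d} = (if f a = d then insert a {y \<in> set L. f y = d} else {y \<in> set L. f y = d})"
    by auto
  then show ?case using Cons by simp
qed simp

text \<open>Addresses are distinct labels, so counting addresses with a given decoration amounts to
  counting occurrences in the list of decorations.\<close>

lemma count_labels_tree: "count (mset (labels_tree t)) d = card {q \<in> nodes t. deco t q = d}"
proof -
  let ?L = "labels_tree (label_tree [] t)"
  have "labels_tree t = map snd ?L"
    by (metis forget_label_tree labels_tree_map)
  then have "count (mset (labels_tree t)) d = card {y \<in> set ?L. snd y = d}"
    using count_map_distinct[of ?L snd d] distinct_label_tree[of "[]" t] by (simp add: distinct_map)
  also have "{y \<in> set ?L. snd y = d} = (\<lambda>q. (q, deco t q)) ` {q \<in> nodes t. deco t q = d}"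
    by (auto simp: set_labels_label_tree)
  also have "card \<dots> = card {q \<in> nodes t. deco t q = d}"
    by (intro card_image) (simp add: inj_on_def)
  finally show ?thesis .
qed

text \<open>Addresses are replaced by subtrees and multiplicities. The root added by
  \<open>Bplus\<close> is black, so it adds no condition and no count.\<close>

lemma exotic_iff: "exotic f \<longleftrightarrow> (\<forall>t\<in>set (subs f). \<forall>i. decoration t = Some i \<longrightarrow>
    0 < i \<and> children t = [] \<and> count (mset (labels f)) (Some i) = 2)"
proof -
  have "set (subs_tree (Bplus f)) = subtree (Bplus f) ` nodes (Bplus f)"
  proof -
    have "map_ptree snd ` set (subs_tree (label_tree [] (Bplus f))) = set (subs_tree (Bplus f))"
      using subs_map[of snd "[label_tree [] (Bplus f)]"] by simp
    then show ?thesis by (simp add: set_subs_label_tree image_image)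
  qed
  then have n: "(\<forall>p\<in>nodes (Bplus f). P (subtree (Bplus f) p)) \<longleftrightarrow> P (Bplus f) \<and> (\<forall>t\<in>set (subs f). P t)" for P
    by (simp add: Bplus_def) (metis (no_types, lifting) imageE image_eqI insert_iff)
  have c: "card {q \<in> nodes (Bplus f). deco (Bplus f) q = Some i} = count (mset (labels f)) (Some i)" for i
    unfolding count_labels_tree[symmetric] by (simp add: Bplus_def)
  have "exotic f \<longleftrightarrow> (\<forall>p\<in>nodes (Bplus f). \<forall>i. decoration (subtree (Bplus f) p) = Some i \<longrightarrow>
     0 < i \<and> children (subtree (Bplus f) p) = [] \<and> count (mset (labels f)) (Some i) = 2)"
    unfolding exotic_def c by (auto simp: deco_def leaves_def)
  then show ?thesis by (simp add: n[where P = "\<lambda>t. \<forall>i. decoration t = Some i \<longrightarrow>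
     0 < i \<and> children t = [] \<and> count (mset (labels f)) (Some i) = 2"]) (simp add: Bplus_def)
qed

lemma valid_iff: "valid F \<longleftrightarrow> distinct (labels F) \<and> exotic (forget F)"
proof -
  let ?c = "\<lambda>i. count (image_mset snd (mset (labels F))) (Some i)"
  have e: "exotic (forget F) \<longleftrightarrow> (\<forall>t\<in>set (subs F). \<forall>i. snd (decoration t) = Some i \<longrightarrow>
      0 < i \<and> children t = [] \<and> ?c i = 2)"
    by (simp add: exotic_iff subs_map mset_map)
  have N: "i \<in> nums F \<longleftrightarrow> (\<exists>t\<in>set (subs F). snd (decoration t) = Some i)" for i
    by (auto simp: nums_def labels_def image_iff) (metis snd_conv)+
  have c: "?c i \<noteq> 0 \<longleftrightarrow> i \<in> nums F" for i
    using nums_count[of i F] by simp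
  have "0 < i \<and> children t = [] \<and> ?c i = 2"
    if "valid F" "t \<in> set (subs F)" "snd (decoration t) = Some i" for t i
  proof -
    have i: "i \<in> nums F" using that(2,3) N by blast
    have "?c i \<in> {0, 2}" using that(1) by (simp only: valid_def)
    then have "?c i = 2" using c[of i] i by blast
    moreover have "0 < i" using that(1) i unfolding valid_def by (metis gr0I)
    ultimately show ?thesis using that by (simp add: valid_def)
  qed
  moreover have "valid F" if d: "distinct (labels F)" and h: "\<And>t i. t \<in> set (subs F) \<Longrightarrow>
      snd (decoration t) = Some i \<Longrightarrow> 0 < i \<and> children t = [] \<and> ?c i = 2"
    unfolding valid_def
  proof (intro conjI allI ballI impI d)
    show "0 \<notin> nums F" using h by (fastforce simp: N)
    show "children t = []" if "t \<in> set (subs F)" "snd (decoration t) \<noteq> None" for t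
      using h that by blast
    show "?c i \<in> {0, 2}" for i
    proof (cases "i \<in> nums F")
      case True
      then show ?thesis using h N by blast
    qed (use c[of i] in blast)
  qed
  ultimately show ?thesis
    unfolding e using valid_distinct[of F] by blast
qed

lemma valid_exotic: "valid F \<Longrightarrow> exotic (forget F)"
  by (simp add: valid_iff)

lemma distinct_label_forest: "distinct (map fst (labels (label_forest p ts)))"
  using distinct_label_tree[of p "Node undefined ts"] by simp

lemma valid_label_forest: "exotic f \<Longrightarrow> valid (label_forest p f)"
  using distinct_label_forest[of p f] by (simp add: valid_iff distinct_map)

lemma labels_label_forest: "x \<in> set (labels (label_forest p ts)) \<Longrightarrow> \<exists>i q. fst x = p @ i # q"
proof -
  assume x: "x \<in> set (labels (label_forest p ts))"
  then have "x \<in> set (labels_tree (label_tree p (Node undefined ts)))" by simp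
  then obtain q where q: "x = (p @ q, deco (Node undefined ts) q)"
    unfolding set_labels_label_tree by auto
  moreover have "fst x \<noteq> p"
  proof
    assume "fst x = p"
    then have "p \<in> fst ` set (labels (label_forest p ts))" using x by force
    then show False using distinct_label_tree[of p "Node undefined ts"] by auto
  qed
  ultimately show ?thesis by (cases q) auto
qed

lemma rep_ef_props: "exotic (rep_ef \<pi>)" "abs_ef (rep_ef \<pi>) = \<pi>"
proof -
  show "abs_ef (rep_ef \<pi>) = \<pi>" by (rule Quotient3_abs_rep[OF Quotient3_ef])
  have "renumber_equiv (rep_ef \<pi>) (rep_ef \<pi>)" by (rule Quotient3_rep_reflp[OF Quotient3_ef])
  then show "exotic (rep_ef \<pi>)" by (simp add: renumber_equiv_def)
qed

lemma abs_ef_eq_iff: "exotic f \<Longrightarrow> exotic g \<Longrightarrow> abs_ef f = abs_ef g \<longleftrightarrow> renumber_equiv f g"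
proof -
  have r: "renumber_equiv f f" if "exotic f" for f
    unfolding renumber_equiv_def using that renumber_id[of f] by (metis bij_id)
  show "exotic f \<Longrightarrow> exotic g \<Longrightarrow> ?thesis"
    using Quotient3_rel[OF Quotient3_ef, of f g] r by blast
qed

subsection \<open>Relabellings\<close>

text \<open>First components may change freely; decorations may change only through an injective
  renumbering of the numbers that occur in \<open>A\<close>. This is the labelled form of
  \<open>renumber_equiv\<close>.\<close>

definition relabelling :: "('a \<times> nat option \<Rightarrow> 'b \<times> nat option) \<Rightarrow> ('a \<times> nat option) set \<Rightarrow> bool" where
  "relabelling h A \<longleftrightarrow> (\<exists>\<sigma>. inj_on \<sigma> {i. Some i \<in> snd ` A} \<and> (\<forall>x\<in>A. snd (h x) = map_option \<sigma> (snd x)))"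

lemma relabelling_subset: "relabelling h A \<Longrightarrow> B \<subseteq> A \<Longrightarrow> relabelling h B"
  unfolding relabelling_def by (elim exE conjE, rule exI) (auto elim!: inj_on_subset)

lemma relabelling_None: "relabelling h A \<Longrightarrow> x \<in> A \<Longrightarrow> snd (h x) = None \<longleftrightarrow> snd x = None"
  by (auto simp: relabelling_def)

lemma inj_extend_bij:
  assumes "finite A" "inj_on \<sigma> A"
  obtains \<tau> :: "'a \<Rightarrow> 'a" where "bij \<tau>" "\<And>a. a \<in> A \<Longrightarrow> \<tau> a = \<sigma> a"
proof -
  let ?B = "A \<union> \<sigma> ` A"
  have "card (?B - A) = card (?B - \<sigma> ` A)"
    using assms by (simp add: card_Diff_subset card_image)
  then obtain g where g: "bij_betw g (?B - A) (?B - \<sigma> ` A)"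
    using assms(1) by (meson finite_Diff finite_UnI finite_imageI finite_same_card_bij)
  have "bij_betw \<sigma> A (\<sigma> ` A)" using assms(2) by (simp add: bij_betw_def)
  then have "bij_betw (\<lambda>x. if x \<in> A then \<sigma> x else g x) (A \<union> (?B - A)) (\<sigma> ` A \<union> (?B - \<sigma> ` A))"
    using g by (intro bij_betw_disjoint_Un) auto
  then have b: "bij_betw (\<lambda>x. if x \<in> A then \<sigma> x else g x) ?B ?B"
    by (simp add: Un_absorb1 Un_Diff_cancel Un_absorb2 Un_commute)
  have "bij_betw (\<lambda>x. if x \<in> ?B then (if x \<in> A then \<sigma> x else g x) else x) (?B \<union> - ?B) (?B \<union> - ?B)"
    by (rule bij_betw_disjoint_Un[OF b]) (auto simp: bij_betw_def)
  then have "bij (\<lambda>x. if x \<in> ?B then (if x \<in> A then \<sigma> x else g x) else x)"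
    by (simp only: Compl_partition)
  then show ?thesis by (rule that) auto
qed

lemma cls_relabel:
  assumes "valid F" "valid (relabel h F)" "relabelling h (set (labels F))"
  shows "cls (relabel h F) = cls F"
proof -
  from assms(3) obtain \<sigma> where s: "inj_on \<sigma> (nums F)" "\<forall>x\<in>set (labels F). snd (h x) = map_option \<sigma> (snd x)"
    unfolding relabelling_def nums_def by blast
  obtain \<tau> where t: "bij \<tau>" "\<And>i. i \<in> nums F \<Longrightarrow> \<tau> i = \<sigma> i"
    using inj_extend_bij[OF finite_nums s(1)] by blast
  have "forget (relabel h F) = relabel (\<lambda>x. map_option \<tau> (snd x)) F"
    unfolding list.map_comp comp_def ptree.map_comp
  proof (rule map_forest_cong)
    fix x assume x: "x \<in> set (labels F)"
    show "snd (h x) = map_option \<tau> (snd x)"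
    proof (cases "snd x")
      case (Some i)
      then have "i \<in> nums F" using x by (force simp: nums_def)
      then show ?thesis using s(2) x t(2) Some by simp
    qed (use s(2) x in simp)
  qed
  also have "\<dots> = renumber \<tau> (forget F)"
    by (simp add: renumber_def ptree.map_comp comp_def)
  finally have "renumber_equiv (forget F) (forget (relabel h F))"
    using assms(1,2) t(1) by (auto simp: renumber_equiv_def valid_iff)
  then show ?thesis
    unfolding cls_def using abs_ef_eq_iff[OF valid_exotic[OF assms(1)] valid_exotic[OF assms(2)]] by simp
qed

text \<open>Equal results force equal shapes, so nodes correspond by position; distinct labels of
  \<open>F\<close> turn this correspondence into a function of labels.\<close>

lemma match_forests:
  assumes "relabel f F = relabel g P" "distinct (labels F)"
  shows "\<exists>h. P = relabel h F \<and> (\<forall>x\<in>set (labels F). f x = g (h x))"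
  using assms
proof (induction F arbitrary: P rule: forest_induct)
  case (Node x ts us)
  from Node.prems(1) obtain p P' where P: "P = p # P'" by (cases P) auto
  obtain y ts' where p: "p = Node y ts'" by (cases p)
  obtain h1 where h1: "ts' = relabel h1 ts" "\<forall>x\<in>set (labels ts). f x = g (h1 x)"
    using Node.IH(1)[of ts'] Node.prems P p by auto
  obtain h2 where h2: "P' = relabel h2 us" "\<forall>x\<in>set (labels us). f x = g (h2 x)"
    using Node.IH(2)[of P'] Node.prems P p by auto
  let ?h = "\<lambda>z. if z = x then y else if z \<in> set (labels ts) then h1 z else h2 z"
  have "relabel ?h ts = ts'"
    unfolding h1(1) using Node.prems(2) by (intro map_forest_cong) auto
  moreover have "relabel ?h us = P'"
    unfolding h2(1) using Node.prems(2) by (intro map_forest_cong) auto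
  ultimately have "P = relabel ?h (Node x ts # us)" using P p by simp
  moreover have "\<forall>z\<in>set (labels (Node x ts # us)). f z = g (?h z)"
    using h1(2) h2(2) Node.prems(1) P p by auto
  ultimately show ?case by blast
qed simp

lemma cls_eqD:
  assumes "valid F" "valid P" "cls F = cls P"
  shows "\<exists>h. P = relabel h F \<and> relabelling h (set (labels F))"
proof -
  have "renumber_equiv (forget F) (forget P)"
    using assms(3) abs_ef_eq_iff[OF valid_exotic[OF assms(1)] valid_exotic[OF assms(2)]]
    by (simp add: cls_def)
  then obtain \<sigma> where s: "bij \<sigma>" "forget P = renumber \<sigma> (forget F)"
    by (auto simp: renumber_equiv_def)
  then have "relabel (\<lambda>x. map_option \<sigma> (snd x)) F = relabel snd P"
    by (simp add: renumber_def ptree.map_comp comp_def)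
  from match_forests[OF this valid_distinct[OF assms(1)]] obtain h where
    "P = relabel h F" "\<forall>x\<in>set (labels F). map_option \<sigma> (snd x) = snd (h x)" by blast
  moreover from this have "relabelling h (set (labels F))"
    unfolding relabelling_def
    by (intro exI[of _ \<sigma>] conjI ballI inj_on_subset[OF bij_is_inj[OF s(1)]]) auto
  ultimately show ?thesis by blast
qed

text \<open>The relabellings of the two factors are merged into one. Apartness of \<open>F\<close>
  and \<open>G\<close> makes it well defined, and apartness of \<open>P\<close> and \<open>R\<close>
  makes it injective.\<close>

lemma cls_pair_eqD:
  assumes "valid F" "valid G" "apart F G" "valid P" "valid R" "apart P R" "cls F = cls P" "cls G = cls R"
  obtains h where "P = relabel h F" "R = relabel h G"
    "relabelling h (set (labels (F @ G)))" "inj_on h (set (labels (F @ G)))"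
proof -
  obtain h1 where h1: "P = relabel h1 F" "relabelling h1 (set (labels F))"
    using cls_eqD[OF assms(1,4,7)] by blast
  obtain h2 where h2: "R = relabel h2 G" "relabelling h2 (set (labels G))"
    using cls_eqD[OF assms(2,5,8)] by blast
  obtain s1 where s1: "inj_on s1 (nums F)" "\<And>x. x \<in> set (labels F) \<Longrightarrow> snd (h1 x) = map_option s1 (snd x)"
    using h1(2) unfolding relabelling_def nums_def by blast
  obtain s2 where s2: "inj_on s2 (nums G)" "\<And>x. x \<in> set (labels G) \<Longrightarrow> snd (h2 x) = map_option s2 (snd x)"
    using h2(2) unfolding relabelling_def nums_def by blast
  let ?h = "\<lambda>x. if x \<in> set (labels F) then h1 x else h2 x"
  let ?s = "\<lambda>i. if i \<in> nums F then s1 i else s2 i"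
  have dis: "set (labels F) \<inter> set (labels G) = {}" "nums F \<inter> nums G = {}"
    using assms(3) by (auto simp: apart_def)
  have P: "P = relabel ?h F"
    unfolding h1(1) by (intro map_forest_cong) auto
  have R: "R = relabel ?h G"
    unfolding h2(1) using dis(1) by (intro map_forest_cong) auto
  have numsP: "s1 i \<in> nums P" if i: "i \<in> nums F" for i
  proof -
    obtain x where "x \<in> set (labels F)" "snd x = Some i" using i unfolding nums_def by force
    then have "snd (h1 x) = Some (s1 i)" "h1 x \<in> set (labels P)" using s1(2) h1(1) by auto
    then show ?thesis unfolding nums_def by force
  qed
  have numsR: "s2 i \<in> nums R" if i: "i \<in> nums G" for i
  proof -
    obtain x where "x \<in> set (labels G)" "snd x = Some i" using i unfolding nums_def by force
    then have "snd (h2 x) = Some (s2 i)" "h2 x \<in> set (labels R)" using s2(2) h2(1) by auto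
    then show ?thesis unfolding nums_def by force
  qed
  have "inj_on ?s (nums F \<union> nums G)"
  proof (rule inj_onI)
    fix i j assume "i \<in> nums F \<union> nums G" "j \<in> nums F \<union> nums G" "?s i = ?s j"
    then show "i = j"
      using numsP[of i] numsP[of j] numsR[of i] numsR[of j] inj_onD[OF s1(1), of i j] inj_onD[OF s2(1), of i j]
        assms(6) unfolding apart_def
      by (cases "i \<in> nums F"; cases "j \<in> nums F") (simp_all, (metis disjoint_iff)+)
  qed
  moreover have "snd (?h x) = map_option ?s (snd x)" if x: "x \<in> set (labels (F @ G))" for x
  proof (cases "x \<in> set (labels F)")
    case True
    show ?thesis
    proof (cases "snd x")
      case (Some i)
      then have "i \<in> nums F" using True by (force simp: nums_def)
      then show ?thesis using True Some by (simp add: s1(2))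
    qed (use True in \<open>simp add: s1(2)\<close>)
  next
    case False
    then have xG: "x \<in> set (labels G)" using x by simp
    show ?thesis
    proof (cases "snd x")
      case (Some i)
      then have "i \<in> nums G" using xG by (force simp: nums_def)
      then have "i \<notin> nums F" using dis(2) by auto
      then show ?thesis using False xG Some by (simp add: s2(2))
    qed (use False xG in \<open>simp add: s2(2)\<close>)
  qed
  ultimately have rel: "relabelling ?h (set (labels (F @ G)))"
    unfolding relabelling_def nums_append[symmetric] nums_def[of "F @ G"]
    by (intro exI[of _ ?s] conjI ballI)
  have "distinct (map ?h (labels (F @ G)))"
  proof -
    have "map ?h (labels (F @ G)) = labels (P @ R)" by (simp add: P[symmetric] R[symmetric]
        labels_map[symmetric] del: labels_map)
    then show ?thesis using valid_distinct[OF valid_append[OF assms(4,5,6)]] by simp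
  qed
  then have "inj_on ?h (set (labels (F @ G)))" by (simp only: distinct_map)
  from that[OF P R rel this] show ?thesis .
qed

subsection \<open>The Grossman--Larson product on labelled forests\<close>

lemma count_image_mset_inj: "inj f \<Longrightarrow> count (image_mset f M) (f x) = count M x"
  by (induction M) (auto simp: inj_eq)

lemma exotic_renumber:
  assumes "exotic f" "inj \<sigma>" "\<And>i. 0 < i \<Longrightarrow> 0 < \<sigma> i"
  shows "exotic (renumber \<sigma> f)"
  unfolding exotic_iff
proof (intro ballI allI impI)
  fix t i assume "t \<in> set (subs (renumber \<sigma> f))" and i: "decoration t = Some i"
  then obtain u where u: "u \<in> set (subs f)" "t = map_ptree (map_option \<sigma>) u"
    by (auto simp: renumber_def subs_map)
  then obtain j where j: "decoration u = Some j" "i = \<sigma> j" using i by auto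
  have *: "0 < j" "children u = []" "count (mset (labels f)) (Some j) = 2"
    using assms(1) u(1) j(1) unfolding exotic_iff by blast+
  have "count (image_mset (map_option \<sigma>) (mset (labels f))) (map_option \<sigma> (Some j)) = 2"
    using count_image_mset_inj[OF option.inj_map[OF assms(2)], of "mset (labels f)" "Some j"] * by simp
  then show "0 < i \<and> children t = [] \<and> count (mset (labels (renumber \<sigma> f))) (Some i) = 2"
    using * assms(3) by (simp add: u(2) j(2) renumber_def)
qed

text \<open>The renumberings that separate the factors of a product, such as doubling, are injective
  without being permutations.\<close>

lemma abs_renumber:
  assumes "exotic f" "inj \<sigma>" "\<And>i. 0 < i \<Longrightarrow> 0 < \<sigma> i"
  shows "abs_ef (renumber \<sigma> f) = abs_ef f"
proof -
  let ?F = "label_forest [] f" and ?h = "\<lambda>x. (fst x, map_option \<sigma> (snd x))"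
  have fg: "forget (relabel ?h ?F) = renumber \<sigma> f"
  proof -
    have "forget (relabel ?h ?F) = relabel (map_option \<sigma>) (forget ?F)"
      by (simp add: ptree.map_comp comp_def del: forget_label_forest forget_label_tree)
    then show ?thesis by (simp add: renumber_def)
  qed
  have "distinct (map fst (labels (relabel ?h ?F)))"
    using distinct_label_forest[of "[]" f] by (simp add: comp_def)
  then have "valid (relabel ?h ?F)"
    unfolding valid_iff fg using exotic_renumber[OF assms] distinct_map by blast
  moreover have "relabelling ?h (set (labels ?F))"
    unfolding relabelling_def using assms(2) by (intro exI[of _ \<sigma>]) (auto intro: inj_on_subset)
  ultimately have "cls (relabel ?h ?F) = cls ?F"
    by (intro cls_relabel valid_label_forest assms(1))
  then show ?thesis unfolding cls_def fg by simp
qed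

lemma nums_label_forest: "nums (label_forest p f) = {i. Some i \<in> set (labels f)}"
  using labels_map[of snd "label_forest p f"] by (simp add: nums_def)

text \<open>The tag \<open>k\<close> is the first entry of every address and the residue of every
  number modulo three. Three residues are provided because associativity involves three forests that
  must be pairwise apart.\<close>

lemma representative:
  fixes \<pi> :: ef and k :: nat
  obtains F :: "nat list lforest"
  where "valid F" "cls F = \<pi>" "\<And>x. x \<in> set (labels F) \<Longrightarrow> hd (fst x) = k"
    "\<And>i. i \<in> nums F \<Longrightarrow> i mod 3 = k mod 3"
proof -
  let ?\<sigma> = "\<lambda>i. 3 * i + k :: nat"
  let ?f = "renumber ?\<sigma> (rep_ef \<pi>)"
  have e: "exotic ?f" by (rule exotic_renumber) (auto simp: rep_ef_props inj_def)
  have "abs_ef ?f = \<pi>" by (subst abs_renumber) (auto simp: rep_ef_props inj_def)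
  then have "cls (label_forest [k] ?f) = \<pi>" by (simp add: cls_def)
  moreover have "hd (fst x) = k" if "x \<in> set (labels (label_forest [k] ?f))" for x
    using labels_label_forest[OF that] by auto
  moreover have "i mod 3 = k mod 3" if "i \<in> nums (label_forest [k] ?f)" for i
    using that by (auto simp: nums_label_forest renumber_def map_option_case split: option.splits)
  ultimately show ?thesis using that valid_label_forest[OF e] by blast
qed

lemma apart_tags:
  assumes "\<And>x. x \<in> set (labels F) \<Longrightarrow> s x = k" "\<And>x. x \<in> set (labels G) \<Longrightarrow> s x = l" "k \<noteq> l"
    and "\<And>i. i \<in> nums F \<Longrightarrow> u i = m" "\<And>i. i \<in> nums G \<Longrightarrow> u i = n" "m \<noteq> n"
  shows "apart F G"
  unfolding apart_def using assms by blast

lemma representatives3: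
  obtains F G H :: "nat list lforest"
  where "valid F" "valid G" "valid H" "cls F = \<pi>" "cls G = \<eta>" "cls H = \<zeta>"
    "apart F G" "apart F H" "apart G H"
proof -
  obtain F :: "nat list lforest" where F: "valid F" "cls F = \<pi>"
    "\<And>x. x \<in> set (labels F) \<Longrightarrow> hd (fst x) = 0" "\<And>i. i \<in> nums F \<Longrightarrow> i mod 3 = 0 mod 3"
    using representative[of \<pi> 0] by blast
  obtain G :: "nat list lforest" where G: "valid G" "cls G = \<eta>"
    "\<And>x. x \<in> set (labels G) \<Longrightarrow> hd (fst x) = 1" "\<And>i. i \<in> nums G \<Longrightarrow> i mod 3 = 1 mod 3"
    using representative[of \<eta> 1] by blast
  obtain H :: "nat list lforest" where H: "valid H" "cls H = \<zeta>"
    "\<And>x. x \<in> set (labels H) \<Longrightarrow> hd (fst x) = 2" "\<And>i. i \<in> nums H \<Longrightarrow> i mod 3 = 2 mod 3"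
    using representative[of \<zeta> 2] by blast
  have "apart F G" by (rule apart_tags[OF F(3) G(3) _ F(4) G(4)]) auto
  moreover have "apart F H" by (rule apart_tags[OF F(3) H(3) _ F(4) H(4)]) auto
  moreover have "apart G H" by (rule apart_tags[OF G(3) H(3) _ G(4) H(4)]) auto
  ultimately show ?thesis using F(1,2) G(1,2) H(1,2) that by blast
qed

section \<open>Transport of grafting maps, and independence of representatives\<close>

definition conj_map :: "('a \<Rightarrow> 'b) \<Rightarrow> ('c \<Rightarrow> 'd) \<Rightarrow> 'a set \<Rightarrow> ('a \<Rightarrow> 'c) \<Rightarrow> 'b \<Rightarrow> 'd" where
  "conj_map a b I \<phi> = restrict (\<lambda>y. b (\<phi> (inv_into I a y))) (a ` I)"

lemma conj_map_apply: "inj_on a I \<Longrightarrow> i \<in> I \<Longrightarrow> conj_map a b I \<phi> (a i) = b (\<phi> i)"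
  by (simp add: conj_map_def)

lemma bij_conj_map:
  assumes a: "inj_on a I" and b: "inj_on b V"
  shows "bij_betw (conj_map a b I) (I \<rightarrow>\<^sub>E V) (a ` I \<rightarrow>\<^sub>E b ` V)"
  unfolding bij_betw_def
proof
  show "inj_on (conj_map a b I) (I \<rightarrow>\<^sub>E V)"
  proof (rule inj_onI)
    fix \<phi> \<psi> assume h: "\<phi> \<in> I \<rightarrow>\<^sub>E V" "\<psi> \<in> I \<rightarrow>\<^sub>E V" "conj_map a b I \<phi> = conj_map a b I \<psi>"
    show "\<phi> = \<psi>"
    proof (rule PiE_ext[OF h(1,2)])
      fix i assume i: "i \<in> I"
      then have "b (\<phi> i) = b (\<psi> i)" using h(3) conj_map_apply[OF a i] by metis
      then show "\<phi> i = \<psi> i" using h(1,2) i b by (auto simp: inj_on_def PiE_iff)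
    qed
  qed
  show "conj_map a b I ` (I \<rightarrow>\<^sub>E V) = a ` I \<rightarrow>\<^sub>E b ` V"
  proof (intro subset_antisym subsetI)
    fix \<psi> assume "\<psi> \<in> conj_map a b I ` (I \<rightarrow>\<^sub>E V)"
    then show "\<psi> \<in> a ` I \<rightarrow>\<^sub>E b ` V"
      using a by (auto simp: conj_map_def PiE_iff)
  next
    fix \<psi> assume p: "\<psi> \<in> a ` I \<rightarrow>\<^sub>E b ` V"
    let ?\<phi> = "restrict (\<lambda>i. inv_into V b (\<psi> (a i))) I"
    have v: "\<psi> (a i) \<in> b ` V" if "i \<in> I" for i using p that by (auto simp: PiE_iff)
    have "?\<phi> \<in> I \<rightarrow>\<^sub>E V" using v by (auto intro: inv_into_into)
    moreover have "conj_map a b I ?\<phi> = \<psi>"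
    proof
      fix y show "conj_map a b I ?\<phi> y = \<psi> y"
      proof (cases "y \<in> a ` I")
        case True
        then obtain i where i: "i \<in> I" "y = a i" by blast
        then show ?thesis using conj_map_apply[OF a i(1), of b ?\<phi>] v[OF i(1)] by (simp add: f_inv_into_f)
      next
        case False
        then show ?thesis using p by (auto simp: conj_map_def PiE_iff extensional_def)
      qed
    qed
    ultimately show "\<psi> \<in> conj_map a b I ` (I \<rightarrow>\<^sub>E V)" by (metis image_eqI)
  qed
qed

definition push :: "('a \<times> nat option \<Rightarrow> 'b \<times> nat option) \<Rightarrow> 'a lforest \<Rightarrow>
    ('a \<times> nat option \<Rightarrow> ('a \<times> nat option) option) \<Rightarrow> ('b \<times> nat option \<Rightarrow> ('b \<times> nat option) option)" where
  "push h F = conj_map h (map_option h) (roots F)"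

text \<open>Grafting is equivariant: an injective relabelling of both forests carries maps to maps
  and each grafted forest to its relabelled version.\<close>

lemma push_props:
  assumes inj: "inj_on h (set (labels (F @ G)))" and rel: "relabelling h (set (labels (F @ G)))"
  shows "bij_betw (push h F) (maps F G) (maps (relabel h F) (relabel h G))"
    and "\<phi> \<in> maps F G \<Longrightarrow>
      glue (push h F \<phi>) (relabel h F) (relabel h G) = relabel h (glue \<phi> F G)"
proof -
  let ?B = "{x \<in> set (labels G). snd x = None}"
  have injF: "inj_on h (roots F)" using inj roots_labels[of F] by (auto intro: inj_on_subset)
  have injG: "inj_on h (set (labels G))" using inj by (auto intro: inj_on_subset)
  have injO: "inj_on (map_option h) (insert None (Some ` set (labels G)))"
    using injG by (auto simp: inj_on_def)
  have B: "{x \<in> set (labels (relabel h G)). snd x = None} = h ` ?B"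
    using relabelling_None[OF rel] by auto
  have "insert None (Some ` {x \<in> set (labels (relabel h G)). snd x = None}) =
      map_option h ` insert None (Some ` ?B)"
    unfolding B by (simp add: image_image)
  then show "bij_betw (push h F) (maps F G) (maps (relabel h F) (relabel h G))"
    unfolding maps_def push_def roots_map
    by (simp only:) (intro bij_conj_map injF inj_on_subset[OF injO], auto)
  assume \<phi>: "\<phi> \<in> maps F G"
  have fib: "fiber (push h F \<phi>) (relabel h F) (map_option h v) = relabel h (fiber \<phi> F v)"
    if "v \<in> insert None (Some ` set (labels G))" for v
  proof (rule fiber_map)
    fix x assume x: "x \<in> roots F"
    then have "\<phi> x \<in> insert None (Some ` set (labels G))" using maps_range[OF \<phi>] by blast
    then show "push h F \<phi> (h x) = map_option h v \<longleftrightarrow> \<phi> x = v"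
      unfolding push_def conj_map_apply[OF injF x] using injO that by (meson inj_on_eq_iff)
  qed
  show "glue (push h F \<phi>) (relabel h F) (relabel h G) = relabel h (glue \<phi> F G)"
    unfolding glue_def map_append using fib[of None]
    by (subst gr_map[where b = "\<lambda>x. fiber (push h F \<phi>) (relabel h F) (Some x)"])
      (auto simp: fib[of "Some _", simplified])
qed

lemma GL_sum_relabel:
  assumes "valid F" "valid G" "apart F G" "valid P" "valid R" "apart P R" "cls F = cls P" "cls G = cls R"
  shows "(\<Sum>\<phi>\<in>maps F G. basis (cls (glue \<phi> F G))) = (\<Sum>\<phi>\<in>maps P R. basis (cls (glue \<phi> P R)) :: ef \<Rightarrow>\<^sub>0 'k::field)"
proof -
  obtain h where h: "P = relabel h F" "R = relabel h G"
    "relabelling h (set (labels (F @ G)))" "inj_on h (set (labels (F @ G)))"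
    by (rule cls_pair_eqD[OF assms])
  note push = push_props[OF h(4,3), folded h(1,2)]
  have "cls (glue (push h F \<phi>) P R) = cls (glue \<phi> F G)" if \<phi>: "\<phi> \<in> maps F G" for \<phi>
  proof -
    have "push h F \<phi> \<in> maps P R" using push(1) \<phi> by (auto simp: bij_betw_def)
    then have "valid (glue (push h F \<phi>) P R)" using valid_glue assms by blast
    then show ?thesis
      using cls_relabel[OF valid_glue[OF assms(1-3) \<phi>], of h] h(3) push(2)[OF \<phi>]
        set_labels_glue[OF \<phi> valid_distinct[OF assms(2)]] by simp
  qed
  then have "(\<Sum>\<phi>\<in>maps F G. basis (cls (glue \<phi> F G))) =
      (\<Sum>\<phi>\<in>maps F G. basis (cls (glue (push h F \<phi>) P R)) :: ef \<Rightarrow>\<^sub>0 'k)"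
    by (intro sum.cong) auto
  also have "\<dots> = (\<Sum>\<phi>\<in>maps P R. basis (cls (glue \<phi> P R)))"
    by (rule sum.reindex_bij_betw[OF push(1)])
  finally show ?thesis .
qed

text \<open>\<open>graft\<close> finds nodes by address and \<open>gr\<close> by label. In an
  address-labelled tree, the node \<open>v\<close> has the label \<open>(q @ v, deco t v)\<close>,
  which translates between them.\<close>

lemma graft_label_tree:
  assumes "\<And>v. v \<in> nodes t \<Longrightarrow> relabel snd (a (q @ v, deco t v)) = b v"
  shows "map_ptree snd (gr a (label_tree q t)) = graft b t"
  using assms
proof (induction t arbitrary: q b)
  case (Node d ts)
  have "map_ptree snd (gr a (label_tree (q @ [i]) (ts ! i))) = graft (\<lambda>p. b (i # p)) (ts ! i)" if "i < length
      ts" for i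
  proof (rule Node.IH)
    show "ts ! i \<in> set ts" using that by simp
    fix v assume "v \<in> nodes (ts ! i)"
    then show "relabel snd (a ((q @ [i]) @ v, deco (ts ! i) v)) = b (i # v)"
      using Node.prems[of "i # v"] that by (simp add: nodes_def deco_def)
  qed
  moreover have "relabel snd (a (q, d)) = b []"
    using Node.prems[of "[]"] by (simp add: nodes_def deco_def)
  ultimately show ?case by (simp add: label_forest_def)
qed

lemma labels_label_forest_eq:
  "(\<lambda>x. Some x) ` set (labels (label_forest q g)) = (\<lambda>v. Some (q @ v, deco (Bplus g) v)) ` (nodes (Bplus g) - {[]})"
proof -
  have "insert (q, None) (set (labels (label_forest q g))) = (\<lambda>v. (q @ v, deco (Bplus g) v)) ` nodes (Bplus g)"
    unfolding set_labels_label_tree[symmetric] by (simp add: Bplus_def)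
  moreover have "(q, None) \<notin> set (labels (label_forest q g))"
    using labels_label_forest by fastforce
  moreover have "set (labels (label_forest q g)) = insert (q, None) (set (labels (label_forest q g))) - {(q, None)}"
    using calculation(2) by simp
  ultimately have "set (labels (label_forest q g)) = (\<lambda>v. (q @ v, deco (Bplus g) v)) ` nodes (Bplus g) - {(q,
      None)}"
    by simp
  also have "\<dots> = (\<lambda>v. (q @ v, deco (Bplus g) v)) ` (nodes (Bplus g) - {[]})"
    using image_set_diff[of "\<lambda>v. (q @ v, deco (Bplus g) v)" "nodes (Bplus g)" "{[]}"]
    by (simp add: inj_def) (simp add: deco_def Bplus_def)
  finally show ?thesis by (simp add: image_image)
qed

lemma GL_basis_label_forest:
  fixes \<pi> \<eta> p q
  defines "F \<equiv> label_forest p (rep_even \<pi>)" and "G \<equiv> label_forest q (rep_odd \<eta>)"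
  shows "GL_basis \<pi> \<eta> = (\<Sum>\<phi>\<in>maps F G. basis (cls (glue \<phi> F G)) :: ef \<Rightarrow>\<^sub>0 'k::field)"
proof -
  define f g where "f = rep_even \<pi>" and "g = rep_odd \<eta>"
  let ?t = "Bplus g"
  define rt where "rt = (\<lambda>i. decoration (F ! i))"
  \<comment> \<open>The address of the added root means staying, hence \<open>None\<close>; every
    other address becomes the label of its node.\<close>
  define nd where "nd = (\<lambda>v. if v = [] then None else Some (q @ v, deco ?t v))"
  have lenF: "length F = length f" by (simp add: F_def f_def)
  have rt: "rt i = (p @ [i], decoration (f ! i))" if "i < length f" for i
    using that by (simp add: rt_def F_def f_def)
  have injr: "inj_on rt {..<length f}" by (auto simp: inj_on_def rt)
  have roots: "roots F = rt ` {..<length f}"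
    unfolding roots_def rt_def lenF[symmetric] by (auto simp: set_conv_nth)
  have injn: "inj nd" by (auto simp: inj_def nd_def)
  have "Some ` {x \<in> set (labels G). snd x = None} = {y \<in> Some ` set (labels G). snd (the y) = None}"
    by auto
  also have "\<dots> = nd ` (black_nodes ?t - {[]})"
    unfolding G_def g_def[symmetric] labels_label_forest_eq by (auto simp: nd_def black_nodes_def)
  finally have "insert None (Some ` {x \<in> set (labels G). snd x = None}) = insert (nd []) (nd ` (black_nodes ?t
      - {[]}))"
    by (simp add: nd_def)
  moreover have "[] \<in> black_nodes ?t" by (simp add: black_nodes_def nodes_def deco_def Bplus_def)
  ultimately have "insert None (Some ` {x \<in> set (labels G). snd x = None}) = nd ` black_nodes ?t"
    by (metis image_insert insert_Diff)
  then have bij: "bij_betw (conj_map rt nd {..<length f}) ({..<length f} \<rightarrow>\<^sub>E black_nodes ?t) (maps F G)"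
    unfolding maps_def roots using bij_conj_map[OF injr inj_on_subset[OF injn], of "black_nodes ?t"] by simp
  have tm: "Bminus (graft (\<lambda>v. nths f {i. i < length f \<and> \<phi> i = v}) ?t) =
      forget (glue (conj_map rt nd {..<length f} \<phi>) F G)" for \<phi>
  proof -
    let ?\<psi> = "conj_map rt nd {..<length f} \<phi>"
    have fib: "forget (fiber ?\<psi> F (nd v)) = nths f {i. i < length f \<and> \<phi> i = v}" for v
    proof -
      have "?\<psi> (decoration (F ! i)) = nd v \<longleftrightarrow> \<phi> i = v" if "i < length f" for i
        using conj_map_apply[OF injr, of i nd \<phi>] that injn by (simp add: rt_def inj_eq)
      then have "fiber ?\<psi> F (nd v) = nths F {i. i < length f \<and> \<phi> i = v}"
        unfolding fiber_def filter_eq_nths lenF by (intro arg_cong[where f = "nths F"]) auto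
      then show ?thesis by (simp add: nths_map[symmetric] F_def f_def)
    qed
    \<comment> \<open>\<open>(q, None)\<close> is the label of the added root in
      \<open>label_tree q ?t\<close>. It does not occur in \<open>G\<close>, so below the root the
      exceptional case never applies.\<close>
    let ?a = "\<lambda>x. fiber ?\<psi> F (if x = (q, None) then None else Some x)"
    have "map_ptree snd (gr ?a (label_tree q ?t)) = graft (\<lambda>v. nths f {i. i < length f \<and> \<phi> i = v}) ?t"
    proof (rule graft_label_tree)
      fix v
      have "(if (q @ v, deco ?t v) = (q, None) then None else Some (q @ v, deco ?t v)) = nd v"
        by (auto simp: nd_def deco_def Bplus_def)
      then show "forget (?a (q @ v, deco ?t v)) = nths f {i. i < length f \<and> \<phi> i = v}"
        using fib[of v] by simp
    qed
    moreover have "map (gr ?a) G = map (gr (\<lambda>x. fiber ?\<psi> F (Some x))) G"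
      by (rule gr_cong) (use labels_label_forest in \<open>fastforce simp: G_def\<close>)
    moreover have "label_tree q ?t = Node (q, None) G" by (simp add: Bplus_def G_def g_def)
    moreover from calculation have
      "graft (\<lambda>v. nths f {i. i < length f \<and> \<phi> i = v}) ?t = Node None (forget (glue ?\<psi> F G))"
      unfolding glue_def map_append by simp
    ultimately show ?thesis by (simp add: Bminus_def)
  qed
  have "GL_basis \<pi> \<eta> = (\<Sum>\<phi>\<in>{..<length f} \<rightarrow>\<^sub>E black_nodes ?t.
      basis (cls (glue (conj_map rt nd {..<length f} \<phi>) F G)))"
    unfolding GL_basis_def Let_def f_def[symmetric] g_def[symmetric] tm cls_def ..
  also have "\<dots> = (\<Sum>\<phi>\<in>maps F G. basis (cls (glue \<phi> F G)))"
    by (rule sum.reindex_bij_betw[OF bij])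
  finally show ?thesis .
qed

lemma rep_even_odd:
  "valid (label_forest p (rep_even \<pi>))" "valid (label_forest p (rep_odd \<pi>))"
  "cls (label_forest p (rep_even \<pi>)) = \<pi>" "cls (label_forest p (rep_odd \<pi>)) = \<pi>"
  "apart (label_forest [0] (rep_even \<pi>)) (label_forest [1] (rep_odd \<eta>))"
proof -
  show "valid (label_forest p (rep_even \<pi>))" "valid (label_forest p (rep_odd \<pi>))"
    unfolding rep_even_def rep_odd_def
    by (intro valid_label_forest exotic_renumber rep_ef_props; simp add: inj_def)+
  show "cls (label_forest p (rep_even \<pi>)) = \<pi>" "cls (label_forest p (rep_odd \<pi>)) = \<pi>"
    unfolding cls_def forget_label_forest rep_even_def rep_odd_def
    by (subst abs_renumber; simp add: rep_ef_props inj_def)+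
  have "set (labels (label_forest [0] (rep_even \<pi>))) \<inter> set (labels (label_forest [1] (rep_odd \<eta>))) = {}"
    using labels_label_forest[of _ "[0]" "rep_even \<pi>"] labels_label_forest[of _ "[1]" "rep_odd \<eta>"]
    by fastforce
  moreover have "even i" if "i \<in> nums (label_forest [0] (rep_even \<pi>))" for i
    using that by (auto simp: nums_label_forest rep_even_def renumber_def map_option_case split: option.splits)
  moreover have "odd i" if "i \<in> nums (label_forest [1] (rep_odd \<eta>))" for i
    using that by (auto simp: nums_label_forest rep_odd_def renumber_def map_option_case split: option.splits)
  ultimately show "apart (label_forest [0] (rep_even \<pi>)) (label_forest [1] (rep_odd \<eta>))"
    unfolding apart_def by blast
qed

text \<open>This frees the product from \<open>rep_even\<close> and \<open>rep_odd\<close>: all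
  later arguments choose their own labelled representatives.\<close>

theorem GL_basis_labelled:
  assumes "valid F" "valid G" "apart F G"
  shows "GL_basis (cls F) (cls G) = (\<Sum>\<phi>\<in>maps F G. basis (cls (glue \<phi> F G)) :: ef \<Rightarrow>\<^sub>0 'k::field)"
  unfolding GL_basis_label_forest[of "cls F" "cls G" "[0]" "[1]"]
  by (rule GL_sum_relabel) (simp_all only: rep_even_odd assms)

subsection \<open>Deshuffling labelled forests\<close>

definition sel :: "'d set \<Rightarrow> 'd ptree list \<Rightarrow> 'd ptree list" where
  "sel I F = filter (\<lambda>t. decoration t \<in> I) F"

text \<open>For a valid forest these are the root sets of the unions of connected components, by
  \<open>deshuffle_label_forest\<close>.\<close>

definition closed_roots :: "'a lforest \<Rightarrow> ('a \<times> nat option) set set" where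
  "closed_roots F = {I. I \<subseteq> roots F \<and> nums (sel I F) \<inter> nums (sel (- I) F) = {}}"

lemma roots_sel [simp]: "roots (sel I F) = roots F \<inter> I"
  by (auto simp: roots_def sel_def)

lemma set_sel: "set (sel I F) = {t \<in> set F. decoration t \<in> I}"
  by (auto simp: sel_def)

lemma labels_sel: "set (labels (sel I F)) \<subseteq> set (labels F)"
  using set_labels[of "sel I F"] set_labels[of F] by (auto simp: set_sel)

lemma mset_labels_sel: "mset (labels (sel I F)) + mset (labels (sel (- I) F)) = mset (labels F)"
  unfolding sel_def using mset_labels_filter[of "\<lambda>t. decoration t \<in> I" F] by simp

lemma finite_closed [simp]: "finite (closed_roots F)"
  by (rule finite_subset[of _ "Pow (roots F)"]) (auto simp: closed_roots_def)

lemma nums_sel: "nums (sel I F) = (\<Union>t\<in>{t \<in> set F. decoration t \<in> I}. nums [t])"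
  unfolding nums_def using set_labels[of "sel I F"] by (auto simp: set_sel image_iff)

text \<open>The tree-by-tree form, in which stability under complement and intersection is
  immediate.\<close>

lemma closed_iff: "I \<in> closed_roots F \<longleftrightarrow> I \<subseteq> roots F \<and>
    (\<forall>s\<in>set F. \<forall>t\<in>set F. decoration s \<in> I \<and> decoration t \<notin> I \<longrightarrow> nums [s] \<inter> nums [t] = {})"
  unfolding closed_roots_def nums_sel by blast

text \<open>A number occurs zero or two times in \<open>F\<close>; a selection is exotic precisely
  when both occurrences always fall on the same side.\<close>

lemma valid_sel_iff:
  assumes F: "valid F"
  shows "valid (sel I F) \<longleftrightarrow> nums (sel I F) \<inter> nums (sel (- I) F) = {}"
proof -
  let ?c = "\<lambda>F i. count (image_mset snd (mset (labels F))) (Some i)"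
  have sum: "?c F i = ?c (sel I F) i + ?c (sel (- I) F) i" for i
    unfolding mset_labels_sel[of I F, symmetric] by simp
  have cF: "?c F i \<in> {0, 2}" for i using F by (simp only: valid_def)
  have sub: "set (subs (sel I F)) \<subseteq> set (subs F)" by (auto simp: subs_def set_sel)
  have numsub: "nums (sel I F) \<subseteq> nums F" using labels_sel[of I F] by (auto simp: nums_def)
  have dis: "distinct (labels (sel I F))"
    using valid_distinct[OF F] mset_labels_sel[of I F]
    by (metis distinct_append mset_append mset_eq_imp_distinct_iff)
  show ?thesis
  proof
    assume "valid (sel I F)"
    then have c: "?c (sel I F) i \<in> {0, 2}" for i by (simp only: valid_def)
    have "?c (sel I F) i = 0 \<or> ?c (sel (- I) F) i = 0" for i
    proof -
      \<comment> \<open>The total and one part are each zero or two, so either that part or the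
        remaining one is zero.\<close>
      have "a = 0 \<or> b = 0" if "s \<in> {0, 2}" "a \<in> {0, 2}" "s = a + b" for s a b :: nat
        using that by auto
      from this[OF cF[of i] c[of i] sum[of i]] show ?thesis .
    qed
    then show "nums (sel I F) \<inter> nums (sel (- I) F) = {}"
      using nums_count by (metis disjoint_iff less_numeral_extra(3))
  next
    assume d: "nums (sel I F) \<inter> nums (sel (- I) F) = {}"
    have "?c (sel I F) i \<in> {0, 2}" for i
    proof (cases "i \<in> nums (sel I F)")
      case True
      then have "i \<notin> nums (sel (- I) F)" using d by blast
      then have "?c (sel (- I) F) i = 0" using nums_count by (metis not_gr_zero)
      then show ?thesis using sum[of i] cF[of i] by simp
    next
      case False
      then have "?c (sel I F) i = 0" using nums_count by (metis not_gr_zero)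
      then show ?thesis by simp
    qed
    moreover have "0 \<notin> nums (sel I F)" using F numsub by (auto simp: valid_def)
    moreover have "\<forall>t\<in>set (subs (sel I F)). snd (decoration t) \<noteq> None \<longrightarrow> children t = []"
      using F sub unfolding valid_def by blast
    ultimately show "valid (sel I F)" unfolding valid_def using dis by blast
  qed
qed

lemma closed_valid: "valid F \<Longrightarrow> I \<in> closed_roots F \<longleftrightarrow> I \<subseteq> roots F \<and> valid (sel I F)"
  by (simp add: closed_roots_def valid_sel_iff)

lemma apart_sel:
  assumes "valid F" "I \<in> closed_roots F"
  shows "valid (sel I F)" "valid (sel (- I) F)" "apart (sel I F) (sel (- I) F)"
proof -
  show v: "valid (sel I F)" "valid (sel (- I) F)"
    using assms valid_sel_iff[of F I] valid_sel_iff[of F "- I"] by (auto simp: closed_roots_def)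
  have "distinct (labels (sel I F) @ labels (sel (- I) F))"
    using valid_distinct[OF assms(1)] mset_labels_sel[of I F]
    by (metis mset_append mset_eq_imp_distinct_iff)
  then show "apart (sel I F) (sel (- I) F)"
    using assms(2) by (auto simp: apart_def closed_roots_def)
qed

lemma nums_relabel:
  assumes "\<forall>x\<in>set (labels F). snd (h x) = map_option \<sigma> (snd x)"
  shows "nums (relabel h F) = \<sigma> ` nums F"
proof (intro set_eqI iffI)
  fix i assume "i \<in> nums (relabel h F)"
  then have "Some i \<in> snd ` h ` set (labels F)" by (simp add: nums_def)
  then obtain x where "x \<in> set (labels F)" "snd (h x) = Some i" by (metis imageE)
  then obtain j where "snd x = Some j" "i = \<sigma> j" using assms by auto
  then show "i \<in> \<sigma> ` nums F" using \<open>x \<in> set (labels F)\<close> unfolding nums_def by force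
next
  fix i assume "i \<in> \<sigma> ` nums F"
  then obtain x j where x: "x \<in> set (labels F)" "snd x = Some j" "i = \<sigma> j" unfolding nums_def by force
  then have "snd (h x) = Some i" using assms by auto
  then show "i \<in> nums (relabel h F)" using x(1) unfolding nums_def by force
qed

lemma closed_relabel:
  assumes rel: "relabelling h (set (labels F))" and inj: "inj_on h (set (labels F))"
  shows "bij_betw ((`) h) (closed_roots F) (closed_roots (relabel h F))"
    and "I \<subseteq> roots F \<Longrightarrow> sel (h ` I) (relabel h F) = relabel h (sel I F)"
    and "I \<subseteq> roots F \<Longrightarrow> sel (- (h ` I)) (relabel h F) = relabel h (sel (- I) F)"
proof -
  have injr: "inj_on h (roots F)" using inj roots_labels[of F] by (rule inj_on_subset)
  have mem: "h (decoration t) \<in> h ` I \<longleftrightarrow> decoration t \<in> I" if "I \<subseteq> roots F" "t \<in> set F" for I t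
    using inj_on_image_mem_iff[OF injr _ that(1)] that(2) by (simp add: roots_def)
  have s1: "sel (h ` I) (relabel h F) = relabel h (sel I F)" if "I \<subseteq> roots F" for I
    using mem[OF that] by (simp add: sel_def filter_map comp_def cong: filter_cong)
  have s2: "sel (- (h ` I)) (relabel h F) = relabel h (sel (- I) F)" if "I \<subseteq> roots F" for I
    using mem[OF that] by (simp add: sel_def filter_map comp_def cong: filter_cong)
  show "I \<subseteq> roots F \<Longrightarrow> sel (h ` I) (relabel h F) = relabel h (sel I F)"
    and "I \<subseteq> roots F \<Longrightarrow> sel (- (h ` I)) (relabel h F) = relabel h (sel (- I) F)"
    by (rule s1 s2; assumption)+
  obtain \<sigma> where s: "inj_on \<sigma> (nums F)" "\<forall>x\<in>set (labels F). snd (h x) = map_option \<sigma> (snd x)"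
    using rel unfolding relabelling_def nums_def by blast
  have n: "nums (relabel h (sel I F)) = \<sigma> ` nums (sel I F)" for I
    using nums_relabel[of "sel I F" h \<sigma>] s(2) labels_sel[of I F] by blast
  have sub: "nums (sel I F) \<subseteq> nums F" for I
    using labels_sel[of I F] by (auto simp: nums_def)
  have cl: "h ` I \<in> closed_roots (relabel h F) \<longleftrightarrow> I \<in> closed_roots F" if "I \<subseteq> roots F" for I
    using that image_mono[OF that, of h]
    by (simp add: closed_roots_def s1 s2 n inj_on_image_Int[OF s(1) sub sub, symmetric])
  show "bij_betw ((`) h) (closed_roots F) (closed_roots (relabel h F))"
    unfolding bij_betw_def
  proof
    show "inj_on ((`) h) (closed_roots F)"
      using inj_on_image_Pow[OF injr] by (rule inj_on_subset) (auto simp: closed_roots_def)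
    show "(`) h ` closed_roots F = closed_roots (relabel h F)"
    proof (intro subset_antisym subsetI)
      fix J assume "J \<in> (`) h ` closed_roots F"
      then show "J \<in> closed_roots (relabel h F)" using cl by (auto simp: closed_roots_def)
    next
      fix J assume J: "J \<in> closed_roots (relabel h F)"
      then have "J \<subseteq> h ` roots F" by (simp add: closed_roots_def)
      then obtain I where "I \<subseteq> roots F" "J = h ` I" by (auto simp: subset_image_iff)
      then show "J \<in> (`) h ` closed_roots F" using J cl by blast
    qed
  qed
qed

section \<open>Connected components as atoms of a Boolean algebra of position sets\<close>

definition atoms :: "'a set set \<Rightarrow> 'a set set" where
  "atoms C = {I \<in> C. I \<noteq> {} \<and> \<not> (\<exists>J\<in>C. \<exists>K\<in>C. J \<noteq> {} \<and> K \<noteq> {} \<and> J \<inter> K = {} \<and> J \<union> K = I)}"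

text \<open>A finite Boolean algebra of sets is isomorphic to the power set of its atoms. The
  definition of \<open>atoms\<close> copies the splitting condition in
  \<open>connected_forest\<close>.\<close>

lemma bij_Union_atoms:
  assumes fin: "finite X" and sub: "\<And>I. I \<in> C \<Longrightarrow> I \<subseteq> X"
    and compl: "\<And>I. I \<in> C \<Longrightarrow> X - I \<in> C" and inter: "\<And>I J. I \<in> C \<Longrightarrow> J \<in> C \<Longrightarrow> I \<inter> J \<in> C"
    and empty: "{} \<in> C"
  shows "bij_betw Union (Pow (atoms C)) C"
    and "S \<subseteq> atoms C \<Longrightarrow> \<Union>(atoms C - S) = X - \<Union>S"
proof -
  have diff: "I - J \<in> C" if "I \<in> C" "J \<in> C" for I J
  proof -
    have "I - J = I \<inter> (X - J)" using sub[OF that(1)] by blast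
    then show ?thesis using inter compl that by metis
  qed
  have un: "I \<union> J \<in> C" if "I \<in> C" "J \<in> C" for I J
  proof -
    have "I \<union> J = X - ((X - I) \<inter> (X - J))" using sub[OF that(1)] sub[OF that(2)] by blast
    then show ?thesis using inter compl that by metis
  qed
  \<comment> \<open>An atom meeting \<open>B\<close> without being contained in it would split into
    \<open>A \<inter> B\<close> and \<open>A - B\<close>.\<close>
  have le: "A \<subseteq> B" if A: "A \<in> atoms C" and B: "B \<in> C" and ne: "A \<inter> B \<noteq> {}" for A B
  proof (rule ccontr)
    assume "\<not> A \<subseteq> B"
    then have "A - B \<noteq> {}" "A \<inter> B \<in> C" "A - B \<in> C" "(A \<inter> B) \<inter> (A - B) = {}" "(A \<inter> B) \<union> (A - B) = A"
      using A B inter diff by (auto simp: atoms_def)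
    then have "\<exists>J\<in>C. \<exists>K\<in>C. J \<noteq> {} \<and> K \<noteq> {} \<and> J \<inter> K = {} \<and> J \<union> K = A"
      using ne by (intro bexI[of _ "A \<inter> B"] bexI[of _ "A - B"]) simp_all
    with A show False unfolding atoms_def mem_Collect_eq by (elim conjE) (erule notE, assumption)
  qed
  have disj: "A = B" if "A \<in> atoms C" "B \<in> atoms C" "A \<inter> B \<noteq> {}" for A B
    using le[of A B] le[of B A] that by (auto simp: atoms_def)
  \<comment> \<open>A member that is no atom splits into two smaller members, and the point lies in
    one of them; this ends by finiteness.\<close>
  have ex: "\<exists>A\<in>atoms C. x \<in> A" if "x \<in> I" "I \<in> C" for x I
    using that
  proof (induction "card I" arbitrary: I rule: less_induct)
    case less
    have finI: "finite I" using sub[OF less.prems(2)] fin by (rule finite_subset)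
    show ?case
    proof (cases "I \<in> atoms C")
      case False
      then obtain J K where JK: "J \<in> C" "K \<in> C" "J \<noteq> {}" "K \<noteq> {}" "J \<inter> K = {}" "J \<union> K = I"
        using less.prems unfolding atoms_def by blast
      have "J \<subset> I" "K \<subset> I" using JK(3-6) by blast+
      then have "card J < card I" "card K < card I" using finI by (auto intro: psubset_card_mono)
      then show ?thesis using less.hyps[of J] less.hyps[of K] less.prems(1) JK by blast
    qed (use less.prems in blast)
  qed
  have XC: "X \<in> C" using compl[OF empty] by simp
  have part: "\<Union>{A \<in> atoms C. A \<subseteq> I} = I" if I: "I \<in> C" for I
  proof (intro subset_antisym subsetI)
    fix x assume x: "x \<in> I"
    then obtain A where A: "A \<in> atoms C" "x \<in> A" using ex[OF _ I] by blast
    then have "A \<subseteq> I" using le[OF A(1) I] x by blast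
    then show "x \<in> \<Union>{A \<in> atoms C. A \<subseteq> I}" using A by blast
  qed blast
  have UC: "\<Union>S \<in> C" if "S \<subseteq> atoms C" for S
  proof -
    have "finite S"
      using that fin sub by (intro finite_subset[of S "Pow X"]) (auto simp: atoms_def)
    then show ?thesis using that
    proof (induction S)
      case (insert A S)
      then show ?case using un[of A "\<Union>S"] by (simp add: atoms_def)
    qed (simp add: empty)
  qed
  have inv: "{A \<in> atoms C. A \<subseteq> \<Union>S} = S" if S: "S \<subseteq> atoms C" for S
  proof (intro subset_antisym subsetI)
    fix A assume A: "A \<in> {A \<in> atoms C. A \<subseteq> \<Union>S}"
    then obtain x where "x \<in> A" by (auto simp: atoms_def)
    then obtain B where "B \<in> S" "x \<in> B" using A by blast
    then show "A \<in> S" using disj[of A B] A S \<open>x \<in> A\<close> by blast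
  qed (use S in blast)
  show "bij_betw Union (Pow (atoms C)) C"
    by (rule bij_betw_byWitness[where f' = "\<lambda>I. {A \<in> atoms C. A \<subseteq> I}"]) (use inv part UC in auto)
  assume S: "S \<subseteq> atoms C"
  show "\<Union>(atoms C - S) = X - \<Union>S"
  proof (intro subset_antisym subsetI)
    fix x assume "x \<in> \<Union>(atoms C - S)"
    then obtain A where A: "x \<in> A" "A \<in> atoms C" "A \<notin> S" by blast
    then have "x \<notin> \<Union>S" using disj[OF A(2)] S by blast
    then show "x \<in> X - \<Union>S" using A sub by (auto simp: atoms_def)
  next
    fix x assume x: "x \<in> X - \<Union>S"
    then obtain A where "A \<in> atoms C" "x \<in> A" using ex[OF _ XC] by blast
    then show "x \<in> \<Union>(atoms C - S)" using x by blast
  qed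
qed

text \<open>\<open>nths (nths f I) A\<close> counts positions inside the sublist. The rank of a
  position within \<open>I\<close> translates between those positions and the positions in
  \<open>f\<close>.\<close>

lemma rank_bij:
  fixes I :: "nat set"
  assumes "finite I"
  shows "bij_betw (\<lambda>i. card {j \<in> I. j < i}) I {..<card I}"
proof -
  let ?r = "\<lambda>i. card {j \<in> I. j < i}"
  have lt: "?r i < ?r k" if "i \<in> I" "i < k" for i k
    using that assms by (intro psubset_card_mono) auto
  have "inj_on ?r I"
  proof (rule inj_onI)
    fix i k assume "i \<in> I" "k \<in> I" "?r i = ?r k"
    then show "i = k" using lt[of i k] lt[of k i] by (cases i k rule: linorder_cases) auto
  qed
  moreover have "?r ` I \<subseteq> {..<card I}"
    using assms by (auto intro!: psubset_card_mono)
  moreover from calculation have "?r ` I = {..<card I}"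
    by (intro card_subset_eq) (auto simp: card_image)
  ultimately show ?thesis by (simp add: bij_betw_def)
qed

lemma split_transport:
  assumes r: "bij_betw r I N"
  shows "(\<exists>A B. A \<noteq> {} \<and> B \<noteq> {} \<and> A \<inter> B = {} \<and> A \<union> B = N \<and> P {i \<in> I. r i \<in> A} \<and> P {i \<in> I. r i \<in> B}) \<longleftrightarrow>
    (\<exists>J K. J \<noteq> {} \<and> K \<noteq> {} \<and> J \<inter> K = {} \<and> J \<union> K = I \<and> P J \<and> P K)"
    (is "?L \<longleftrightarrow> ?R")
proof
  have img: "r ` I = N" and inj: "inj_on r I" using r by (simp_all add: bij_betw_def)
  {
    assume ?L
    then obtain A B where AB: "A \<noteq> {}" "B \<noteq> {}" "A \<inter> B = {}" "A \<union> B = N"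
      and P: "P {i \<in> I. r i \<in> A}" "P {i \<in> I. r i \<in> B}" by blast
    have "{i \<in> I. r i \<in> X} \<noteq> {}" if "X \<noteq> {}" "X \<subseteq> N" for X
    proof -
      obtain x where "x \<in> X" using \<open>X \<noteq> {}\<close> by blast
      then have "x \<in> r ` I" using \<open>X \<subseteq> N\<close> img by blast
      then show ?thesis using \<open>x \<in> X\<close> by blast
    qed
    then have "{i \<in> I. r i \<in> A} \<noteq> {}" "{i \<in> I. r i \<in> B} \<noteq> {}" using AB by blast+
    moreover have "{i \<in> I. r i \<in> A} \<inter> {i \<in> I. r i \<in> B} = {}" using AB(3) by blast
    moreover have "{i \<in> I. r i \<in> A} \<union> {i \<in> I. r i \<in> B} = I" using AB(4) img by blast
    ultimately show ?R using P
      by (intro exI[of _ "{i \<in> I. r i \<in> A}"] exI[of _ "{i \<in> I. r i \<in> B}"] conjI)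
  next
    assume ?R
    then obtain J K where JK: "J \<noteq> {}" "K \<noteq> {}" "J \<inter> K = {}" "J \<union> K = I" and P: "P J" "P K" by blast
    have pre: "{i \<in> I. r i \<in> r ` X} = X" if "X \<subseteq> I" for X
      using that inj_on_image_mem_iff[OF inj _ that] by blast
    have "P {i \<in> I. r i \<in> r ` J}" "P {i \<in> I. r i \<in> r ` K}" using P JK(4) pre[of J] pre[of K] by auto
    moreover have "r ` J \<inter> r ` K = {}" using JK(3,4) inj_on_image_Int[OF inj, of J K] by auto
    moreover have "r ` J \<union> r ` K = N" using JK(4) img by blast
    moreover have "r ` J \<noteq> {}" "r ` K \<noteq> {}" using JK(1,2) by auto
    ultimately show ?L by (intro exI[of _ "r ` J"] exI[of _ "r ` K"] conjI)
  }
qed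

text \<open>Along the ranks, splittings of the sublist into exotic parts become splittings of
  \<open>I\<close> itself, as in \<open>atoms\<close>.\<close>

lemma connected_nths_iff:
  assumes I: "I \<subseteq> {..<length f}"
  shows "connected_forest (nths f I) \<longleftrightarrow> I \<in> atoms {J. J \<subseteq> {..<length f} \<and> exotic (nths f J)}"
    (is "_ \<longleftrightarrow> _ \<in> atoms ?C")
proof -
  let ?r = "\<lambda>i. card {j \<in> I. j < i}"
  have fI: "finite I" using I finite_subset by blast
  have r: "bij_betw ?r I {..<card I}" by (rule rank_bij[OF fI])
  have len: "length (nths f I) = card I"
  proof -
    have "{i. i < length f \<and> i \<in> I} = I" using I by auto
    then show ?thesis by (simp add: length_nths)
  qed
  have nn: "nths (nths f I) A = nths f {i \<in> I. ?r i \<in> A}" for A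
    by (simp add: nths_nths)
  have "(\<exists>A B. A \<noteq> {} \<and> B \<noteq> {} \<and> A \<inter> B = {} \<and> A \<union> B = {..<card I} \<and>
      exotic (nths (nths f I) A) \<and> exotic (nths (nths f I) B)) \<longleftrightarrow>
    (\<exists>J K. J \<noteq> {} \<and> K \<noteq> {} \<and> J \<inter> K = {} \<and> J \<union> K = I \<and> exotic (nths f J) \<and> exotic (nths f K))"
    unfolding nn using split_transport[OF r, of "\<lambda>J. exotic (nths f J)"] by simp
  moreover have "nths f I \<noteq> [] \<longleftrightarrow> I \<noteq> {}"
    using len fI by (metis card_0_eq length_0_conv)
  ultimately have "connected_forest (nths f I) \<longleftrightarrow> exotic (nths f I) \<and> I \<noteq> {} \<and>
      \<not> (\<exists>J K. J \<noteq> {} \<and> K \<noteq> {} \<and> J \<inter> K = {} \<and> J \<union> K = I \<and> exotic (nths f J) \<and> exotic (nths f K))"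
    unfolding connected_forest_def len by simp
  moreover have "(\<exists>J K. J \<noteq> {} \<and> K \<noteq> {} \<and> J \<inter> K = {} \<and> J \<union> K = I \<and> exotic (nths f J) \<and> exotic (nths f K)) \<longleftrightarrow>
      (\<exists>J\<in>?C. \<exists>K\<in>?C. J \<noteq> {} \<and> K \<noteq> {} \<and> J \<inter> K = {} \<and> J \<union> K = I)" (is "?L \<longleftrightarrow> ?R")
  proof
    assume ?L
    then obtain J K where JK: "J \<noteq> {}" "K \<noteq> {}" "J \<inter> K = {}" "J \<union> K = I" "exotic (nths f J)" "exotic (nths f K)"
      by blast
    have "J \<in> ?C" "K \<in> ?C" using JK(4-6) I by auto
    with JK(1-4) show ?R by (intro bexI[of _ J] bexI[of _ K] conjI)
  next
    assume ?R
    then obtain J K where "J \<noteq> {}" "K \<noteq> {}" "J \<inter> K = {}" "J \<union> K = I" "exotic (nths f J)" "exotic (nths f K)"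
      by blast
    then show ?L by (intro exI[of _ J] exI[of _ K] conjI)
  qed
  moreover have "I \<in> atoms ?C \<longleftrightarrow> exotic (nths f I) \<and> I \<noteq> {} \<and>
      \<not> (\<exists>J\<in>?C. \<exists>K\<in>?C. J \<noteq> {} \<and> K \<noteq> {} \<and> J \<inter> K = {} \<and> J \<union> K = I)"
    using I by (simp only: atoms_def mem_Collect_eq simp_thms)
  ultimately show ?thesis by (simp only:)
qed

text \<open>Position sets with exotic sublists form a Boolean algebra whose atoms are the
  components. Hence sums over sets of components are sums over such position sets, that is, over
  closed sets of roots.\<close>

lemma deshuffle_label_forest:
  fixes \<pi>
  defines "F \<equiv> label_forest [] (rep_ef \<pi>)"
  shows "deshuffle_basis \<pi> = (\<Sum>I\<in>closed_roots F. basis (cls (sel I F), cls (sel (- I) F)) :: ef \<times> ef \<Rightarrow>\<^sub>0 'k::field)"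
proof -
  define f where "f = rep_ef \<pi>"
  let ?n = "length f"
  define rt where "rt = (\<lambda>i. decoration (F ! i))"
  have F: "valid F" unfolding F_def by (intro valid_label_forest rep_ef_props)
  have lenF: "length F = ?n" by (simp add: F_def f_def)
  have fF: "forget F = f" by (simp add: F_def f_def)
  have injr: "inj_on rt {..<?n}" by (auto simp: inj_on_def rt_def F_def f_def)
  have roots: "roots F = rt ` {..<?n}"
    unfolding roots_def rt_def lenF[symmetric] by (auto simp: set_conv_nth)
  have sel: "sel (rt ` I) F = nths F I" if "I \<subseteq> {..<?n}" for I
  proof -
    have "{i. i < length F \<and> decoration (F ! i) \<in> rt ` I} = I"
      using that injr by (auto simp: lenF rt_def inj_on_def)
    then show ?thesis by (simp add: sel_def filter_eq_nths)
  qed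
  have selc: "sel (- (rt ` I)) F = nths F ({..<?n} - I)" if "I \<subseteq> {..<?n}" for I
  proof -
    have "{i. i < length F \<and> decoration (F ! i) \<in> - (rt ` I)} = {..<?n} - I"
      using that injr by (auto simp: lenF rt_def inj_on_def)
    then show ?thesis by (simp add: sel_def filter_eq_nths)
  qed
  have cls: "cls (nths F I) = abs_ef (nths f I)" for I
    unfolding cls_def nths_map[symmetric] fF ..
  let ?C = "{J. J \<subseteq> {..<?n} \<and> exotic (nths f J)}"
  have closed: "rt ` I \<in> closed_roots F \<longleftrightarrow> exotic (nths f I)" if I: "I \<subseteq> {..<?n}" for I
  proof -
    have "distinct (labels (nths F I))"
      using valid_distinct[OF F] mset_labels_sel[of "rt ` I" F]
      by (metis distinct_append mset_append mset_eq_imp_distinct_iff sel[OF I])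
    then have "valid (nths F I) \<longleftrightarrow> exotic (nths f I)"
      unfolding valid_iff nths_map[symmetric] fF by simp
    moreover have "rt ` I \<subseteq> roots F" using I by (auto simp: roots)
    ultimately show ?thesis by (simp add: closed_valid[OF F] sel[OF I])
  qed
  have comp: "components f = atoms ?C"
    unfolding components_def using connected_nths_iff by (auto simp: atoms_def)
  have bijC: "bij_betw ((`) rt) ?C (closed_roots F)"
    unfolding bij_betw_def
  proof
    show "inj_on ((`) rt) ?C"
      using inj_on_image_Pow[OF injr] by (rule inj_on_subset) auto
    show "(`) rt ` ?C = closed_roots F"
    proof (intro subset_antisym subsetI)
      fix J assume J: "J \<in> closed_roots F"
      then have "J \<subseteq> rt ` {..<?n}" by (simp add: closed_roots_def roots)
      then obtain I where "I \<subseteq> {..<?n}" "J = rt ` I" by (auto simp: subset_image_iff)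
      then show "J \<in> (`) rt ` ?C" using J closed by blast
    qed (use closed in blast)
  qed
  have inC: "I \<in> ?C \<longleftrightarrow> I \<subseteq> {..<?n} \<and> rt ` I \<in> closed_roots F" for I
    using closed by blast
  \<comment> \<open>The Boolean operations are checked on root sets, where closure under lianas is
    symmetric in a set and its complement.\<close>
  have compl: "{..<?n} - I \<in> ?C" if "I \<in> ?C" for I
  proof -
    have "rt ` ({..<?n} - I) = roots F - rt ` I"
      unfolding roots using that injr by (intro inj_on_image_set_diff[of rt "{..<?n}"]) auto
    moreover have "roots F - J \<in> closed_roots F" if "J \<in> closed_roots F" for J
      using that unfolding closed_iff roots_def by blast
    ultimately show ?thesis using that unfolding inC by simp
  qed
  have inter: "I \<inter> J \<in> ?C" if "I \<in> ?C" "J \<in> ?C" for I J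
  proof -
    have "rt ` (I \<inter> J) = rt ` I \<inter> rt ` J"
      using that by (intro inj_on_image_Int[OF injr]) auto
    moreover have "A \<inter> B \<in> closed_roots F" if "A \<in> closed_roots F" "B \<in> closed_roots F" for A B
      using that unfolding closed_iff by blast
    ultimately show ?thesis using that unfolding inC by auto
  qed
  have empty: "{} \<in> ?C" by (simp add: exotic_Nil)
  note bijU = bij_Union_atoms[of "{..<?n}" ?C, OF _ _ compl inter empty]
  have bij: "bij_betw Union (Pow (components f)) ?C"
    unfolding comp by (rule bijU(1)) auto
  have cU: "\<Union>(components f - S) = {..<?n} - \<Union>S" if "S \<subseteq> components f" for S
    using that unfolding comp by (intro bijU(2)) auto
  have "deshuffle_basis \<pi> = (\<Sum>S\<in>Pow (components f).
      basis (abs_ef (nths f (\<Union>S)), abs_ef (nths f ({..<?n} - \<Union>S))) :: ef \<times> ef \<Rightarrow>\<^sub>0 'k)"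
    unfolding deshuffle_basis_def Let_def f_def[symmetric] using cU by (intro sum.cong) auto
  also have "\<dots> = (\<Sum>I\<in>?C. basis (abs_ef (nths f I), abs_ef (nths f ({..<?n} - I))))"
    by (rule sum.reindex_bij_betw[OF bij])
  also have "\<dots> = (\<Sum>I\<in>?C. basis (cls (sel (rt ` I) F), cls (sel (- (rt ` I)) F)))"
    by (intro sum.cong) (auto simp: sel selc cls)
  also have "\<dots> = (\<Sum>I\<in>closed_roots F. basis (cls (sel I F), cls (sel (- I) F)))"
    by (rule sum.reindex_bij_betw[OF bijC])
  finally show ?thesis .
qed

theorem deshuffle_basis_labelled:
  assumes F: "valid F"
  shows "deshuffle_basis (cls F) = (\<Sum>I\<in>closed_roots F. basis (cls (sel I F), cls (sel (- I) F)) :: ef \<times> ef \<Rightarrow>\<^sub>0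
      'k::field)"
proof -
  let ?P = "label_forest [] (rep_ef (cls F))"
  have P: "valid ?P" by (intro valid_label_forest rep_ef_props)
  have "cls F = cls ?P" by (simp add: cls_def[of ?P] rep_ef_props)
  then obtain h where h: "?P = relabel h F" "relabelling h (set (labels F))"
    using cls_eqD[OF F P] by blast
  have "distinct (map h (labels F))"
    using valid_distinct[OF P] unfolding h(1) by simp
  then have inj: "inj_on h (set (labels F))" by (simp add: distinct_map)
  note cl = closed_relabel[OF h(2) inj, folded h(1)]
  have "deshuffle_basis (cls F) = (\<Sum>I\<in>closed_roots ?P. basis (cls (sel I ?P), cls (sel (- I) ?P)) :: ef \<times> ef
      \<Rightarrow>\<^sub>0 'k)"
    by (rule deshuffle_label_forest)
  also have "\<dots> = (\<Sum>I\<in>closed_roots F. basis (cls (sel (h ` I) ?P), cls (sel (- (h ` I)) ?P)))"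
    by (rule sum.reindex_bij_betw[OF cl(1), symmetric])
  also have "\<dots> = (\<Sum>I\<in>closed_roots F. basis (cls (sel I F), cls (sel (- I) F)))"
  proof (rule sum.cong[OF refl])
    fix I assume I: "I \<in> closed_roots F"
    then have I': "I \<subseteq> roots F" "h ` I \<in> closed_roots ?P"
      using bij_betw_apply[OF cl(1) I] by (auto simp: closed_roots_def)
    have "cls (sel (h ` I) ?P) = cls (sel I F)"
      unfolding cl(2)[OF I'(1)]
      by (rule cls_relabel[OF apart_sel(1)[OF F I] apart_sel(1)[OF P I'(2), unfolded cl(2)[OF I'(1)]]
            relabelling_subset[OF h(2) labels_sel]])
    moreover have "cls (sel (- (h ` I)) ?P) = cls (sel (- I) F)"
      unfolding cl(3)[OF I'(1)]
      by (rule cls_relabel[OF apart_sel(2)[OF F I] apart_sel(2)[OF P I'(2), unfolded cl(3)[OF I'(1)]]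
            relabelling_subset[OF h(2) labels_sel]])
    ultimately show "basis (cls (sel (h ` I) ?P), cls (sel (- (h ` I)) ?P)) =
      (basis (cls (sel I F), cls (sel (- I) F)) :: ef \<times> ef \<Rightarrow>\<^sub>0 'k)" by simp
  qed
  finally show ?thesis .
qed

subsection \<open>The Grossman--Larson bialgebra\<close>

lemma lin_GL_prod [simp]: "lin GL_prod" and lin_deshuffle [simp]: "lin deshuffle"
  and lin_shuffle_prod [simp]: "lin shuffle_prod" and lin_MKW [simp]: "lin MKW"
  by (simp_all add: GL_prod_def deshuffle_def shuffle_prod_def MKW_def)

lemma GL_prod_basis [simp]: "GL_prod (basis (\<pi>, \<eta>)) = GL_basis \<pi> \<eta>"
  and deshuffle_basis [simp]: "deshuffle (basis \<pi>) = deshuffle_basis \<pi>"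
  and shuffle_prod_basis [simp]: "shuffle_prod (basis (\<pi>, \<eta>)) = shuffle_basis \<pi> \<eta>"
  and MKW_basis [simp]: "MKW (basis \<pi>) = MKW_basis \<pi>"
  by (simp_all add: GL_prod_def deshuffle_def shuffle_prod_def MKW_def)

lemma roots_glue: "roots (glue \<phi> F G) = {r \<in> roots F. \<phi> r = None} \<union> roots G"
  by (auto simp: glue_def fiber_def roots_def image_Un image_image)

lemma nums_glue:
  assumes "\<phi> \<in> maps F G" "distinct (labels G)"
  shows "nums (glue \<phi> F G) = nums F \<union> nums G"
  unfolding nums_def set_labels_glue[OF assms] by auto

lemma apart_glue:
  assumes "\<phi> \<in> maps F G" "distinct (labels G)"
  shows "apart (glue \<phi> F G) H \<longleftrightarrow> apart F H \<and> apart G H"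
    and "apart H (glue \<phi> F G) \<longleftrightarrow> apart H F \<and> apart H G"
  unfolding apart_def nums_glue[OF assms] set_labels_glue[OF assms] by blast+

text \<open>A tree of \<open>F\<close> attached to a node of \<open>G\<close> keeps that target; one
  that stays is then sent on by \<open>\<psi>\<close> like the roots of \<open>G\<close>. In both
  bracketings, at each node of \<open>H\<close> trees coming from \<open>F\<close> precede those
  from \<open>G\<close>.\<close>

lemma glue_glue:
  assumes dis: "set (labels G) \<inter> set (labels H) = {}"
    and \<phi>: "\<And>r. r \<in> roots F \<Longrightarrow> \<phi> r \<in> insert None (Some ` set (labels G))"
    and \<psi>: "\<And>r. r \<in> roots F \<Longrightarrow> \<phi> r = None \<Longrightarrow> \<psi> r \<in> insert None (Some ` set (labels H))"
    and \<phi>': "\<And>r. r \<in> roots F \<Longrightarrow> \<phi>' r = (case \<phi> r of None \<Rightarrow> \<psi> r | Some x \<Rightarrow> Some x)"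
    and \<psi>': "\<And>r. r \<in> roots G \<Longrightarrow> \<psi>' r = \<psi> r"
  shows "glue \<psi> (glue \<phi> F G) H = glue \<phi>' F (glue \<psi>' G H)"
proof -
  let ?a = "\<lambda>x. fiber \<phi> F (Some x)" and ?b = "\<lambda>x. fiber \<phi>' F (Some x)"
  have rt: "decoration t \<in> roots X" if "t \<in> set X" for t and X :: "'a ptree list"
    using that by (simp add: roots_def)
  have 1: "fiber \<psi> (glue \<phi> F G) v = fiber \<psi> (fiber \<phi> F None) v @ map (gr ?a) (fiber \<psi> G v)" for v
    by (simp add: glue_def fiber_def filter_map comp_def)
  \<comment> \<open>Targets in \<open>H\<close> cannot be nodes of \<open>G\<close>, so only trees
    that stayed in the first grafting reach them.\<close>
  have 2: "fiber \<phi>' F v = fiber \<psi> (fiber \<phi> F None) v" if v: "v \<in> insert None (Some ` set (labels H))" for v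
  proof -
    have "\<phi>' (decoration t) = v \<longleftrightarrow> \<phi> (decoration t) = None \<and> \<psi> (decoration t) = v" if "t \<in> set F" for t
      using \<phi>[OF rt[OF that]] \<phi>'[OF rt[OF that]] v dis by (auto split: option.splits)
    then show ?thesis by (auto simp: fiber_def intro!: filter_cong)
  qed
  have 3: "?b x = ?a x" if x: "x \<in> set (labels G)" for x
  proof -
    have "\<phi>' (decoration t) = Some x \<longleftrightarrow> \<phi> (decoration t) = Some x" if "t \<in> set F" for t
      using \<phi>'[OF rt[OF that]] \<psi>[OF rt[OF that]] x dis by (auto split: option.splits)
    then show ?thesis by (auto simp: fiber_def intro!: filter_cong)
  qed
  have 4: "fiber \<psi>' G v = fiber \<psi> G v" for v
    using \<psi>'[OF rt] by (auto simp: fiber_def intro!: filter_cong)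
  have 5: "map (gr ?b) (fiber \<psi> G v) = map (gr ?a) (fiber \<psi> G v)" for v
    using labels_fiber[of \<psi> G v] by (intro gr_cong 3) blast
  have "glue \<phi>' F (glue \<psi>' G H) = fiber \<phi>' F None @ map (gr ?a) (fiber \<psi> G None) @
      map (gr (\<lambda>x. ?b x @ map (gr ?a) (fiber \<psi> G (Some x)))) H"
    unfolding glue_def[of \<phi>'] glue_def[of \<psi>'] 4 map_append gr_gr 5 ..
  also have "map (gr (\<lambda>x. ?b x @ map (gr ?a) (fiber \<psi> G (Some x)))) H =
      map (gr (\<lambda>x. fiber \<psi> (fiber \<phi> F None) (Some x) @ map (gr ?a) (fiber \<psi> G (Some x)))) H"
    by (rule gr_cong) (simp add: 2)
  also have "fiber \<phi>' F None = fiber \<psi> (fiber \<phi> F None) None" by (rule 2) simp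
  finally show ?thesis unfolding glue_def[of \<psi> "glue \<phi> F G"] 1 by simp
qed

text \<open>The two index sets of pairs of maps are in bijection, and \<open>glue_glue\<close>
  identifies the grafted forests of corresponding pairs.\<close>

lemma GL_assoc_labelled:
  fixes F G H :: "'a lforest"
  assumes "valid F" "valid G" "valid H" "apart F G" "apart F H" "apart G H"
  shows "(\<Sum>\<phi>\<in>maps F G. \<Sum>\<psi>\<in>maps (glue \<phi> F G) H. g (glue \<psi> (glue \<phi> F G) H)) =
    (\<Sum>\<psi>\<in>maps G H. \<Sum>\<phi>\<in>maps F (glue \<psi> G H). (g (glue \<phi> F (glue \<psi> G H)) :: 'b::comm_monoid_add))"
proof -
  let ?bl = "\<lambda>G. {x \<in> set (labels G). snd x = None}"
  let ?A = "SIGMA \<phi>:maps F G. maps (glue \<phi> F G) H"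
  let ?B = "SIGMA \<psi>:maps G H. maps F (glue \<psi> G H)"
  define j where "j = (\<lambda>(\<phi>, \<psi>). (restrict \<psi> (roots G),
    restrict (\<lambda>r. case \<phi> r of None \<Rightarrow> \<psi> r | Some x \<Rightarrow> Some (x :: 'a \<times> nat option)) (roots F)))"
  \<comment> \<open>The inverse recovers the first map by testing whether a target lies in
    \<open>G\<close>; the other targets belong to the second map. The value \<open>undefined\<close>
    keeps the second map extensional on the roots of \<open>glue \<phi> F G\<close>.\<close>
  define i where "i = (\<lambda>(\<psi>, \<phi>). (restrict (\<lambda>r. case \<phi> r of None \<Rightarrow> None
      | Some x \<Rightarrow> if x \<in> set (labels G) then Some x else None) (roots F),
    \<lambda>r. if r \<in> roots G then \<psi> r
      else if r \<in> roots F \<and> (case \<phi> r of None \<Rightarrow> True | Some x \<Rightarrow> x \<notin> set (labels G)) then \<phi> r else undefined))"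
  have dG: "distinct (labels G)" and dH: "distinct (labels H)"
    using assms by (simp_all add: valid_distinct)
  have disl: "set (labels F) \<inter> set (labels G) = {}" "set (labels G) \<inter> set (labels H) = {}"
    using assms by (auto simp: apart_def)
  have disr: "roots F \<inter> roots G = {}" using disl(1) roots_labels[of F] roots_labels[of G] by blast
  have blg: "?bl (glue \<psi> G H) = ?bl G \<union> ?bl H" if "\<psi> \<in> maps G H" for \<psi>
    unfolding set_labels_glue[OF that dH] by blast
  have jA: "j p \<in> ?B \<and> i (j p) = p \<and> glue (snd (j p)) F (glue (fst (j p)) G H) = glue (snd p) (glue (fst p) F G) H"
    if "p \<in> ?A" for p
  proof -
    obtain \<phi> \<psi> where p0: "p = (\<phi>, \<psi>)" by (cases p)
    with that have p: "p = (\<phi>, \<psi>)" "\<phi> \<in> maps F G" "\<psi> \<in> maps (glue \<phi> F G) H"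
      by simp_all
    have ph: "\<phi> r \<in> insert None (Some ` ?bl G)" if "r \<in> roots F" for r
      using p(2) that by (auto simp: maps_def PiE_iff)
    have ps: "\<psi> r \<in> insert None (Some ` ?bl H)" if "r \<in> roots G \<or> r \<in> roots F \<and> \<phi> r = None" for r
      using p(3) that unfolding maps_def roots_glue by (auto simp: PiE_iff)
    have ex: "\<phi> \<in> extensional (roots F)" "\<psi> \<in> extensional ({r \<in> roots F. \<phi> r = None} \<union> roots G)"
      using p(2,3) unfolding maps_def roots_glue by (auto simp: PiE_iff)
    have 1: "restrict \<psi> (roots G) \<in> maps G H" using ps by (auto simp: maps_def)
    have 2: "restrict (\<lambda>r. case \<phi> r of None \<Rightarrow> \<psi> r | Some x \<Rightarrow> Some x) (roots F) \<in> maps F (glue (restrict \<psi>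
        (roots G)) G H)"
      unfolding maps_def blg[OF 1] using ph ps by (fastforce split: option.splits)
    have 3: "i (j p) = p"
    proof -
      have "fst (i (j p)) = \<phi>"
      proof
        fix r show "fst (i (j p)) r = \<phi> r"
        proof (cases "r \<in> roots F")
          case True
          then show ?thesis using ph[of r] ps[of r] disl(2) by (auto simp: i_def j_def p(1) split: option.splits)
        next
          case False
          then show ?thesis using extensional_arb[OF ex(1)] by (simp add: i_def j_def p(1))
        qed
      qed
      moreover have "snd (i (j p)) = \<psi>"
      proof
        fix r show "snd (i (j p)) r = \<psi> r"
        proof (cases "r \<in> roots F")
          case True
          then have "r \<notin> roots G" using disr by blast
          then show ?thesis using ph[of r] ps[of r] True disl(2) extensional_arb[OF ex(2), of r]
            by (auto simp: i_def j_def p(1) split: option.splits)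
        next
          case False
          then show ?thesis using extensional_arb[OF ex(2), of r] by (auto simp: i_def j_def p(1))
        qed
      qed
      ultimately show ?thesis by (simp add: p(1) prod_eq_iff)
    qed
    have "glue \<psi> (glue \<phi> F G) H =
      glue (restrict (\<lambda>r. case \<phi> r of None \<Rightarrow> \<psi> r | Some x \<Rightarrow> Some x) (roots F)) F (glue (restrict \<psi> (roots G)) G H)"
    proof (rule glue_glue[OF disl(2)])
      show "\<phi> r \<in> insert None (Some ` set (labels G))" if "r \<in> roots F" for r
        using ph[OF that] by blast
      show "\<psi> r \<in> insert None (Some ` set (labels H))" if "r \<in> roots F" "\<phi> r = None" for r
        using ps[of r] that by blast
    qed simp_all
    then show ?thesis using 1 2 3 by (simp add: p(1) j_def)
  qed
  have iB: "i q \<in> ?A \<and> j (i q) = q" if "q \<in> ?B" for q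
  proof -
    obtain \<phi> \<psi> where q0: "q = (\<psi>, \<phi>)" by (cases q)
    with that have q: "q = (\<psi>, \<phi>)" "\<psi> \<in> maps G H" "\<phi> \<in> maps F (glue \<psi> G H)"
      by simp_all
    have ps: "\<psi> r \<in> insert None (Some ` ?bl H)" if "r \<in> roots G" for r
      using q(2) that by (auto simp: maps_def PiE_iff)
    have ph: "\<phi> r \<in> insert None (Some ` (?bl G \<union> ?bl H))" if "r \<in> roots F" for r
      using q(3) that unfolding maps_def blg[OF q(2)] by (auto simp: PiE_iff)
    have ex: "\<psi> \<in> extensional (roots G)" "\<phi> \<in> extensional (roots F)"
      using q(2,3) unfolding maps_def by (auto simp: PiE_iff)
    have 1: "fst (i q) \<in> maps F G"
      unfolding i_def q(1) maps_def using ph by (fastforce split: option.splits)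
    have 2: "snd (i q) \<in> maps (glue (fst (i q)) F G) H"
      unfolding maps_def roots_glue PiE_iff extensional_def
    proof (intro conjI ballI CollectI allI impI)
      fix r assume "r \<in> {r \<in> roots F. fst (i q) r = None} \<union> roots G"
      then show "snd (i q) r \<in> insert None (Some ` ?bl H)"
        using ph[of r] ps[of r] by (auto simp: i_def q(1) split: option.splits if_splits)
    next
      fix r assume "r \<notin> {r \<in> roots F. fst (i q) r = None} \<union> roots G"
      then show "snd (i q) r = undefined"
        by (auto simp: i_def q(1) split: option.splits if_splits)
    qed
    have "fst (j (i q)) = \<psi>"
      using ex(1) by (auto simp: i_def j_def q(1) extensional_def)
    moreover have "snd (j (i q)) = \<phi>"
    proof
      fix r show "snd (j (i q)) r = \<phi> r"
      proof (cases "r \<in> roots F")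
        case True
        then have "r \<notin> roots G" using disr by blast
        then show ?thesis using True by (auto simp: i_def j_def q(1) split: option.splits)
      next
        case False
        then show ?thesis using extensional_arb[OF ex(2), of r] by (simp add: i_def j_def q(1))
      qed
    qed
    ultimately have "j (i q) = q" by (simp add: q(1) prod_eq_iff)
    moreover have "i q \<in> ?A" using 1 2 by (metis SigmaI prod.collapse)
    ultimately show ?thesis by blast
  qed
  have "(\<Sum>p\<in>?A. g (glue (snd p) (glue (fst p) F G) H)) = (\<Sum>q\<in>?B. g (glue (snd q) F (glue (fst q) G H)))"
    by (rule sum.reindex_bij_witness[where i = i and j = j]) (use iB jA in auto)
  then show ?thesis by (simp add: sum.Sigma case_prod_unfold)
qed

lemma trilin_eqI:
  assumes "\<And>y z. lin (\<lambda>x. f x y z)" "\<And>x z. lin (\<lambda>y. f x y z)" "\<And>x y. lin (\<lambda>z. f x y z)"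
    and "\<And>y z. lin (\<lambda>x. g x y z)" "\<And>x z. lin (\<lambda>y. g x y z)" "\<And>x y. lin (\<lambda>z. g x y z)"
    and "\<And>a b c. f (basis a) (basis b) (basis c) = g (basis a) (basis b) (basis c)"
  shows "f x y z = g x y z"
proof (rule lin_eqI[where f = "\<lambda>z. f x y z" and g = "\<lambda>z. g x y z"])
  fix c show "f x y (basis c) = g x y (basis c)"
    by (rule bilin_eqI[where f = "\<lambda>x y. f x y (basis c)" and g = "\<lambda>x y. g x y (basis c)"]) (rule assms)+
qed (rule assms)+

lemma GL_assoc: "GL_prod (GL_prod (x \<otimes> y) \<otimes> z) = GL_prod (x \<otimes> GL_prod (y \<otimes> z))"
proof (rule trilin_eqI[where f = "\<lambda>x y z. GL_prod (GL_prod (x \<otimes> y) \<otimes> z)"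
      and g = "\<lambda>x y z. GL_prod (x \<otimes> GL_prod (y \<otimes> z))"])
  fix a b c :: ef
  obtain F G H :: "nat list lforest"
    where FGH: "valid F" "valid G" "valid H" "cls F = a" "cls G = b" "cls H = c"
      "apart F G" "apart F H" "apart G H" by (rule representatives3)
  note d = valid_distinct[OF FGH(2)] valid_distinct[OF FGH(3)]
  have "GL_prod (GL_prod (basis a \<otimes> basis b) \<otimes> basis c) =
      (\<Sum>\<phi>\<in>maps F G. GL_basis (cls (glue \<phi> F G)) (cls H) :: ef \<Rightarrow>\<^sub>0 'a)"
    using FGH by (auto simp: GL_basis_labelled lin_sum[OF lin_tensor(1)] lin_sum[OF lin_GL_prod])
  also have "\<dots> = (\<Sum>\<phi>\<in>maps F G. \<Sum>\<psi>\<in>maps (glue \<phi> F G) H. basis (cls (glue \<psi> (glue \<phi> F G) H)))"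
    using FGH by (intro sum.cong refl GL_basis_labelled) (auto simp: valid_glue apart_glue d)
  also have "\<dots> = (\<Sum>\<psi>\<in>maps G H. \<Sum>\<phi>\<in>maps F (glue \<psi> G H). basis (cls (glue \<phi> F (glue \<psi> G H))))"
    using FGH by (intro GL_assoc_labelled)
  also have "\<dots> = (\<Sum>\<psi>\<in>maps G H. GL_basis (cls F) (cls (glue \<psi> G H)))"
    using FGH by (intro sum.cong refl GL_basis_labelled[symmetric]) (auto simp: valid_glue apart_glue d)
  also have "\<dots> = GL_prod (basis a \<otimes> GL_prod (basis b \<otimes> basis c))"
    using FGH by (auto simp: GL_basis_labelled lin_sum[OF lin_tensor(2)] lin_sum[OF lin_GL_prod])
  finally show "GL_prod (GL_prod (basis a \<otimes> basis b) \<otimes> basis c) =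
    (GL_prod (basis a \<otimes> GL_prod (basis b \<otimes> basis c)) :: ef \<Rightarrow>\<^sub>0 'a)" .
qed (intro lin_comp[OF lin_GL_prod] lin_comp[OF lin_tensor(1)] lin_comp[OF lin_tensor(2)] lin_tensor)+

lemma valid_Nil: "valid []"
  by (simp add: valid_def nums_def)

lemma cls_Nil: "cls [] = empty_forest"
  by (simp add: cls_def empty_forest_def)

lemma apart_Nil: "apart [] F" "apart F []"
  by (simp_all add: apart_def nums_def)

lemma cls_empty_iff: "valid F \<Longrightarrow> cls F = empty_forest \<longleftrightarrow> F = []"
proof
  assume "valid F" "cls F = empty_forest"
  then have "valid F" "cls ([] :: nat lforest) = cls F" by (simp_all add: cls_Nil)
  from cls_eqD[OF valid_Nil this] show "F = []" by auto
qed (simp add: cls_Nil)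

lemma GL_unit_left: "GL_prod (EF_unit \<otimes> x) = x"
proof (rule lin_eqI[where f = "\<lambda>x. GL_prod (EF_unit \<otimes> x)"])
  fix a
  obtain F :: "nat list lforest" where F: "valid F" "cls F = a"
    by (rule representative)
  have m: "maps ([] :: nat list lforest) F = {\<lambda>_. undefined}" by (simp add: maps_def)
  have "glue \<phi> [] F = F" for \<phi> by (simp add: glue_def fiber_def gr_empty)
  then show "GL_prod (EF_unit \<otimes> basis a) = basis a"
    using GL_basis_labelled[OF valid_Nil F(1) apart_Nil(1)] by (simp add: EF_unit_def cls_Nil m F(2))
qed (intro lin_comp[OF lin_GL_prod] lin_tensor lin_id)+

lemma GL_unit_right: "GL_prod (x \<otimes> EF_unit) = x"
proof (rule lin_eqI[where f = "\<lambda>x. GL_prod (x \<otimes> EF_unit)"])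
  fix a
  obtain F :: "nat list lforest" where F: "valid F" "cls F = a"
    by (rule representative)
  have "maps F ([] :: nat list lforest) = (roots F \<rightarrow>\<^sub>E {None})"
    by (simp add: maps_def)
  also have "\<dots> = {restrict (\<lambda>_. None) (roots F)}" by (simp add: PiE_over_singleton_iff restrict_def)
  finally have m: "maps F ([] :: nat list lforest) = {restrict (\<lambda>_. None) (roots F)}" .
  have "glue (restrict (\<lambda>_. None) (roots F)) F [] = F"
    by (auto simp: glue_def fiber_def filter_id_conv roots_def)
  then show "GL_prod (basis a \<otimes> EF_unit) = basis a"
    using GL_basis_labelled[OF F(1) valid_Nil apart_Nil(2)] by (simp add: EF_unit_def cls_Nil m F(2))
qed (intro lin_comp[OF lin_GL_prod] lin_tensor lin_id)+

section \<open>The deshuffle coalgebra, units and counits\<close>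

lemma sel_sel: "sel J (sel I F) = sel (I \<inter> J) F"
  unfolding sel_def by (auto intro: filter_cong)

lemma sel_cong: "(\<And>r. r \<in> roots F \<Longrightarrow> r \<in> I \<longleftrightarrow> r \<in> J) \<Longrightarrow> sel I F = sel J F"
  unfolding sel_def roots_def by (auto intro!: filter_cong)

text \<open>A liana leaving \<open>J\<close> would either stay among the trees over
  \<open>I\<close>, which closedness of \<open>J\<close> there forbids, or leave \<open>I\<close>,
  which closedness of \<open>I\<close> forbids.\<close>

lemma closed_sel:
  assumes I: "I \<in> closed_roots F" and J: "J \<in> closed_roots (sel I F)"
  shows "J \<in> closed_roots F"
  unfolding closed_iff
proof (intro conjI ballI impI)
  have JI: "J \<subseteq> roots F \<inter> I" using J unfolding closed_roots_def by simp
  then show "J \<subseteq> roots F" by blast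
  fix s t assume st: "s \<in> set F" "t \<in> set F" "decoration s \<in> J \<and> decoration t \<notin> J"
  show "nums [s] \<inter> nums [t] = {}"
  proof (cases "decoration t \<in> I")
    case True
    then have "s \<in> set (sel I F)" "t \<in> set (sel I F)" using st JI by (auto simp: set_sel)
    then show ?thesis using J st(3) unfolding closed_iff by blast
  next
    case False
    then show ?thesis using I st JI unfolding closed_iff by blast
  qed
qed

lemma deshuffle_coassoc: "reassoc (tensor_map deshuffle id (deshuffle x)) = tensor_map id deshuffle (deshuffle x)"
proof (rule lin_eqI[where f = "\<lambda>x. reassoc (tensor_map deshuffle id (deshuffle x))"])
  fix a
  obtain F :: "nat list lforest" where F: "valid F" "cls F = a"
    by (rule representative)
  let ?A = "SIGMA I:closed_roots F. closed_roots (sel I F)"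
  let ?B = "SIGMA I:closed_roots F. closed_roots (sel (- I) F)"
  have d: "deshuffle (basis a) = (\<Sum>I\<in>closed_roots F. basis (cls (sel I F), cls (sel (- I) F)) :: ef \<times> ef \<Rightarrow>\<^sub>0 'a)"
    using deshuffle_basis_labelled[OF F(1)] by (simp add: F(2))
  let ?f = "\<lambda>p. basis (cls (sel (snd p) (sel (fst p) F)), (cls (sel (- snd p) (sel (fst p) F)), cls (sel (-
      fst p) F)))
    :: _ \<Rightarrow>\<^sub>0 'a"
  let ?g = "\<lambda>p. basis (cls (sel (fst p) F), (cls (sel (snd p) (sel (- fst p) F)), cls (sel (- snd p) (sel (-
      fst p) F))))
    :: _ \<Rightarrow>\<^sub>0 'a"
  have "reassoc (tensor_map deshuffle id (deshuffle (basis a))) =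
      (\<Sum>I\<in>closed_roots F. \<Sum>J\<in>closed_roots (sel I F). ?f (I, J))"
    unfolding d
    by (simp add: lin_sum[OF lin_tensor_map] lin_sum[OF lin_reassoc] lin_sum[OF lin_tensor(1)]
        deshuffle_basis_labelled apart_sel[OF F(1)] cong: sum.cong)
  also have "\<dots> = (\<Sum>p\<in>?A. ?f p)" by (simp add: sum.Sigma case_prod_unfold)
  also have "\<dots> = (\<Sum>p\<in>?B. ?g p)"
  \<comment> \<open>Both sides run over the ordered partitions of the roots into three closed sets:
    \<open>J\<close>, \<open>I - J\<close> and the complement of \<open>I\<close>.\<close>
  proof (rule sum.reindex_bij_witness[where j = "\<lambda>p. (snd p, fst p - snd p)" and i = "\<lambda>p. (fst p \<union> snd p, fst p)"])
    fix p assume pA: "p \<in> ?A"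
    obtain I J where p: "p = (I, J)" by (cases p)
    have IJ: "I \<in> closed_roots F" "J \<in> closed_roots (sel I F)" using pA by (simp_all add: p)
    then have JI: "J \<subseteq> I" by (simp add: closed_roots_def)
    show "(fst (snd p, fst p - snd p) \<union> snd (snd p, fst p - snd p), fst (snd p, fst p - snd p)) = p"
      using JI by (simp add: p Un_absorb1)
    have "J \<in> closed_roots F" by (rule closed_sel[OF IJ])
    moreover have "I - J \<in> closed_roots (sel (- J) F)"
      using IJ(1) unfolding closed_iff set_sel by (simp; blast)
    ultimately show "(snd p, fst p - snd p) \<in> ?B" by (simp add: p)
    have s: "I \<inter> J = J" "I \<inter> - J = - J \<inter> (I - J)" "- I = - J \<inter> - (I - J)"
      using JI by auto
    have e: "sel J (sel I F) = sel J F" "sel (- J) (sel I F) = sel (I - J) (sel (- J) F)"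
      by (simp_all only: sel_sel s(1,2))
    have e': "sel (- I) F = sel (- (I - J)) (sel (- J) F)"
      unfolding sel_sel by (rule arg_cong[OF s(3)])
    show "?g (snd p, fst p - snd p) = ?f p"
      by (simp add: p e e')
  next
    fix q assume qB: "q \<in> ?B"
    obtain I J where q: "q = (I, J)" by (cases q)
    have IJ: "I \<in> closed_roots F" "J \<in> closed_roots (sel (- I) F)" using qB by (simp_all add: q)
    then have JI: "J \<inter> I = {}" unfolding closed_roots_def by auto
    then have "I \<union> J - I = J" by blast
    then show "(snd (fst q \<union> snd q, fst q), fst (fst q \<union> snd q, fst q) - snd (fst q \<union> snd q, fst q)) = q"
      by (simp add: q)
    have "I \<union> J \<in> closed_roots F"
      using IJ unfolding closed_iff set_sel by (simp; blast)
    moreover have "I \<in> closed_roots (sel (I \<union> J) F)"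
      using IJ(1) unfolding closed_iff set_sel by (simp; blast)
    ultimately show "(fst q \<union> snd q, fst q) \<in> ?A" by (simp add: q)
  qed
  also have "\<dots> = (\<Sum>I\<in>closed_roots F. \<Sum>J\<in>closed_roots (sel (- I) F). ?g (I, J))"
    by (simp add: sum.Sigma case_prod_unfold)
  also have "\<dots> = tensor_map id deshuffle (deshuffle (basis a))"
    unfolding d
    by (simp add: lin_sum[OF lin_tensor_map] lin_sum[OF lin_tensor(2)]
        deshuffle_basis_labelled apart_sel[OF F(1)] cong: sum.cong)
  finally show "reassoc (tensor_map deshuffle id (deshuffle (basis a))) =
    tensor_map id deshuffle (deshuffle (basis a) :: _ \<Rightarrow>\<^sub>0 'a)" .
qed (intro lin_comp[OF lin_reassoc] lin_comp[OF lin_tensor_map] lin_deshuffle)+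

lemma EF_counit_basis: "EF_counit (basis a) = (if a = empty_forest then 1 else 0)"
  by (simp add: EF_counit_def lookup_basis)

lemma sel_empty: "sel {} F = []" "sel (- {}) F = F"
  by (simp_all add: sel_def)

lemma closed_empty: "{} \<in> closed_roots F" "roots F \<in> closed_roots F"
  by (auto simp: closed_iff roots_def)

lemma sel_roots: "sel (roots F) F = F" "sel (- roots F) F = []"
  by (auto simp: sel_def roots_def filter_id_conv filter_empty_conv)

lemma cls_sel_empty:
  assumes "valid F" "I \<in> closed_roots F"
  shows "cls (sel I F) = empty_forest \<longleftrightarrow> I = {}"
    and "cls (sel (- I) F) = empty_forest \<longleftrightarrow> I = roots F"
proof -
  have I: "I \<subseteq> roots F" using assms(2) by (simp add: closed_roots_def)
  show "cls (sel I F) = empty_forest \<longleftrightarrow> I = {}"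
    unfolding cls_empty_iff[OF apart_sel(1)[OF assms]] using I by (auto simp: sel_def filter_empty_conv roots_def)
  show "cls (sel (- I) F) = empty_forest \<longleftrightarrow> I = roots F"
    unfolding cls_empty_iff[OF apart_sel(2)[OF assms]] using I by (auto simp: sel_def filter_empty_conv roots_def)
qed

lemma deshuffle_counit:
  "lin_ext (\<lambda>(a, b). scale (EF_counit (basis a)) (basis b)) (deshuffle x) = x"
  "lin_ext (\<lambda>(a, b). scale (EF_counit (basis b)) (basis a)) (deshuffle x) = x"
proof -
  have "lin_ext (\<lambda>(a, b). scale (EF_counit (basis a)) (basis b)) (deshuffle (basis c)) = (basis c :: ef \<Rightarrow>\<^sub>0 'a) \<and>
    lin_ext (\<lambda>(a, b). scale (EF_counit (basis b)) (basis a)) (deshuffle (basis c)) = (basis c :: ef \<Rightarrow>\<^sub>0 'a)" for c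
  proof -
    obtain F :: "nat list lforest" where F: "valid F" "cls F = c"
      by (rule representative)
    have d: "deshuffle (basis c) = (\<Sum>I\<in>closed_roots F. basis (cls (sel I F), cls (sel (- I) F)) :: ef \<times> ef \<Rightarrow>\<^sub>0 'a)"
      using deshuffle_basis_labelled[OF F(1)] by (simp add: F(2))
    have "lin_ext (\<lambda>(a, b). scale (EF_counit (basis a)) (basis b)) (deshuffle (basis c)) =
        (\<Sum>I\<in>closed_roots F. if I = {} then basis (cls F) else 0 :: ef \<Rightarrow>\<^sub>0 'a)"
      unfolding d lin_sum[OF lin_lin_ext]
      by (intro sum.cong refl) (auto simp: EF_counit_basis cls_sel_empty[OF F(1)] sel_empty[unfolded
          Compl_empty_eq])
    moreover have "lin_ext (\<lambda>(a, b). scale (EF_counit (basis b)) (basis a)) (deshuffle (basis c)) =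
        (\<Sum>I\<in>closed_roots F. if I = roots F then basis (cls F) else 0 :: ef \<Rightarrow>\<^sub>0 'a)"
      unfolding d lin_sum[OF lin_lin_ext]
      by (intro sum.cong refl) (auto simp: EF_counit_basis cls_sel_empty[OF F(1)] sel_roots)
    ultimately show ?thesis by (simp add: closed_empty F(2))
  qed
  note * = this
  show "lin_ext (\<lambda>(a, b). scale (EF_counit (basis a)) (basis b)) (deshuffle x) = x"
    by (rule lin_eqI[where f = "\<lambda>x. lin_ext (\<lambda>(a, b). scale (EF_counit (basis a)) (basis b)) (deshuffle x)"])
      (intro lin_comp[OF lin_lin_ext] lin_deshuffle lin_id conjunct1[OF *])+
  show "lin_ext (\<lambda>(a, b). scale (EF_counit (basis b)) (basis a)) (deshuffle x) = x"
    by (rule lin_eqI[where f = "\<lambda>x. lin_ext (\<lambda>(a, b). scale (EF_counit (basis b)) (basis a)) (deshuffle x)"])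
      (intro lin_comp[OF lin_lin_ext] lin_deshuffle lin_id conjunct2[OF *])+
qed

lemma deshuffle_unit: "deshuffle EF_unit = EF_unit \<otimes> EF_unit"
proof -
  have "closed_roots ([] :: nat lforest) = {{}}"
    by (auto simp: closed_iff)
  then show ?thesis
    using deshuffle_basis_labelled[OF valid_Nil[where 'a = nat]]
    by (simp add: EF_unit_def cls_Nil sel_def)
qed

lemma glue_empty_iff: "\<phi> \<in> maps F G \<Longrightarrow> distinct (labels G) \<Longrightarrow> glue \<phi> F G = [] \<longleftrightarrow> F = [] \<and> G = []"
proof -
  have e: "labels X = [] \<longleftrightarrow> X = []" for X :: "'a lforest"
  proof (cases X)
    case (Cons t X')
    then show ?thesis by (cases t) simp
  qed simp
  assume "\<phi> \<in> maps F G" "distinct (labels G)"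
  from maps_mset[OF this] show ?thesis
    by (metis e mset_zero_iff union_eq_empty)
qed

lemma EF_counit_add: "EF_counit (x + y) = EF_counit x + EF_counit y"
  and EF_counit_scale: "EF_counit (scale c x) = c * EF_counit x"
  by (simp_all add: EF_counit_def lookup_add)

lemma GL_counit:
  fixes x y :: "ef \<Rightarrow>\<^sub>0 'k::field"
  shows "EF_counit (GL_prod (x \<otimes> y)) = EF_counit x * EF_counit y"
proof -
  have b: "EF_counit (GL_basis a b) = (if a = empty_forest \<and> b = empty_forest then 1 else 0 :: 'k)" for a b
  proof -
    obtain F G H :: "nat list lforest" where FG: "valid F" "valid G" "cls F = a" "cls G = b" "apart F G"
      by (rule representatives3[of a b a])
    have "EF_counit (GL_basis a b) = (\<Sum>\<phi>\<in>maps F G. if F = [] \<and> G = [] then 1 else 0 :: 'k)"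
      unfolding FG(3,4)[symmetric] GL_basis_labelled[OF FG(1,2,5)] EF_counit_def lookup_sum lookup_basis
      by (intro sum.cong refl) (simp add: cls_empty_iff[OF valid_glue[OF FG(1,2,5)]] glue_empty_iff[OF _
          valid_distinct[OF FG(2)]])
    also have "\<dots> = (if F = [] \<and> G = [] then 1 else 0)" by (auto simp: maps_def)
    finally show ?thesis using cls_empty_iff[OF FG(1)] cls_empty_iff[OF FG(2)] by (simp add: FG(3,4))
  qed
  \<comment> \<open>\<open>bilin_eqI\<close> compares maps into free vector spaces, so the scalars
    are viewed as the space with the single basis vector \<open>basis ()\<close>.\<close>
  have "scale (EF_counit (GL_prod (x \<otimes> y))) (basis ()) = scale (EF_counit x * EF_counit y) (basis () :: unit
      \<Rightarrow>\<^sub>0 'k)"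
  proof (rule bilin_eqI[where f = "\<lambda>x y. scale (EF_counit (GL_prod (x \<otimes> y))) (basis ())"
        and g = "\<lambda>x y. scale (EF_counit x * EF_counit y) (basis ())"])
    fix c d :: ef
    show "scale (EF_counit (GL_prod (basis c \<otimes> basis d))) (basis ()) =
        scale (EF_counit (basis c) * EF_counit (basis d)) (basis () :: unit \<Rightarrow>\<^sub>0 'k)"
      by (simp add: b EF_counit_basis)
  qed (rule linI; simp add: tensor_simps lin_add[OF lin_GL_prod] lin_scale[OF lin_GL_prod]
      EF_counit_add EF_counit_scale scale_add algebra_simps)+
  then have "coeff (scale (EF_counit (GL_prod (x \<otimes> y))) (basis ())) () =
      coeff (scale (EF_counit x * EF_counit y) (basis () :: unit \<Rightarrow>\<^sub>0 'k)) ()"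
    by simp
  then show ?thesis by (simp add: lookup_basis)
qed

section \<open>Compatibility of the Grossman--Larson product with deshuffling\<close>

definition owner :: "'d ptree list \<Rightarrow> 'd \<Rightarrow> 'd" where
  "owner F x = decoration (SOME t. t \<in> set F \<and> x \<in> set (labels_tree t))"

lemma owner_eq:
  assumes "distinct (labels F)" "t \<in> set F" "x \<in> set (labels_tree t)"
  shows "owner F x = decoration t"
proof -
  have "(SOME t. t \<in> set F \<and> x \<in> set (labels_tree t)) = t"
  proof (rule some_equality)
    show "u = t" if "u \<in> set F \<and> x \<in> set (labels_tree u)" for u
      by (rule roots_disjoint[OF assms(1) conjunct1[OF that] assms(2) conjunct2[OF that] assms(3)])
  qed (use assms in simp)
  then show ?thesis by (simp add: owner_def)
qed

lemma owner_roots: "distinct (labels F) \<Longrightarrow> x \<in> set (labels F) \<Longrightarrow> owner F x \<in> roots F"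
  using set_labels[of F] owner_eq[of F _ x] by (auto simp: roots_def)

lemma labels_sel_iff:
  assumes "distinct (labels F)"
  shows "x \<in> set (labels (sel I F)) \<longleftrightarrow> x \<in> set (labels F) \<and> owner F x \<in> I"
  using set_labels[of F] set_labels[of "sel I F"] owner_eq[OF assms] by (auto simp: set_sel)

text \<open>An attached tree of \<open>F\<close> is selected exactly when the tree of
  \<open>G\<close> carrying it is, so the fibres over selected trees survive completely.\<close>

lemma sel_glue:
  assumes G: "distinct (labels G)"
    and stay: "\<And>r. r \<in> roots F \<Longrightarrow> \<phi> r = None \<Longrightarrow> r \<in> K \<longleftrightarrow> r \<in> I"
    and move: "\<And>r x. r \<in> roots F \<Longrightarrow> \<phi> r = Some x \<Longrightarrow> x \<in> set (labels G) \<and> (r \<in> I \<longleftrightarrow> owner G x \<in> J)"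
    and K: "\<And>r. r \<in> roots G \<Longrightarrow> r \<in> K \<longleftrightarrow> r \<in> J"
    and \<psi>: "\<And>r. r \<in> roots F \<Longrightarrow> r \<in> I \<Longrightarrow> \<psi> r = \<phi> r"
  shows "sel K (glue \<phi> F G) = glue \<psi> (sel I F) (sel J G)"
proof -
  have rt: "decoration t \<in> roots X" if "t \<in> set X" for t and X :: "'a ptree list"
    using that by (simp add: roots_def)
  have 1: "sel K (fiber \<phi> F None) = fiber \<psi> (sel I F) None"
    unfolding sel_def fiber_def filter_filter
    using stay[OF rt] \<psi>[OF rt] by (intro filter_cong refl) auto
  have "sel K (map (gr (\<lambda>x. fiber \<phi> F (Some x))) G) = map (gr (\<lambda>x. fiber \<phi> F (Some x))) (sel K G)"
    by (simp add: sel_def filter_map comp_def)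
  also have "sel K G = sel J G" by (rule sel_cong) (rule K)
  also have "map (gr (\<lambda>x. fiber \<phi> F (Some x))) (sel J G) = map (gr (\<lambda>x. fiber \<psi> (sel I F) (Some x))) (sel J G)"
  proof (rule gr_cong)
    fix x assume "x \<in> set (labels (sel J G))"
    then have x: "owner G x \<in> J" using labels_sel_iff[OF G] by blast
    show "fiber \<phi> F (Some x) = fiber \<psi> (sel I F) (Some x)"
      unfolding sel_def fiber_def filter_filter
    proof (rule filter_cong[OF refl])
      fix t assume t: "t \<in> set F"
      show "\<phi> (decoration t) = Some x \<longleftrightarrow> decoration t \<in> I \<and> \<psi> (decoration t) = Some x"
        using move[OF rt[OF t], of x] \<psi>[OF rt[OF t]] x by auto
    qed
  qed
  finally show ?thesis
    using 1 by (simp add: glue_def sel_def)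
qed

text \<open>The condition that no grafting edge joins a selected tree to an unselected one.\<close>

definition compatible :: "'a lforest \<Rightarrow> 'a lforest \<Rightarrow>
    ('a \<times> nat option \<Rightarrow> ('a \<times> nat option) option) \<Rightarrow> ('a \<times> nat option) set \<Rightarrow> ('a \<times> nat option) set \<Rightarrow> bool" where
  "compatible F G \<phi> I J \<longleftrightarrow> (\<forall>r\<in>roots F. \<forall>x. \<phi> r = Some x \<longrightarrow> (r \<in> I \<longleftrightarrow> owner G x \<in> J))"

lemma restrict_maps:
  assumes G: "distinct (labels G)" and \<phi>: "\<phi> \<in> maps F G" and c: "compatible F G \<phi> I J"
  shows "restrict \<phi> (roots F \<inter> I) \<in> maps (sel I F) (sel J G)"
    and "restrict \<phi> (roots F \<inter> - I) \<in> maps (sel (- I) F) (sel (- J) G)"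
proof -
  have r: "\<phi> r = None \<or> (\<exists>x. \<phi> r = Some x \<and> x \<in> set (labels G) \<and> snd x = None \<and> (r \<in> I \<longleftrightarrow> owner G x \<in> J))"
    if r: "r \<in> roots F" for r
  proof -
    have "\<phi> r \<in> insert None (Some ` {x \<in> set (labels G). snd x = None})" using \<phi> r by (simp add: maps_def PiE_iff)
    moreover have "\<forall>x. \<phi> r = Some x \<longrightarrow> (r \<in> I \<longleftrightarrow> owner G x \<in> J)" using c r by (simp add: compatible_def)
    ultimately show ?thesis by blast
  qed
  show "restrict \<phi> (roots F \<inter> I) \<in> maps (sel I F) (sel J G)"
    unfolding maps_def roots_sel using r by (auto simp: labels_sel_iff[OF G] simp del: split_paired_All
        split_paired_Ex)
  show "restrict \<phi> (roots F \<inter> - I) \<in> maps (sel (- I) F) (sel (- J) G)"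
    unfolding maps_def roots_sel using r by (auto simp: labels_sel_iff[OF G] simp del: split_paired_All
        split_paired_Ex)
qed

text \<open>A compatible map is the same as a pair of maps, one between the selected forests and one
  between their complements.\<close>

lemma sum_compatible:
  assumes G: "distinct (labels G)"
  shows "(\<Sum>\<phi>\<in>{\<phi> \<in> maps F G. compatible F G \<phi> I J}.
      g (restrict \<phi> (roots F \<inter> I)) (restrict \<phi> (roots F \<inter> - I))) =
    (\<Sum>\<phi>\<in>maps (sel I F) (sel J G). \<Sum>\<psi>\<in>maps (sel (- I) F) (sel (- J) G). (g \<phi> \<psi> :: 'b::comm_monoid_add))"
proof -
  let ?B = "maps (sel I F) (sel J G) \<times> maps (sel (- I) F) (sel (- J) G)"
  let ?j = "\<lambda>\<phi>. (restrict \<phi> (roots F \<inter> I), restrict \<phi> (roots F \<inter> - I))"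
  let ?i = "\<lambda>p r. if r \<in> I then fst p r else snd p r"
  have "(\<Sum>\<phi>\<in>{\<phi> \<in> maps F G. compatible F G \<phi> I J}. g (fst (?j \<phi>)) (snd (?j \<phi>))) =
      (\<Sum>p\<in>?B. g (fst p) (snd p))"
  proof (rule sum.reindex_bij_witness[where i = ?i and j = ?j])
    fix \<phi> assume "\<phi> \<in> {\<phi> \<in> maps F G. compatible F G \<phi> I J}"
    then have \<phi>: "\<phi> \<in> maps F G" "compatible F G \<phi> I J" by simp_all
    show "?j \<phi> \<in> ?B" using restrict_maps[OF G \<phi>] by simp
    have "\<phi> \<in> extensional (roots F)" using \<phi>(1) by (simp add: maps_def PiE_iff)
    from extensional_arb[OF this] show "?i (?j \<phi>) = \<phi>" by (intro ext) simp
  next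
    fix p assume "p \<in> ?B"
    then have p: "fst p \<in> maps (sel I F) (sel J G)" "snd p \<in> maps (sel (- I) F) (sel (- J) G)"
      by (auto simp del: split_paired_All split_paired_Ex)
    have m1: "fst p r \<in> insert None (Some ` {x. (x \<in> set (labels G) \<and> owner G x \<in> J) \<and> snd x = None})"
      if "r \<in> roots F" "r \<in> I" for r
      using p(1) that by (simp add: maps_def PiE_iff labels_sel_iff[OF G])
    have m2: "snd p r \<in> insert None (Some ` {x. (x \<in> set (labels G) \<and> owner G x \<in> - J) \<and> snd x = None})"
      if "r \<in> roots F" "r \<notin> I" for r
      using p(2) that by (simp add: maps_def PiE_iff labels_sel_iff[OF G])
    have e1: "fst p r = undefined" if "r \<notin> roots F \<inter> I" for r
      using p(1) extensional_arb[of "fst p" "roots F \<inter> I" r] that by (simp add: maps_def PiE_iff)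
    have e2: "snd p r = undefined" if "r \<notin> roots F \<inter> - I" for r
      using p(2) extensional_arb[of "snd p" "roots F \<inter> - I" r] that by (simp add: maps_def PiE_iff)
    have "restrict (?i p) (roots F \<inter> I) = fst p" using e1 by (intro ext) simp
    moreover have "restrict (?i p) (roots F \<inter> - I) = snd p" using e2 by (intro ext) simp
    ultimately show "?j (?i p) = p" by (metis prod.collapse)
    have "?i p r \<in> insert None (Some ` {x \<in> set (labels G). snd x = None})" if "r \<in> roots F" for r
      using m1[OF that] m2[OF that] by (cases "r \<in> I") auto
    moreover have "?i p r = undefined" if "r \<notin> roots F" for r using e1[of r] e2[of r] that by simp
    ultimately have "?i p \<in> maps F G" unfolding maps_def PiE_iff extensional_def by simp
    moreover have "compatible F G (?i p) I J"
      unfolding compatible_def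
    proof (intro ballI allI impI)
      fix r x assume r: "r \<in> roots F" and x: "?i p r = Some x"
      show "r \<in> I \<longleftrightarrow> owner G x \<in> J"
        using m1[OF r] m2[OF r] x by (cases "r \<in> I") auto
    qed
    ultimately show "?i p \<in> {\<phi> \<in> maps F G. compatible F G \<phi> I J}" by simp
  qed simp
  then show ?thesis by (simp add: sum.cartesian_product case_prod_unfold)
qed

lemma sum_closed_glue:
  assumes F: "valid F" and G: "valid G" and ap: "apart F G" and \<phi>: "\<phi> \<in> maps F G"
  shows "(\<Sum>K\<in>closed_roots (glue \<phi> F G). g (sel K (glue \<phi> F G)) (sel (- K) (glue \<phi> F G))) =
    (\<Sum>p\<in>{p \<in> closed_roots F \<times> closed_roots G. compatible F G \<phi> (fst p) (snd p)}.
      (g (glue (restrict \<phi> (roots F \<inter> fst p)) (sel (fst p) F) (sel (snd p) G))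
         (glue (restrict \<phi> (roots F \<inter> - fst p)) (sel (- fst p) F) (sel (- snd p) G)) :: 'b::comm_monoid_add))"
proof -
  note dG = valid_distinct[OF G]
  let ?Z = "glue \<phi> F G"
  \<comment> \<open>A closed set \<open>K\<close> of the grafted forest sees only the roots of
    \<open>F\<close> that stay. The attached ones are put back according to the tree of
    \<open>G\<close> on which they sit.\<close>
  let ?j = "\<lambda>K. ({r \<in> roots F. case \<phi> r of None \<Rightarrow> r \<in> K | Some x \<Rightarrow> owner G x \<in> K}, K \<inter> roots G)"
  let ?i = "\<lambda>p. {r \<in> fst p. \<phi> r = None} \<union> snd p"
  let ?P = "{p \<in> closed_roots F \<times> closed_roots G. compatible F G \<phi> (fst p) (snd p)}"
  have disr: "roots F \<inter> roots G = {}"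
    using ap roots_labels[of F] roots_labels[of G] unfolding apart_def by blast
  have mv: "x \<in> set (labels G)" if "r \<in> roots F" "\<phi> r = Some x" for r x
  proof -
    have "\<phi> r \<in> insert None (Some ` set (labels G))" using maps_range[OF \<phi>] that(1) by blast
    then show ?thesis using that(2) by auto
  qed
  have key: "sel K ?Z = glue (restrict \<phi> (roots F \<inter> I)) (sel I F) (sel J G)
    \<and> sel (- K) ?Z = glue (restrict \<phi> (roots F \<inter> - I)) (sel (- I) F) (sel (- J) G)
    \<and> (K \<in> closed_roots ?Z \<longleftrightarrow> I \<in> closed_roots F \<and> J \<in> closed_roots G)"
    if c: "compatible F G \<phi> I J" and IJ: "I \<subseteq> roots F" "J \<subseteq> roots G"
      and K: "K = {r \<in> I. \<phi> r = None} \<union> J" for I J K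
  proof -
    have c': "r \<in> I \<longleftrightarrow> owner G x \<in> J" if "r \<in> roots F" "\<phi> r = Some x" for r x
      using c that unfolding compatible_def by blast
    have s1: "sel K ?Z = glue (restrict \<phi> (roots F \<inter> I)) (sel I F) (sel J G)"
      by (rule sel_glue[OF dG]) (use c' mv K IJ disr in auto)
    have s2: "sel (- K) ?Z = glue (restrict \<phi> (roots F \<inter> - I)) (sel (- I) F) (sel (- J) G)"
      by (rule sel_glue[OF dG]) (use c' mv K IJ disr in auto)
    have d: "distinct (labels (sel J G))" "distinct (labels (sel (- J) G))"
      using dG mset_labels_sel[of J G] by (metis distinct_append mset_append mset_eq_imp_distinct_iff)+
    have n1: "nums (sel K ?Z) = nums (sel I F) \<union> nums (sel J G)"
      unfolding s1 by (rule nums_glue[OF restrict_maps(1)[OF dG \<phi> c] d(1)])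
    have n2: "nums (sel (- K) ?Z) = nums (sel (- I) F) \<union> nums (sel (- J) G)"
      unfolding s2 by (rule nums_glue[OF restrict_maps(2)[OF dG \<phi> c] d(2)])
    have sub: "nums (sel A F) \<subseteq> nums F" "nums (sel A G) \<subseteq> nums G" for A
      using labels_sel[of A F] labels_sel[of A G] by (auto simp: nums_def)
    \<comment> \<open>No liana joins \<open>F\<close> to \<open>G\<close>, so closedness of
      \<open>K\<close> separates into closedness of \<open>I\<close> and of
      \<open>J\<close>.\<close>
    have ap': "nums (sel A F) \<inter> nums (sel B G) = {}" for A B
      using sub(1)[of A] sub(2)[of B] ap unfolding apart_def by blast
    have "K \<subseteq> roots ?Z" using IJ unfolding K roots_glue by blast
    then have "K \<in> closed_roots ?Z \<longleftrightarrow> I \<in> closed_roots F \<and> J \<in> closed_roots G"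
      unfolding closed_roots_def mem_Collect_eq n1 n2
      using IJ ap'[of I "- J"] ap'[of "- I" J] by blast
    with s1 s2 show ?thesis by blast
  qed
  show ?thesis
  proof (rule sum.reindex_bij_witness[where i = ?i and j = ?j])
    fix K assume K: "K \<in> closed_roots ?Z"
    let ?I = "fst (?j K)" and ?J = "snd (?j K)"
    have Kr: "K \<subseteq> {r \<in> roots F. \<phi> r = None} \<union> roots G"
      using K by (simp add: closed_roots_def roots_glue)
    have c: "compatible F G \<phi> ?I ?J"
      unfolding compatible_def using mv owner_roots[OF dG] by auto
    have KK: "K = {r \<in> ?I. \<phi> r = None} \<union> ?J"
    proof (intro set_eqI iffI)
      fix r assume "r \<in> K"
      then show "r \<in> {r \<in> ?I. \<phi> r = None} \<union> ?J" using Kr by auto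
    next
      fix r assume "r \<in> {r \<in> ?I. \<phi> r = None} \<union> ?J"
      then show "r \<in> K" by auto
    qed
    have "?I \<subseteq> roots F" "?J \<subseteq> roots G" by auto
    note k = key[OF c this KK]
    show "?i (?j K) = K" using KK by simp
    show "?j K \<in> ?P" using k K c by simp
    show "g (glue (restrict \<phi> (roots F \<inter> ?I)) (sel ?I F) (sel ?J G))
         (glue (restrict \<phi> (roots F \<inter> - ?I)) (sel (- ?I) F) (sel (- ?J) G)) = g (sel K ?Z) (sel (- K) ?Z)"
      using k by simp
  next
    fix p assume "p \<in> ?P"
    then have p: "fst p \<in> closed_roots F" "snd p \<in> closed_roots G" "compatible F G \<phi> (fst p) (snd p)"
      by (auto simp del: split_paired_All split_paired_Ex)
    have sub: "fst p \<subseteq> roots F" "snd p \<subseteq> roots G" using p(1,2) unfolding closed_roots_def by blast+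
    show "?i p \<in> closed_roots ?Z" using key[OF p(3) sub refl] p(1,2) by blast
    have "fst (?j (?i p)) = fst p"
    proof (intro set_eqI)
      fix r
      show "r \<in> fst (?j (?i p)) \<longleftrightarrow> r \<in> fst p"
      proof (cases "r \<in> roots F")
        case True
        then have rG: "r \<notin> roots G" "r \<notin> snd p" using disr sub by blast+
        show ?thesis
        proof (cases "\<phi> r")
          case None
          then show ?thesis using True rG by simp
        next
          case (Some x)
          have "owner G x \<in> roots G" using owner_roots[OF dG] mv[OF True Some] by blast
          then have "owner G x \<notin> fst p" using disr sub(1) by blast
          moreover have "r \<in> fst p \<longleftrightarrow> owner G x \<in> snd p"
            using p(3) True Some unfolding compatible_def by blast
          ultimately show ?thesis using True Some by simp
        qed
      qed (use sub in auto)
    qed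
    moreover have "snd (?j (?i p)) = snd p" unfolding snd_conv using sub disr by blast
    ultimately show "?j (?i p) = p" by (rule prod_eqI)
  qed
qed

text \<open>Both sides run over triples of a closed set of each factor and a grafting map compatible
  with them; they differ in the order of summation and in whether the map is kept whole or as its
  two restrictions.\<close>

lemma deshuffle_GL: "deshuffle (GL_prod (x \<otimes> y)) = tensor_map GL_prod GL_prod (interchange (deshuffle x \<otimes>
    deshuffle y))"
proof (rule bilin_eqI[where f = "\<lambda>x y. deshuffle (GL_prod (x \<otimes> y))"
      and g = "\<lambda>x y. tensor_map GL_prod GL_prod (interchange (deshuffle x \<otimes> deshuffle y))"])
  fix a b :: ef
  obtain F G H :: "nat list lforest"
    where FG: "valid F" "valid G" "cls F = a" "cls G = b" "apart F G"
    by (rule representatives3[of a b a])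
  note dG = valid_distinct[OF FG(2)]
  let ?C = "closed_roots F \<times> closed_roots G"
  let ?t = "\<lambda>\<phi> I J. basis (cls (glue (restrict \<phi> (roots F \<inter> I)) (sel I F) (sel J G)),
      cls (glue (restrict \<phi> (roots F \<inter> - I)) (sel (- I) F) (sel (- J) G))) :: _ \<Rightarrow>\<^sub>0 'a"
  have GL: "GL_basis a b = (\<Sum>\<phi>\<in>maps F G. basis (cls (glue \<phi> F G)) :: _ \<Rightarrow>\<^sub>0 'a)"
    using GL_basis_labelled[OF FG(1,2,5)] by (simp add: FG(3,4))
  have ap: "apart (sel I F) (sel J G)" for I J
    using FG(5) labels_sel[of I F] labels_sel[of J G] unfolding apart_def nums_def by blast
  have "deshuffle (GL_prod (basis a \<otimes> basis b)) =
      (\<Sum>\<phi>\<in>maps F G. \<Sum>K\<in>closed_roots (glue \<phi> F G).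
        basis (cls (sel K (glue \<phi> F G)), cls (sel (- K) (glue \<phi> F G))) :: _ \<Rightarrow>\<^sub>0 'a)"
    by (simp add: GL lin_sum[OF lin_deshuffle] deshuffle_basis_labelled valid_glue[OF FG(1,2,5)] cong: sum.cong)
  also have "\<dots> = (\<Sum>\<phi>\<in>maps F G. \<Sum>p\<in>{p \<in> ?C. compatible F G \<phi> (fst p) (snd p)}. ?t \<phi> (fst p) (snd p))"
    by (intro sum.cong refl sum_closed_glue[OF FG(1,2,5), where g = "\<lambda>X Y. basis (cls X, cls Y)"])
  also have "\<dots> = (\<Sum>p\<in>?C. \<Sum>\<phi>\<in>{\<phi> \<in> maps F G. compatible F G \<phi> (fst p) (snd p)}. ?t \<phi> (fst p) (snd p))"
    by (rule sum.swap_restrict) auto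
  also have "\<dots> = (\<Sum>p\<in>?C. \<Sum>\<phi>\<in>maps (sel (fst p) F) (sel (snd p) G). \<Sum>\<psi>\<in>maps (sel (- fst p) F) (sel (- snd p) G).
      basis (cls (glue \<phi> (sel (fst p) F) (sel (snd p) G)), cls (glue \<psi> (sel (- fst p) F) (sel (- snd p) G))))"
    by (rule sum.cong[OF refl])
      (rule sum_compatible[OF dG, where g = "\<lambda>\<phi> \<psi>. basis (cls (glue \<phi> (sel _ F) (sel _ G)), cls (glue \<psi> (sel
          (- _) F) (sel (- _) G))) :: _ \<Rightarrow>\<^sub>0 'a"])
  also have "\<dots> = (\<Sum>p\<in>?C. GL_basis (cls (sel (fst p) F)) (cls (sel (snd p) G)) \<otimes>
      GL_basis (cls (sel (- fst p) F)) (cls (sel (- snd p) G)))"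
  proof (rule sum.cong[OF refl])
    fix p assume "p \<in> ?C"
    then have p: "fst p \<in> closed_roots F" "snd p \<in> closed_roots G" by (auto simp del: split_paired_All
        split_paired_Ex)
    show "(\<Sum>\<phi>\<in>maps (sel (fst p) F) (sel (snd p) G). \<Sum>\<psi>\<in>maps (sel (- fst p) F) (sel (- snd p) G).
      basis (cls (glue \<phi> (sel (fst p) F) (sel (snd p) G)), cls (glue \<psi> (sel (- fst p) F) (sel (- snd p) G)))) =
      (GL_basis (cls (sel (fst p) F)) (cls (sel (snd p) G)) \<otimes> GL_basis (cls (sel (- fst p) F)) (cls (sel (-
          snd p) G)) :: _ \<Rightarrow>\<^sub>0 'a)"
      by (simp add: GL_basis_labelled[OF apart_sel(1)[OF FG(1) p(1)] apart_sel(1)[OF FG(2) p(2)] ap]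
          GL_basis_labelled[OF apart_sel(2)[OF FG(1) p(1)] apart_sel(2)[OF FG(2) p(2)] ap]
          lin_sum[OF lin_tensor(1)] lin_sum[OF lin_tensor(2)]) (rule sum.swap)
  qed
  also have "\<dots> = tensor_map GL_prod GL_prod (interchange (deshuffle (basis a) \<otimes> deshuffle (basis b)))"
  proof -
    have da: "deshuffle_basis a = (\<Sum>I\<in>closed_roots F. basis (cls (sel I F), cls (sel (- I) F)) :: _ \<Rightarrow>\<^sub>0 'a)"
      using deshuffle_basis_labelled[OF FG(1)] by (simp add: FG(3))
    have db: "deshuffle_basis b = (\<Sum>I\<in>closed_roots G. basis (cls (sel I G), cls (sel (- I) G)) :: _ \<Rightarrow>\<^sub>0 'a)"
      using deshuffle_basis_labelled[OF FG(2)] by (simp add: FG(4))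
    show ?thesis
      by (simp add: da db lin_sum[OF lin_tensor(1)] lin_sum[OF lin_tensor(2)] lin_sum[OF lin_interchange]
          lin_sum[OF lin_tensor_map] sum.cartesian_product' case_prod_unfold) (rule sum.swap)
  qed
  finally show "deshuffle (GL_prod (basis a \<otimes> basis b)) =
    (tensor_map GL_prod GL_prod (interchange (deshuffle (basis a) \<otimes> deshuffle (basis b))) :: _ \<Rightarrow>\<^sub>0 'a)" .
qed (intro lin_comp[OF lin_deshuffle] lin_comp[OF lin_GL_prod] lin_comp[OF lin_tensor_map] lin_comp[OF
    lin_interchange]
    lin_comp[OF lin_tensor(1)] lin_comp[OF lin_tensor(2)] lin_tensor lin_deshuffle)+

lemma GL_bialgebra: "bialgebra GL_prod EF_unit deshuffle EF_counit"
  by (rule bialgebra.intro)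
    (rule lin_GL_prod lin_deshuffle EF_counit_add EF_counit_scale GL_assoc GL_unit_left GL_unit_right
      deshuffle_coassoc deshuffle_counit deshuffle_GL deshuffle_unit GL_counit
      EF_counit_basis[of empty_forest, folded EF_unit_def, simplified])+

text \<open>Numbered nodes count fully here, unlike in the grading of exotic forests, where they
  count one half. This makes the degree the length of the list of labels, whose additivity is
  already known.\<close>

definition num_nodes :: "ef \<Rightarrow> nat" where
  "num_nodes \<pi> = length (labels (rep_ef \<pi>))"

lemma num_nodes_cls: "valid F \<Longrightarrow> num_nodes (cls F) = length (labels F)"
proof -
  assume F: "valid F"
  let ?P = "label_forest [] (rep_ef (cls F))"
  have P: "valid ?P" by (intro valid_label_forest rep_ef_props)
  have "cls F = cls ?P" by (simp add: cls_def[of ?P] rep_ef_props)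
  from cls_eqD[OF F P this] obtain h where h: "?P = relabel h F" by blast
  have "length (labels (rep_ef (cls F))) = length (labels (forget ?P))" by simp
  also have "\<dots> = length (labels ?P)" by (simp only: labels_map length_map)
  also have "\<dots> = length (labels F)" unfolding h by simp
  finally show ?thesis by (simp add: num_nodes_def)
qed

lemma num_nodes_deshuffle:
  assumes "(b, c) \<in> supp (deshuffle_basis a :: ef \<times> ef \<Rightarrow>\<^sub>0 'k::field)"
  shows "num_nodes b + num_nodes c = num_nodes a"
proof -
  obtain F :: "nat list lforest" where F: "valid F" "cls F = a"
    by (rule representative)
  have "coeff (deshuffle_basis a) (b, c) \<noteq> (0 :: 'k)" using assms by (simp add: in_keys_iff)
  then have "(\<Sum>I\<in>closed_roots F. if (cls (sel I F), cls (sel (- I) F)) = (b, c) then 1 else 0 :: 'k) \<noteq> 0"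
    using deshuffle_basis_labelled[OF F(1), where 'k = 'k] F(2) by (simp add: lookup_sum lookup_basis)
  then obtain I where I: "I \<in> closed_roots F" "(cls (sel I F), cls (sel (- I) F)) = (b, c)"
    by (rule sum.not_neutral_contains_not_neutral) (auto split: if_splits)
  have "length (labels (sel I F)) + length (labels (sel (- I) F)) = length (labels F)"
    using arg_cong[OF mset_labels_sel[of I F], of size] by simp
  then show ?thesis
    using num_nodes_cls[OF apart_sel(1)[OF F(1) I(1)]] num_nodes_cls[OF apart_sel(2)[OF F(1) I(1)]]
      num_nodes_cls[OF F(1)] I(2) F(2) by simp
qed

lemma num_nodes_GL:
  assumes "a \<in> supp (GL_basis b c :: ef \<Rightarrow>\<^sub>0 'k::field)"
  shows "num_nodes b + num_nodes c = num_nodes a"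
proof -
  obtain F G H :: "nat list lforest"
    where FG: "valid F" "valid G" "cls F = b" "cls G = c" "apart F G"
    by (rule representatives3[of b c b])
  have "coeff (GL_basis b c) a \<noteq> (0 :: 'k)" using assms by (simp add: in_keys_iff)
  then have "(\<Sum>\<phi>\<in>maps F G. if cls (glue \<phi> F G) = a then 1 else 0 :: 'k) \<noteq> 0"
    using GL_basis_labelled[OF FG(1,2,5), where 'k = 'k] FG(3,4) by (simp add: lookup_sum lookup_basis)
  then obtain \<phi> where p: "\<phi> \<in> maps F G" "cls (glue \<phi> F G) = a"
    by (rule sum.not_neutral_contains_not_neutral) (auto split: if_splits)
  have "length (labels (glue \<phi> F G)) = length (labels F) + length (labels G)"
    using arg_cong[OF maps_mset[OF p(1) valid_distinct[OF FG(2)]], of size] by simp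
  then show ?thesis
    using num_nodes_cls[OF valid_glue[OF FG(1,2,5) p(1)]] num_nodes_cls[OF FG(1)] num_nodes_cls[OF FG(2)]
      p(2) FG(3,4) by simp
qed

lemma num_nodes_zero: "num_nodes a = 0 \<longleftrightarrow> a = empty_forest"
proof -
  obtain F :: "nat list lforest" where F: "valid F" "cls F = a"
    by (rule representative)
  have "labels F = [] \<longleftrightarrow> F = []" using subs_self[of F] by (auto simp: labels_def)
  then show ?thesis using num_nodes_cls[OF F(1)] cls_empty_iff[OF F(1)] F(2) by simp
qed

subsection \<open>Duality of structure constants\<close>

text \<open>Structure constants are images of cardinalities in the field, so equal cardinalities
  yield equal coefficients in every characteristic.\<close>

lemma lookup_sum_basis:
  "finite A \<Longrightarrow> coeff (\<Sum>a\<in>A. basis (f a) :: 'b \<Rightarrow>\<^sub>0 'k::field) b = of_nat (card {a \<in> A. f a = b})"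
  by (simp add: lookup_sum lookup_basis sum.If_cases Int_def)

text \<open>
  A structure \<open>x\<close> builds a labelled forest from two fixed ones, and a structure \<open>y\<close> decomposes a fixed
  labelled forest into two. Planar forests have no automorphisms, so a relabelling is determined
  by its effect, and counting \<open>x\<close> with given result amounts to counting \<open>y\<close> with given parts.
\<close>

lemma card_duality:
  fixes F G :: "'a lforest" and Z :: "'b lforest"
  assumes FG: "valid F" "valid G" "apart F G" and Z: "valid Z"
    and X: "\<And>x. x \<in> X \<Longrightarrow> valid (B x)" "\<And>x. x \<in> X \<Longrightarrow> set (labels (B x)) = set (labels (F @ G))"
    and injX: "inj_on B X"
    and Y: "\<And>y. y \<in> Y \<Longrightarrow> valid (P y)" "\<And>y. y \<in> Y \<Longrightarrow> valid (R y)" "\<And>y. y \<in> Y \<Longrightarrow> apart (P y) (R y)"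
    and injY: "\<And>y y'. y \<in> Y \<Longrightarrow> y' \<in> Y \<Longrightarrow> P y = P y' \<Longrightarrow> R y = R y' \<Longrightarrow> y = y'"
    and fwd: "\<And>x h. x \<in> X \<Longrightarrow> inj_on h (set (labels (F @ G))) \<Longrightarrow> relabelling h (set (labels (F @ G))) \<Longrightarrow>
      relabel h (B x) = Z \<Longrightarrow> \<exists>y\<in>Y. P y = relabel h F \<and> R y = relabel h G"
    and bwd: "\<And>y h. y \<in> Y \<Longrightarrow> inj_on h (set (labels (F @ G))) \<Longrightarrow> relabelling h (set (labels (F @ G))) \<Longrightarrow>
      P y = relabel h F \<Longrightarrow> R y = relabel h G \<Longrightarrow> \<exists>x\<in>X. relabel h (B x) = Z"
  shows "card {x \<in> X. cls (B x) = cls Z} = card {y \<in> Y. cls (P y) = cls F \<and> cls (R y) = cls G}"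
proof -
  let ?A = "set (labels (F @ G))"
  let ?X = "{x \<in> X. cls (B x) = cls Z}" and ?Y = "{y \<in> Y. cls (P y) = cls F \<and> cls (R y) = cls G}"
  have sub: "set (labels F) \<subseteq> ?A" "set (labels G) \<subseteq> ?A" by auto
  define rel where "rel = (\<lambda>x h. inj_on h ?A \<and> relabelling h ?A \<and> relabel h (B x) = Z)"
  have exh: "\<exists>h. rel x h" if x: "x \<in> ?X" for x
  proof -
    obtain h where h: "Z = relabel h (B x)" "relabelling h (set (labels (B x)))"
      using cls_eqD[of "B x" Z] x X(1) Z by blast
    have "distinct (map h (labels (B x)))" using valid_distinct[OF Z] unfolding h(1) by simp
    then have "inj_on h (set (labels (B x)))" by (simp add: distinct_map)
    moreover have "set (labels (B x)) = ?A" using X(2) x by blast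
    ultimately show ?thesis using h unfolding rel_def by metis
  qed
  \<comment> \<open>Rigidity of planar forests: the relabelling turning \<open>B x\<close> into
    \<open>Z\<close> is unique on the labels.\<close>
  have unique: "h z = h' z" if x: "x \<in> X" and h: "rel x h" and h': "rel x h'" and z: "z \<in> ?A" for x h h' z
  proof -
    have "relabel h (B x) = relabel h' (B x)" using h h' by (simp add: rel_def)
    then show ?thesis using z X(2)[OF x] unfolding map_forest_cong_iff by blast
  qed
  \<comment> \<open>The decomposition belonging to \<open>x\<close> consists of the images of
    \<open>F\<close> and \<open>G\<close> under the relabelling that identifies \<open>B x\<close>
    with \<open>Z\<close>.\<close>
  define Q where "Q = (\<lambda>x y. y \<in> Y \<and> (\<exists>h. rel x h \<and> P y = relabel h F \<and> R y = relabel h G))"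
  have ex1: "\<exists>y. Q x y" if x: "x \<in> ?X" for x
  proof -
    obtain h where h: "rel x h" using exh[OF x] by blast
    then obtain y where "y \<in> Y" "P y = relabel h F" "R y = relabel h G"
      using fwd[of x h] x unfolding rel_def by blast
    then show ?thesis using h unfolding Q_def by blast
  qed
  define q where "q = (\<lambda>x. SOME y. Q x y)"
  have q: "Q x (q x)" if "x \<in> ?X" for x
    unfolding q_def using ex1[OF that] by (rule someI_ex)
  have "bij_betw q ?X ?Y"
    unfolding bij_betw_def
  proof
    show "inj_on q ?X"
    proof (rule inj_onI)
      fix x x' assume xx: "x \<in> ?X" "x' \<in> ?X" "q x = q x'"
      obtain h where h: "rel x h" "P (q x) = relabel h F" "R (q x) = relabel h G"
        using q[OF xx(1)] unfolding Q_def by blast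
      obtain h' where h': "rel x' h'" "P (q x) = relabel h' F" "R (q x) = relabel h' G"
        using q[OF xx(2)] unfolding Q_def xx(3)[symmetric] by blast
      have "relabel h F = relabel h' F" "relabel h G = relabel h' G"
        using h(2,3) h'(2,3) by simp_all
      then have eq: "h z = h' z" if "z \<in> ?A" for z
        using that unfolding map_forest_cong_iff by auto
      have e1: "relabel h (B x') = relabel h' (B x')"
        using eq X(2) xx(2) by (intro map_forest_cong) blast
      have e2: "relabel h (B x) = Z" "relabel h' (B x') = Z"
        using h(1) h'(1) unfolding rel_def by blast+
      have "relabel h (B x) = relabel h (B x')"
        unfolding e1 e2 ..
      \<comment> \<open>The equal parts force \<open>h\<close> and \<open>h'\<close> to agree on all
        labels; undoing the common injective relabelling then gives
        \<open>B x = B x'\<close>.\<close>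
      moreover have "B y = relabel (inv_into ?A h) (relabel h (B y))" if "y \<in> X" for y
      proof -
        have "relabel (inv_into ?A h \<circ> h) (B y) = relabel id (B y)"
          using h(1) X(2)[OF that] by (intro map_forest_cong) (simp add: rel_def)
        then show ?thesis by (simp add: ptree.map_comp comp_def ptree.map_id0[unfolded id_def] id_def)
      qed
      ultimately have "B x = B x'" using xx(1,2) by (metis (no_types, lifting) mem_Collect_eq)
      then show "x = x'" using injX xx(1,2) by (auto simp: inj_on_def)
    qed
    show "q ` ?X = ?Y"
    proof (intro subset_antisym subsetI)
      fix y assume "y \<in> q ` ?X"
      then obtain x where x: "x \<in> ?X" "y = q x" by blast
      then obtain h where h: "y \<in> Y" "rel x h" "P y = relabel h F" "R y = relabel h G"
        using q[OF x(1)] unfolding Q_def by blast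
      have "relabelling h (set (labels F))" "relabelling h (set (labels G))"
        using h(2) relabelling_subset sub unfolding rel_def by blast+
      then have "cls (P y) = cls F" "cls (R y) = cls G"
        using cls_relabel[of F h] cls_relabel[of G h] FG Y[OF h(1)] h(3,4) by simp_all
      then show "y \<in> ?Y" using h(1) by blast
    next
      fix y assume y: "y \<in> ?Y"
      then have yY: "y \<in> Y" by blast
      obtain h where h: "P y = relabel h F" "R y = relabel h G"
        "relabelling h ?A" "inj_on h ?A"
        using cls_pair_eqD[OF FG Y[OF yY]] y by (metis (mono_tags, lifting) mem_Collect_eq)
      then obtain x where x: "x \<in> X" "relabel h (B x) = Z" using bwd[OF yY] by blast
      then have rx: "rel x h" using h by (simp add: rel_def)
      have "relabelling h (set (labels (B x)))" using h(3) X(2)[OF x(1)] by simp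
      then have "cls (B x) = cls Z"
        using cls_relabel[OF X(1)[OF x(1)], of h] Z x(2) by simp
      then have xX: "x \<in> ?X" using x(1) by blast
      obtain h' where h': "q x \<in> Y" "rel x h'" "P (q x) = relabel h' F" "R (q x) = relabel h' G"
        using q[OF xX] unfolding Q_def by blast
      have "relabel h' F = relabel h F" "relabel h' G = relabel h G"
        by (rule map_forest_cong, rule unique[OF x(1) h'(2) rx], use sub in blast)+
      then have "q x = y" using injY[OF h'(1) yY] h'(3,4) h(1,2) by simp
      then show "y \<in> q ` ?X" using xX by blast
    qed
  qed
  then show ?thesis by (rule bij_betw_same_card)
qed

lemma shuffles_map: "shuffles (map f xs) (map f ys) = map f ` shuffles xs ys"
  by (induction xs ys rule: shuffles.induct) (simp_all add: image_Un image_image)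

text \<open>\<open>shuffles\<close> is a set of lists. As the labelled trees are distinct, different
  interleavings of positions give different lists of trees, and no multiplicity is lost.\<close>

lemma shuffle_basis_label_forest:
  fixes \<pi> \<eta> p q
  defines "F \<equiv> label_forest p (rep_even \<pi>)" and "G \<equiv> label_forest q (rep_odd \<eta>)"
  assumes "distinct (F @ G)"
  shows "shuffle_basis \<pi> \<eta> = (\<Sum>L\<in>shuffles F G. basis (cls L) :: ef \<Rightarrow>\<^sub>0 'k::field)"
proof -
  define f g where "f = rep_even \<pi>" and "g = rep_odd \<eta>"
  let ?n = "length f" and ?m = "length g"
  let ?S = "shuffles [0..<?n] [?n..<?n + ?m]"
  have len: "length F = ?n" "length G = ?m" by (simp_all add: F_def G_def f_def g_def)
  have fg: "forget (F @ G) = f @ g" by (simp add: F_def G_def f_def g_def)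
  have F: "map ((!) (F @ G)) [0..<?n] = F"
    by (rule nth_equalityI) (simp_all add: len nth_append)
  have G: "map ((!) (F @ G)) [?n..<?n + ?m] = G"
    by (rule nth_equalityI) (simp_all add: len nth_append)
  have img: "shuffles F G = map ((!) (F @ G)) ` ?S"
    using shuffles_map[of "(!) (F @ G)" "[0..<?n]" "[?n..<?n + ?m]"] unfolding F G .
  have set: "i < ?n + ?m" if "l \<in> ?S" "i \<in> set l" for i l
  proof -
    have "i \<in> {0..<?n} \<union> {?n..<?n + ?m}"
      using that(2) unfolding set_shuffles[OF that(1)] by simp
    then show ?thesis by (elim UnE) simp_all
  qed
  have inj: "inj_on (map ((!) (F @ G))) ?S"
  proof (rule inj_onI)
    fix l l' assume l: "l \<in> ?S" "l' \<in> ?S" "map ((!) (F @ G)) l = map ((!) (F @ G)) l'"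
    have "inj_on ((!) (F @ G)) (set l \<union> set l')"
      using set[OF l(1)] set[OF l(2)] by (intro inj_on_nth assms(3)) (simp add: len, blast)
    then show "l = l'" by (rule map_inj_on[OF l(3)])
  qed
  have "shuffle_basis \<pi> \<eta> = (\<Sum>l\<in>?S. basis (abs_ef (map ((!) (f @ g)) l)) :: ef \<Rightarrow>\<^sub>0 'k)"
    unfolding shuffle_basis_def Let_def f_def g_def ..
  also have "\<dots> = (\<Sum>l\<in>?S. basis (cls (map ((!) (F @ G)) l)))"
  proof (rule sum.cong[OF refl])
    fix l assume "l \<in> ?S"
    then have "i < length (F @ G)" if "i \<in> set l" for i using set[OF _ that] by (simp add: len)
    then have "map ((!) (f @ g)) l = forget (map ((!) (F @ G)) l)"
      unfolding fg[symmetric] list.map_comp by (intro map_cong refl) (simp add: nth_map del: map_append)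
    then show "basis (abs_ef (map ((!) (f @ g)) l)) = (basis (cls (map ((!) (F @ G)) l)) :: ef \<Rightarrow>\<^sub>0 'k)"
      by (simp only: cls_def)
  qed
  also have "\<dots> = (\<Sum>L\<in>shuffles F G. basis (cls L))"
    unfolding img by (subst sum.reindex[OF inj]) simp
  finally show ?thesis .
qed

text \<open>An instance of \<open>card_duality\<close>: interleavings of \<open>F\<close> and
  \<open>G\<close> are the constructions, closed sets of roots of the labelled representative of
  \<open>\<zeta>\<close> are the decompositions.\<close>

lemma shuffle_deshuffle_dual:
  "coeff (shuffle_basis \<pi> \<eta>) \<zeta> = (coeff (deshuffle_basis \<zeta>) (\<pi>, \<eta>) :: 'k::field)"
proof -
  let ?F = "label_forest [0] (rep_even \<pi>)" and ?G = "label_forest [1] (rep_odd \<eta>)"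
  let ?Z = "label_forest [] (rep_ef \<zeta>)"
  note FG = rep_even_odd(1)[of "[0]" \<pi>] rep_even_odd(2)[of "[1]" \<eta>] rep_even_odd(5)[of \<pi> \<eta>]
  note V = valid_append[OF FG]
  have Z: "valid ?Z" by (intro valid_label_forest rep_ef_props)
  have clsZ: "cls ?Z = \<zeta>" by (simp add: cls_def rep_ef_props)
  have dis: "distinct (?F @ ?G)" by (rule distinct_labels_distinct[OF valid_distinct[OF V]])
  have "card {L \<in> shuffles ?F ?G. cls L = cls ?Z} =
    card {I \<in> closed_roots ?Z. cls (sel I ?Z) = cls ?F \<and> cls (sel (- I) ?Z) = cls ?G}"
  proof (rule card_duality[OF FG Z, where B = "\<lambda>L. L"])
    have mem: "mset L = mset (?F @ ?G)" if L: "L \<in> shuffles ?F ?G" for L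
    proof -
      have "distinct L" using distinct_disjoint_shuffles[OF _ _ _ L] dis by auto
      moreover have "set L = set (?F @ ?G)" using set_shuffles[OF L] by simp
      ultimately show ?thesis using dis by (metis set_eq_iff_mset_eq_distinct)
    qed
    have labm: "mset (labels L) = mset (labels L')" if "mset L = mset L'" for L L' :: "nat list lforest"
    proof -
      have s: "mset (labels L) = sum_mset (image_mset (\<lambda>t. mset (labels_tree t)) (mset L))"
        for L :: "nat list lforest"
        by (induction L) simp_all
      show ?thesis unfolding s that ..
    qed
    show lab: "set (labels L) = set (labels (?F @ ?G))" if "L \<in> shuffles ?F ?G" for L
      using labm[OF mem[OF that]] by (metis set_mset_mset)
    show "valid L" if L: "L \<in> shuffles ?F ?G" for L
    proof (rule valid_mset_cong[OF V labm[OF mem[OF L]]])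
      fix t assume "t \<in> set (subs L)" "snd (decoration t) \<noteq> None"
      moreover have "set (subs L) = set (subs (?F @ ?G))"
        using set_shuffles[OF L] by (simp add: subs_def image_Un)
      ultimately show "children t = []" using V by (simp add: valid_def)
    qed
    show "inj_on (\<lambda>L. L) (shuffles ?F ?G)" by simp
    show "valid (sel I ?Z)" "valid (sel (- I) ?Z)" "apart (sel I ?Z) (sel (- I) ?Z)" if "I \<in> closed_roots ?Z" for I
      using apart_sel[OF Z that] by simp_all
    show "I = J" if "I \<in> closed_roots ?Z" "J \<in> closed_roots ?Z" "sel I ?Z = sel J ?Z" for I J
    proof -
      have "roots (sel I ?Z) = I" "roots (sel J ?Z) = J" using that(1,2) by (auto simp: closed_roots_def)
      then show ?thesis using that(3) by simp
    qed
    show "\<exists>I\<in>closed_roots ?Z. sel I ?Z = relabel h ?F \<and> sel (- I) ?Z = relabel h ?G"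
      if L: "L \<in> shuffles ?F ?G" and inj: "inj_on h (set (labels (?F @ ?G)))"
        and rel: "relabelling h (set (labels (?F @ ?G)))" and hL: "relabel h L = ?Z" for L h
    proof -
      note cl = closed_relabel[of h L, unfolded lab[OF L], OF rel inj, unfolded hL]
      have rL: "roots ?F \<subseteq> roots L" using set_shuffles[OF L] by (auto simp: roots_def)
      have disj: "set ?F \<inter> set ?G = {}" using dis by auto
      have mem: "decoration t \<in> roots ?F \<longleftrightarrow> t \<in> set ?F" if t: "t \<in> set L" for t
      proof
        assume "decoration t \<in> roots ?F"
        then obtain u where u: "u \<in> set ?F" "decoration t = decoration u" by (auto simp: roots_def)
        have "t \<in> set (?F @ ?G)" "u \<in> set (?F @ ?G)" using t u set_shuffles[OF L] by auto
        from root_inj[OF valid_distinct[OF V] this u(2)] show "t \<in> set ?F" using u by simp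
      qed (simp add: roots_def)
      have s: "sel (roots ?F) L = ?F" "sel (- roots ?F) L = ?G"
      proof -
        have "sel (roots ?F) L = filter (\<lambda>t. t \<in> set ?F) L" unfolding sel_def using mem by (intro filter_cong) auto
        then show "sel (roots ?F) L = ?F" by (simp only: filter_shuffles_disjoint1(1)[OF disj L])
        have "sel (- roots ?F) L = filter (\<lambda>t. t \<notin> set ?F) L" unfolding sel_def using mem by (intro
            filter_cong) auto
        then show "sel (- roots ?F) L = ?G" by (simp only: filter_shuffles_disjoint1(2)[OF disj L])
      qed
      have "roots ?F \<in> closed_roots L"
        unfolding closed_roots_def using rL FG(3) by (simp only: mem_Collect_eq s apart_def)
      \<comment> \<open>The closed set belonging to an interleaving consists of the roots
        contributed by \<open>F\<close>, relabelled into \<open>?Z\<close>.\<close>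
      then have "h ` roots ?F \<in> closed_roots ?Z" using bij_betw_apply[OF cl(1)] by blast
      then show ?thesis using cl(2,3)[OF rL] unfolding s by blast
    qed
    show "\<exists>L\<in>shuffles ?F ?G. relabel h L = ?Z"
      if "I \<in> closed_roots ?Z" "sel I ?Z = relabel h ?F" "sel (- I) ?Z = relabel h ?G" for I h
    proof -
      \<comment> \<open>A list is always an interleaving of the sublist satisfying a predicate with
        its complement.\<close>
      have "?Z \<in> shuffles (sel I ?Z) (sel (- I) ?Z)"
        using partition_in_shuffles[of ?Z "\<lambda>t. decoration t \<in> I"] by (simp add: sel_def)
      then have "?Z \<in> relabel h ` shuffles ?F ?G"
        unfolding that(2,3) shuffles_map .
      then show ?thesis by force
    qed
  qed
  then show ?thesis
    unfolding shuffle_basis_label_forest[of "[0]" \<pi> "[1]" \<eta>, OF dis] deshuffle_label_forest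
    by (simp add: lookup_sum_basis clsZ rep_even_odd)
qed

subsection \<open>Admissible cuts of labelled trees\<close>

text \<open>The label-based counterpart of \<open>root_part\<close>; the root of the given tree
  itself is always kept, as there is no edge above it.\<close>

primrec prune :: "'d set \<Rightarrow> 'd ptree \<Rightarrow> 'd ptree" where
  "prune C (Node x ts) = Node x (filter (\<lambda>t. decoration t \<notin> C) (map (prune C) ts))"

definition prunes :: "'d set \<Rightarrow> 'd ptree list \<Rightarrow> 'd ptree list" where
  "prunes C F = filter (\<lambda>t. decoration t \<notin> C) (map (prune C) F)"

lemma prune_Node [simp]: "prune C (Node x ts) = Node x (prunes C ts)"
  by (simp add: prunes_def)

declare prune.simps [simp del]

lemma decoration_prune [simp]: "decoration (prune C t) = decoration t"
  by (cases t) simp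

lemma children_prune [simp]: "children (prune C t) = prunes C (children t)"
  by (cases t) simp

lemma prunes_simps [simp]:
  "prunes C [] = []"
  "prunes C (Node x ts # us) = (if x \<in> C then prunes C us else Node x (prunes C ts) # prunes C us)"
  "prunes C (F @ G) = prunes C F @ prunes C G"
  by (simp_all add: prunes_def)

lemma prunes_none: "roots F \<subseteq> C \<Longrightarrow> prunes C F = []"
  by (auto simp: prunes_def filter_empty_conv roots_def)

lemma labels_prunes: "set (labels (prunes C F)) \<subseteq> set (labels F)"
  by (induction F rule: forest_induct) auto

lemma distinct_prunes: "distinct (labels F) \<Longrightarrow> distinct (labels (prunes C F))"
proof (induction F rule: forest_induct)
  case (Node x ts us)
  then show ?case using labels_prunes[of C ts] labels_prunes[of C us] by auto
qed simp

lemma labels_prunes_cases: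
  "x \<in> set (labels F) \<Longrightarrow> x \<in> set (labels (prunes C F)) \<or>
    (\<exists>u\<in>set (subs F). decoration u \<in> C \<and> x \<in> set (labels_tree u))"
  by (induction F rule: forest_induct) (auto simp del: split_paired_All split_paired_Ex)

lemma subs_prunes: "u \<in> set (subs (prunes C F)) \<Longrightarrow>
    \<exists>v\<in>set (subs F). decoration u = decoration v \<and> children u = prunes C (children v)"
  by (induction F rule: forest_induct) (auto split: if_splits)

text \<open>Cutting off everything that has just been attached restores the forest.\<close>

lemma prunes_gr:
  assumes "\<And>x. x \<in> set (labels F) \<Longrightarrow> roots (a x) \<subseteq> C" "set (labels F) \<inter> C = {}"
  shows "prunes C (map (gr a) F) = F"
  using assms by (induction F rule: forest_induct) (auto simp: prunes_none)

text \<open>\<open>root_part\<close> shortens the addresses of the cut while descending, whereas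
  labels hold addresses in the whole tree; the prefix \<open>p\<close> accounts for the
  difference.\<close>

lemma forget_prune_label_tree:
  "map_ptree snd (prune {x. fst x \<in> c} (label_tree p t)) = root_part {q. p @ q \<in> c} t"
proof (induction t arbitrary: p)
  case (Node d ts)
  have "relabel snd (prunes {x. fst x \<in> c} (label_forest p ts)) =
      map (\<lambda>i. map_ptree snd (prune {x. fst x \<in> c} (label_tree (p @ [i]) (ts ! i))))
        (filter (\<lambda>i. p @ [i] \<notin> c) [0..<length ts])"
    by (simp add: prunes_def label_forest_def filter_map comp_def)
  also have "\<dots> = map (\<lambda>i. root_part {q. i # q \<in> {q. p @ q \<in> c}} (ts ! i))
        (filter (\<lambda>i. [i] \<notin> {q. p @ q \<in> c}) [0..<length ts])"
    using Node by (intro map_cong) auto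
  finally show ?case by simp
qed

lemma is_node_append: "is_node t (p @ q) \<longleftrightarrow> is_node t p \<and> is_node (subtree t p) q"
  by (induction t p rule: is_node.induct) auto

lemma subtree_append: "subtree t (p @ q) = subtree (subtree t p) q"
  by (induction t p rule: subtree.induct) auto

lemma deco_append: "deco t (p @ q) = deco (subtree t p) q"
  by (simp add: deco_def subtree_append)

lemma nodes_append: "p @ q \<in> nodes t \<longleftrightarrow> p \<in> nodes t \<and> q \<in> nodes (subtree t p)"
  by (simp add: nodes_def is_node_append)

lemma leaf_exists: "\<exists>q. q \<in> leaves t"
proof (induction t)
  case (Node d ts)
  show ?case
  proof (cases ts)
    case Nil
    then have "[] \<in> leaves (Node d ts)" by (simp add: leaves_def nodes_def)
    then show ?thesis by blast
  next
    case (Cons u us)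
    then obtain q where "q \<in> leaves u" using Node[of u] by auto
    then have "0 # q \<in> leaves (Node d ts)" using Cons by (simp add: leaves_def nodes_def)
    then show ?thesis by blast
  qed
qed

text \<open>Admissibility restricts cut edges on paths starting at leaves; since every node lies on
  such a path, the restriction reaches all nodes.\<close>

lemma leaf_above: "p \<in> nodes t \<Longrightarrow> \<exists>q\<in>leaves t. prefix p q"
proof -
  assume p: "p \<in> nodes t"
  obtain q where "q \<in> leaves (subtree t p)" using leaf_exists by blast
  then have "p @ q \<in> leaves t" using p by (simp add: leaves_def nodes_append subtree_append)
  then show ?thesis by (meson prefixI)
qed

text \<open>\<open>cut_orders\<close> constrains only edges with a common parent, so the order may
  be verified for one parent at a time.\<close>

lemma sorted_wrt_fibers:
  "(\<And>v. sorted_wrt R (filter (\<lambda>x. f x = v) xs)) \<Longrightarrow> sorted_wrt (\<lambda>x y. f x = f y \<longrightarrow> R x y) xs"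
proof (induction xs)
  case (Cons x xs)
  have "sorted_wrt R (filter (\<lambda>y. f y = v) xs)" for v
    using Cons.prems[of v] by (cases "f x = v") auto
  then show ?case using Cons.IH Cons.prems[of "f x"] by auto
qed simp

text \<open>An ordered cut lists the addresses of the roots of the pieces which are cut off.\<close>

definition ordered_cuts :: "dtree \<Rightarrow> nat list list set" where
  "ordered_cuts t = {l. admissible t (set l) \<and> l \<in> cut_orders (set l)}"

definition cut_pieces :: "dtree \<Rightarrow> nat list list \<Rightarrow> nat list lforest" where
  "cut_pieces t l = map (\<lambda>e. label_tree e (subtree t e)) l"

definition cut_rest :: "dtree \<Rightarrow> nat list list \<Rightarrow> nat list lforest" where
  "cut_rest t l = prunes {x. fst x \<in> set l} (label_forest [] (children t))"

lemma finite_ordered_cuts [simp]: "finite (ordered_cuts t)"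
proof -
  have "finite {l. set l \<subseteq> nodes t \<and> distinct l}" by (rule finite_subset_distinct) simp
  then show ?thesis
    by (rule rev_finite_subset) (auto simp: ordered_cuts_def admissible_def edges_def cut_orders_def)
qed

text \<open>The double sum over cuts and interleavings becomes a single one, because an enumeration
  determines the cut it enumerates.\<close>

lemma MKW_basis_cuts:
  fixes \<zeta>
  defines "t \<equiv> Bplus (rep_ef \<zeta>)"
  shows "MKW_basis \<zeta> = (\<Sum>l\<in>ordered_cuts t. basis (cls (cut_pieces t l), cls (cut_rest t l)) :: ef \<times> ef \<Rightarrow>\<^sub>0
      'k::field)"
proof -
  let ?A = "{c. admissible t c}"
  have finA: "finite ?A"
    by (rule finite_subset[of _ "Pow (nodes t)"]) (auto simp: admissible_def edges_def)
  have finO: "finite (cut_orders c)" if "c \<in> ?A" for c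
  proof -
    have "finite c" using that by (intro finite_subset[of c "nodes t"]) (auto simp: admissible_def edges_def)
    then have "finite {l. set l \<subseteq> c \<and> distinct l}" by (rule finite_subset_distinct)
    then show ?thesis by (rule rev_finite_subset) (auto simp: cut_orders_def)
  qed
  have pieces: "map (subtree t) l = forget (cut_pieces t l)" for l
    by (simp add: cut_pieces_def comp_def)
  have rest: "Bminus (root_part (set l) t) = forget (cut_rest t l)" for l
    using arg_cong[OF forget_prune_label_tree[of "set l" "[]" t], of children]
    by (simp add: Bminus_def cut_rest_def)
  have "MKW_basis \<zeta> = (\<Sum>c\<in>?A. \<Sum>l\<in>cut_orders c.
      basis (abs_ef (map (subtree t) l), abs_ef (Bminus (root_part c t))) :: ef \<times> ef \<Rightarrow>\<^sub>0 'k)"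
    unfolding MKW_basis_def Let_def t_def[symmetric] pruned_part_def
    by (simp add: lin_sum[OF lin_tensor(1)])
  also have "\<dots> = (\<Sum>p\<in>(SIGMA c:?A. cut_orders c). basis (abs_ef (map (subtree t) (snd p)), abs_ef (Bminus
      (root_part (fst p) t))))"
    using finA finO by (simp add: sum.Sigma case_prod_unfold)
  also have "\<dots> = (\<Sum>l\<in>ordered_cuts t. basis (cls (cut_pieces t l), cls (cut_rest t l)))"
  proof (rule sum.reindex_bij_witness[where j = snd and i = "\<lambda>l. (set l, l)"])
    fix p assume "p \<in> (SIGMA c:?A. cut_orders c)"
    then have p: "admissible t (fst p)" "snd p \<in> cut_orders (fst p)" by auto
    then have s: "set (snd p) = fst p" by (simp add: cut_orders_def)
    then show "(set (snd p), snd p) = p" by simp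
    show "snd p \<in> ordered_cuts t" using p s by (simp add: ordered_cuts_def)
    show "basis (cls (cut_pieces t (snd p)), cls (cut_rest t (snd p))) =
      (basis (abs_ef (map (subtree t) (snd p)), abs_ef (Bminus (root_part (fst p) t))) :: ef \<times> ef \<Rightarrow>\<^sub>0 'k)"
      unfolding s[symmetric] cls_def pieces rest ..
  qed (auto simp: ordered_cuts_def)
  finally show ?thesis .
qed

lemma sorted_initial_segment:
  assumes "sorted_wrt (\<lambda>e e'. last e < last e') xs" "\<And>e. e \<in> set xs \<Longrightarrow> e \<noteq> [] \<and> butlast e = p"
    and "last ` set xs = {..<k}"
  shows "xs = map (\<lambda>i. p @ [i]) [0..<k]"
proof -
  have s: "sorted_wrt (<) (map last xs)" using assms(1) by (simp add: sorted_wrt_map)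
  have "sorted_wrt (<) [0..<k]" by simp
  moreover have "set (map last xs) = set [0..<k]" using assms(3) by (simp add: atLeast0LessThan)
  ultimately have l: "map last xs = [0..<k]" using s by (metis strict_sorted_equal)
  have "xs = map (\<lambda>e. p @ [last e]) xs"
    using assms(2) by (intro map_idI[symmetric]) (metis append_butlast_last_id)
  also have "\<dots> = map (\<lambda>i. p @ [i]) (map last xs)" by simp
  finally show ?thesis unfolding l .
qed

text \<open>Regrafting the pieces undoes the cut: at each node the removed children form an initial
  segment, listed from left to right, and grafting puts them back to the left of the remaining
  ones.\<close>

lemma gr_prune:
  fixes t :: dtree
  assumes l: "l \<in> ordered_cuts t"
  defines "a \<equiv> \<lambda>x. map (\<lambda>e. label_tree e (subtree t e)) (filter (\<lambda>e. butlast e = fst x) l)"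
  shows "p \<in> nodes t \<Longrightarrow> subtree t p = s \<Longrightarrow>
    gr a (prune {x. fst x \<in> set l} (label_tree p s)) = label_tree p s"
proof (induction s arbitrary: p)
  case (Node d ts)
  let ?n = "length ts" and ?C = "{x. fst x \<in> set l} :: (nat list \<times> nat option) set"
  have adm: "admissible t (set l)"
    and sorted: "sorted_wrt (\<lambda>e e'. butlast e = butlast e' \<longrightarrow> last e < last e') l"
    using l by (simp_all add: ordered_cuts_def cut_orders_def)
  have edge: "e \<in> nodes t \<and> e \<noteq> []" if "e \<in> set l" for e
    using adm that unfolding admissible_def edges_def by blast
  have left: "p @ [j] \<in> set l" if "p @ [i] \<in> set l" "j < i" for i j
    using adm that unfolding admissible_def by blast
  have child: "i < ?n" if "p @ [i] \<in> set l" for i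
    using edge[OF that] Node.prems(2) by (simp add: nodes_append) (simp add: nodes_def)
  \<comment> \<open>The first child that is not cut off. It exists because the index
    \<open>?n\<close> lies past all children, and by closedness to the left it equals the number of
    children cut off.\<close>
  define k where "k = (LEAST k. p @ [k] \<notin> set l)"
  have ex: "p @ [?n] \<notin> set l" using child by blast
  have k: "p @ [k] \<notin> set l" unfolding k_def by (rule LeastI[of "\<lambda>k. p @ [k] \<notin> set l", OF ex])
  have cut: "p @ [i] \<in> set l \<longleftrightarrow> i < k" for i
  proof
    show "p @ [i] \<in> set l \<Longrightarrow> i < k" using left[of i k] k by (metis linorder_neqE_nat)
    show "i < k \<Longrightarrow> p @ [i] \<in> set l" unfolding k_def using not_less_Least by blast
  qed
  have kn: "k \<le> ?n" unfolding k_def by (rule Least_le[of "\<lambda>k. p @ [k] \<notin> set l", OF ex])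
  have fil: "filter (\<lambda>e. butlast e = p) l = map (\<lambda>i. p @ [i]) [0..<k]"
  proof (rule sorted_initial_segment)
    have "sorted_wrt (\<lambda>e e'. butlast e = butlast e' \<longrightarrow> last e < last e') (filter (\<lambda>e. butlast e = p) l)"
      using sorted by (rule sorted_wrt_filter)
    then show "sorted_wrt (\<lambda>e e'. last e < last e') (filter (\<lambda>e. butlast e = p) l)"
      by (rule sorted_wrt_mono_rel[rotated]) auto
    show "e \<noteq> [] \<and> butlast e = p" if "e \<in> set (filter (\<lambda>e. butlast e = p) l)" for e
      using that edge by auto
    show "last ` set (filter (\<lambda>e. butlast e = p) l) = {..<k}"
    proof (intro subset_antisym subsetI)
      fix i assume "i \<in> last ` set (filter (\<lambda>e. butlast e = p) l)"
      then obtain e where e: "e \<in> set l" "butlast e = p" "i = last e" by auto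
      then have "p @ [i] = e" using edge[OF e(1)] by (metis append_butlast_last_id)
      then have "p @ [i] \<in> set l" using e(1) by (simp only:)
      then show "i \<in> {..<k}" by (simp add: cut)
    next
      fix i assume "i \<in> {..<k}"
      then have "p @ [i] \<in> set (filter (\<lambda>e. butlast e = p) l)" using cut by simp
      then show "i \<in> last ` set (filter (\<lambda>e. butlast e = p) l)" by force
    qed
  qed
  have up: "[0..<?n] = [0..<k] @ [k..<?n]" using upt_add_eq_append[of 0 k "?n - k"] kn by simp
  have sub: "subtree t (p @ [i]) = ts ! i" for i
    using Node.prems(2) by (simp add: subtree_append)
  have a: "a (p, d) = map (\<lambda>i. label_tree (p @ [i]) (ts ! i)) [0..<k]"
    by (simp add: a_def fil comp_def sub)
  have "map (gr a) (prunes ?C (label_forest p ts)) =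
      map (\<lambda>i. gr a (prune ?C (label_tree (p @ [i]) (ts ! i)))) (filter (\<lambda>i. \<not> i < k) [0..<?n])"
    by (simp add: prunes_def label_forest_def filter_map comp_def cut)
  also have "filter (\<lambda>i. \<not> i < k) [0..<?n] = [k..<?n]"
    unfolding up by (simp add: filter_empty_conv filter_id_conv)
  also have "map (\<lambda>i. gr a (prune ?C (label_tree (p @ [i]) (ts ! i)))) [k..<?n] =
      map (\<lambda>i. label_tree (p @ [i]) (ts ! i)) [k..<?n]"
  proof (rule map_cong[OF refl])
    fix i assume "i \<in> set [k..<?n]"
    then have i: "i < ?n" by simp
    have "p @ [i] \<in> nodes t" using Node.prems i by (simp add: nodes_append) (simp add: nodes_def)
    then show "gr a (prune ?C (label_tree (p @ [i]) (ts ! i))) = label_tree (p @ [i]) (ts ! i)"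
      using Node.IH[of "ts ! i" "p @ [i]"] i sub by simp
  qed
  finally have "a (p, d) @ map (gr a) (prunes ?C (label_forest p ts)) = label_forest p ts"
    unfolding a label_forest_def up map_append by simp
  then show ?case by simp
qed

lemma subs_closed: "set P \<subseteq> set (subs Z) \<Longrightarrow> set (subs P) \<subseteq> set (subs Z)"
proof
  fix u assume P: "set P \<subseteq> set (subs Z)" and "u \<in> set (subs P)"
  then obtain v where v: "v \<in> set P" "u \<in> set (subs_tree v)" by (auto simp: subs_def)
  have "set (subs_tree v) = insert v (set (subs (children v)))" by (cases v) simp
  then show "u \<in> set (subs Z)" using v P subs_trans[of v Z] by auto
qed

section \<open>Ordered cuts of a forest are the graftings that produce it\<close>

context
  fixes f :: dforest and t :: dtree and Z :: "nat list lforest"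
  assumes exf: "exotic f"
  defines "t \<equiv> Bplus f" and "Z \<equiv> label_forest [] f"
begin

lemma validZ: "valid Z"
  unfolding Z_def by (rule valid_label_forest[OF exf])

lemma label_t: "label_tree [] t = Node ([], None) Z"
  by (simp add: t_def Bplus_def Z_def)

lemma children_t: "children t = f"
  by (simp add: t_def Bplus_def)

lemma addressZ: "x \<in> set (labels Z) \<Longrightarrow> fst x \<noteq> []"
  using labels_label_forest[of x "[]" f] by (auto simp: Z_def)

lemma labelsZ: "x \<in> set (labels Z) \<longleftrightarrow> fst x \<in> nodes t \<and> fst x \<noteq> [] \<and> snd x = deco t (fst x)"
proof -
  have "insert ([], None) (set (labels Z)) = (\<lambda>q. (q, deco t q)) ` nodes t"
    using set_labels_label_tree[of "[]" t] unfolding label_t by simp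
  then have "x = ([], None) \<or> x \<in> set (labels Z) \<longleftrightarrow> (\<exists>q\<in>nodes t. x = (q, deco t q))"
    by (metis (no_types, lifting) image_iff insert_iff)
  then show ?thesis using addressZ[of x] by (cases x) auto
qed

lemma subsZ: "u \<in> set (subs Z) \<longleftrightarrow> (\<exists>q\<in>nodes t. q \<noteq> [] \<and> u = label_tree q (subtree t q))"
proof -
  have eq: "insert (Node ([], None) Z) (set (subs Z)) = (\<lambda>q. label_tree q (subtree t q)) ` nodes t"
    using set_subs_label_tree[of "[]" t] unfolding label_t by simp
  have "decoration u \<in> set (labels Z)" if "u \<in> set (subs Z)" for u
    using that by (simp add: labels_def)
  then have ne: "fst (decoration u) \<noteq> []" if "u \<in> set (subs Z)" for u
    using addressZ that by blast
  show ?thesis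
  proof
    assume u: "u \<in> set (subs Z)"
    then obtain q where q: "q \<in> nodes t" "u = label_tree q (subtree t q)" using eq by blast
    then show "\<exists>q\<in>nodes t. q \<noteq> [] \<and> u = label_tree q (subtree t q)" using ne[OF u] by auto
  next
    assume "\<exists>q\<in>nodes t. q \<noteq> [] \<and> u = label_tree q (subtree t q)"
    then obtain q where q: "q \<in> nodes t" "q \<noteq> []" "u = label_tree q (subtree t q)" by blast
    then have "u \<in> insert (Node ([], None) Z) (set (subs Z))" unfolding eq by blast
    moreover have "decoration u = (q, decoration (subtree t q))" by (simp add: q(3))
    then have "u \<noteq> Node ([], None) Z" using q(2) by auto
    ultimately show "u \<in> set (subs Z)" by blast
  qed
qed

lemma labels_piece:
  assumes "e \<in> nodes t"
  shows "x \<in> set (labels_tree (label_tree e (subtree t e))) \<longleftrightarrow>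
    prefix e (fst x) \<and> fst x \<in> nodes t \<and> snd x = deco t (fst x)"
  unfolding set_labels_label_tree using assms
  by (cases x) (auto simp: prefix_def nodes_append deco_append image_iff)

text \<open>Numbered nodes are leaves; hence every node above an edge is an admissible target of
  grafting.\<close>

lemma parent_black:
  assumes "p @ [i] \<in> nodes t"
  shows "deco t p = None"
proof (cases "p = []")
  case True
  then show ?thesis by (simp add: deco_def t_def Bplus_def)
next
  case False
  have p: "p \<in> nodes t" "children (subtree t p) \<noteq> []"
    using assms by (auto simp: nodes_append) (auto simp: nodes_def)
  then have "label_tree p (subtree t p) \<in> set (subs Z)" using False subsZ by blast
  moreover have "children (label_tree p (subtree t p)) \<noteq> []"
    using p(2) by (simp add: label_forest_def)
  ultimately have "snd (decoration (label_tree p (subtree t p))) = None"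
    using validZ unfolding valid_def by blast
  then show ?thesis by (simp add: deco_def)
qed

text \<open>The pieces are glued back to their parents; the liana condition ensures that pieces and
  rest are exotic separately.\<close>

lemma cut_glue:
  assumes l: "l \<in> ordered_cuts t"
  defines "P \<equiv> cut_pieces t l" and "R \<equiv> cut_rest t l"
  shows "\<exists>\<psi>\<in>maps P R. glue \<psi> P R = Z"
    and "valid P" "valid R" "apart P R"
proof -
  let ?c = "set l" and ?C = "{x. fst x \<in> set l} :: (nat list \<times> nat option) set"
  have adm: "admissible t ?c" and dl: "distinct l"
    using l by (simp_all add: ordered_cuts_def cut_orders_def)
  have edge: "e \<in> nodes t" "e \<noteq> []" if "e \<in> ?c" for e
    using adm that unfolding admissible_def edges_def by blast+
  \<comment> \<open>Comparable cut edges would lie on the path of a common leaf, which carries at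
    most one cut edge. So the cut is an antichain.\<close>
  have anti: "e = e'" if "e \<in> ?c" "e' \<in> ?c" "prefix e e'" for e e'
  proof -
    have "\<exists>q\<in>leaves t. prefix e' q" by (rule leaf_above[OF edge(1)[OF that(2)]])
    then obtain q where q: "q \<in> leaves t" "prefix e' q" by blast
    have "card {e \<in> ?c. prefix e q} \<le> 1" using adm q(1) unfolding admissible_def by blast
    moreover have "e \<in> {e \<in> ?c. prefix e q}" "e' \<in> {e \<in> ?c. prefix e q}"
      using that q(2) prefix_order.trans by auto
    moreover have fin: "finite {e \<in> ?c. prefix e q}" by simp
    ultimately show ?thesis unfolding One_nat_def card_le_Suc0_iff_eq[OF fin] by blast
  qed
  have R: "R = prunes ?C Z" by (simp add: R_def cut_rest_def Z_def children_t)
  have labR: "set (labels R) \<subseteq> set (labels Z)" unfolding R by (rule labels_prunes)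
  have dR: "distinct (labels R)" unfolding R by (rule distinct_prunes[OF valid_distinct[OF validZ]])
  have setP: "set P = (\<lambda>e. label_tree e (subtree t e)) ` ?c" by (simp add: P_def cut_pieces_def)
  have rootsP: "roots P = (\<lambda>e. (e, deco t e)) ` ?c"
    by (simp add: roots_def setP image_image deco_def)
  have cover: "x \<in> set (labels R) \<or> (\<exists>e\<in>?c. prefix e (fst x))" if x: "x \<in> set (labels Z)" for x
  proof -
    have "x \<in> set (labels R) \<or> (\<exists>u\<in>set (subs Z). decoration u \<in> ?C \<and> x \<in> set (labels_tree u))"
      unfolding R by (rule labels_prunes_cases[OF x])
    then show ?thesis
    proof
      assume "\<exists>u\<in>set (subs Z). decoration u \<in> ?C \<and> x \<in> set (labels_tree u)"
      then obtain u where u: "u \<in> set (subs Z)" "fst (decoration u) \<in> ?c" "x \<in> set (labels_tree u)" by auto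
      then obtain q where q: "q \<in> nodes t" "u = label_tree q (subtree t q)" using subsZ by blast
      then show ?thesis using u labels_piece[OF q(1)] by auto
    qed blast
  qed
  \<comment> \<open>Each piece returns to its parent; a parent equal to the added root means that
    the piece stays.\<close>
  define \<psi> where "\<psi> = restrict (\<lambda>x. if butlast (fst x) = [] then None
      else Some (butlast (fst x), deco t (butlast (fst x)))) (roots P)"
  have psi: "\<psi> (e, deco t e) = (if butlast e = [] then None else Some (butlast e, deco t (butlast e)))" if "e
      \<in> ?c" for e
    using that by (simp add: \<psi>_def rootsP)
  have "\<psi> r \<in> insert None (Some ` {x \<in> set (labels R). snd x = None})" if r: "r \<in> roots P" for r
  proof -
    obtain e where e: "e \<in> ?c" "r = (e, deco t e)" using r rootsP by blast
    show ?thesis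
    proof (cases "butlast e = []")
      case False
      have ee: "butlast e @ [last e] = e" using edge(2)[OF e(1)] by simp
      then have n: "butlast e @ [last e] \<in> nodes t" using edge(1)[OF e(1)] by simp
      then have "butlast e \<in> nodes t" by (simp add: nodes_append)
      then have "(butlast e, deco t (butlast e)) \<in> set (labels Z)" using False labelsZ by simp
      \<comment> \<open>A cut edge at or above the parent would be comparable to \<open>e\<close>;
        hence the parent survives in the rest and is a legitimate target.\<close>
      moreover have "\<not> (\<exists>e'\<in>?c. prefix e' (butlast e))"
      proof
        assume "\<exists>e'\<in>?c. prefix e' (butlast e)"
        then obtain e' where e': "e' \<in> ?c" "prefix e' (butlast e)" by blast
        have "prefix e' e" using e'(2) ee by (metis prefix_prefix)
        then have "e' = e" using anti[OF e'(1) e(1)] by blast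
        then show False using e'(2) edge(2)[OF e(1)]
          by (metis ee append_self_conv not_Cons_self2 prefix_def prefix_order.antisym)
      qed
      ultimately have "(butlast e, deco t (butlast e)) \<in> set (labels R)" using cover by force
      then show ?thesis using psi[OF e(1)] e(2) False parent_black[OF n] by simp
    qed (simp add: psi[OF e(1)] e(2))
  qed
  then have maps: "\<psi> \<in> maps P R" unfolding maps_def PiE_iff by (simp add: \<psi>_def)
  let ?a = "\<lambda>x :: nat list \<times> nat option. map (\<lambda>e. label_tree e (subtree t e)) (filter (\<lambda>e. butlast e = fst x) l)"
  have fibN: "fiber \<psi> P None = ?a ([], None)"
  proof -
    have "\<psi> (e, deco t e) = None \<longleftrightarrow> butlast e = []" if "e \<in> ?c" for e using psi[OF that] by simp
    then show ?thesis
      unfolding fiber_def P_def cut_pieces_def filter_map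
      by (intro arg_cong[where f = "map _"] filter_cong) (auto simp: deco_def)
  qed
  have fibS: "fiber \<psi> P (Some x) = ?a x" if x: "x \<in> set (labels Z)" for x
  proof -
    have "\<psi> (e, deco t e) = Some x \<longleftrightarrow> butlast e = fst x" if "e \<in> ?c" for e
      using psi[OF that] x labelsZ[of x] by (cases x) auto
    then show ?thesis
      unfolding fiber_def P_def cut_pieces_def filter_map
      by (intro arg_cong[where f = "map _"] filter_cong) (auto simp: deco_def)
  qed
  have "[] \<in> nodes t" by (simp add: nodes_def)
  from gr_prune[OF l this refl]
  have "Z = ?a ([], None) @ map (gr ?a) R"
    unfolding subtree.simps label_t prune_Node gr.simps R by simp
  also have "map (gr ?a) R = map (gr (\<lambda>x. fiber \<psi> P (Some x))) R"
    using fibS labR by (intro gr_cong) auto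
  finally have glue: "glue \<psi> P R = Z" unfolding glue_def fibN by (rule sym)
  then show "\<exists>\<psi>\<in>maps P R. glue \<psi> P R = Z" using maps by blast
  have mset: "mset (labels Z) = mset (labels P) + mset (labels R)"
    using maps_mset[OF maps dR] glue by simp
  then have disPR: "distinct (labels P @ labels R)"
    using valid_distinct[OF validZ] by (metis mset_append mset_eq_imp_distinct_iff)
  have inP: "x \<in> set (labels P) \<longleftrightarrow> x \<in> set (labels Z) \<and> (\<exists>e\<in>?c. prefix e (fst x))" for x
  proof -
    have "x \<in> set (labels P) \<longleftrightarrow> (\<exists>e\<in>?c. prefix e (fst x) \<and> fst x \<in> nodes t \<and> snd x = deco t (fst x))"
      unfolding set_labels[of P] setP using labels_piece edge(1) by auto
    moreover have "fst x \<noteq> []" if "e \<in> ?c" "prefix e (fst x)" for e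
      using edge(2)[OF that(1)] that(2) by (cases "fst x") auto
    ultimately show ?thesis using labelsZ[of x] by blast
  qed
  \<comment> \<open>A number on both sides would be a liana with only one end cut off.\<close>
  have nums: "nums P \<inter> nums R = {}"
  proof (rule ccontr)
    assume "\<not> ?thesis"
    then obtain i where i: "i \<in> nums P" "i \<in> nums R" by blast
    obtain x where x: "x \<in> set (labels P)" "snd x = Some i" using i(1) unfolding nums_def by force
    obtain y where y: "y \<in> set (labels R)" "snd y = Some i" using i(2) unfolding nums_def by force
    have xZ: "x \<in> set (labels Z)" using x(1) inP by blast
    have yZ: "y \<in> set (labels Z)" using y(1) labR by blast
    have "x \<noteq> y" using disPR x(1) y(1) by auto
    then have "fst x \<noteq> fst y" using x(2) y(2) by (simp add: prod_eq_iff)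
    then have "liana t (fst x) (fst y)"
      unfolding liana_def using xZ yZ labelsZ x(2) y(2) by metis
    moreover have "\<exists>e\<in>?c. prefix e (fst x)" using x(1) inP by blast
    ultimately have "\<exists>e\<in>?c. prefix e (fst y)" using adm unfolding admissible_def by blast
    then have "y \<in> set (labels P)" using inP yZ by blast
    then show False using disPR y(1) by auto
  qed
  show "apart P R" using nums disPR by (auto simp: apart_def)
  let ?n = "\<lambda>F i. count (image_mset snd (mset (labels F))) (Some i)"
  \<comment> \<open>Multiplicities in \<open>Z\<close> are zero or two and no number lies on both
    sides, so each side has multiplicities zero or two.\<close>
  have cnt: "?n P i \<in> {0, 2} \<and> ?n R i \<in> {0, 2}" for i
  proof -
    have s: "?n Z i = ?n P i + ?n R i" unfolding mset by simp
    have z: "?n Z i \<in> {0, 2}" using validZ by (simp only: valid_def)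
    have "?n P i = 0 \<or> ?n R i = 0" using nums nums_count[of i P] nums_count[of i R] by blast
    then show ?thesis using s z by (metis add_0 add.right_neutral insertI1)
  qed
  have labP: "set (labels P) \<subseteq> set (labels Z)" using inP by blast
  have zero: "0 \<notin> nums P" "0 \<notin> nums R"
    using validZ labP labR unfolding valid_def nums_def by blast+
  have leafZ: "children u = []" if "u \<in> set (subs Z)" "snd (decoration u) \<noteq> None" for u
    using validZ that unfolding valid_def by blast
  have "set P \<subseteq> set (subs Z)" unfolding setP using subsZ edge by blast
  then have "set (subs P) \<subseteq> set (subs Z)" by (rule subs_closed)
  then have leafP: "\<forall>u\<in>set (subs P). snd (decoration u) \<noteq> None \<longrightarrow> children u = []" using leafZ by blast
  have leafR: "\<forall>u\<in>set (subs R). snd (decoration u) \<noteq> None \<longrightarrow> children u = []"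
  proof (intro ballI impI)
    fix u assume u: "u \<in> set (subs R)" "snd (decoration u) \<noteq> None"
    obtain v where v: "v \<in> set (subs Z)" "decoration u = decoration v" "children u = prunes ?C (children v)"
      using subs_prunes u(1) unfolding R by blast
    then show "children u = []" using leafZ[OF v(1)] u(2) by simp
  qed
  show "valid P" "valid R"
    unfolding valid_def using disPR zero leafP leafR cnt by auto
qed

text \<open>The labels of \<open>Z\<close> are its addresses, so the root label of a piece tells
  where it was glued; these addresses, in the order of the pieces, form the ordered cut.\<close>

lemma glue_cut:
  fixes P R :: "nat list lforest"
  assumes dis: "distinct (labels P @ labels R)" and nums: "nums P \<inter> nums R = {}"
    and \<psi>: "\<psi> \<in> maps P R" and glue: "glue \<psi> P R = Z"
  defines "l \<equiv> map (\<lambda>p. fst (decoration p)) P"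
  shows "l \<in> ordered_cuts t" "cut_pieces t l = P" "cut_rest t l = R"
proof -
  let ?c = "set l" and ?C = "{x. fst x \<in> set l} :: (nat list \<times> nat option) set"
  let ?a = "\<lambda>x. fiber \<psi> P (Some x)"
  have dR: "distinct (labels R)" and dP: "distinct (labels P)" and disj: "set (labels P) \<inter> set (labels R) = {}"
    using dis by auto
  have labZ: "set (labels Z) = set (labels P) \<union> set (labels R)"
    using set_labels_glue[OF \<psi> dR] glue by simp
  have Z: "fiber \<psi> P None @ map (gr ?a) R = Z" using glue by (simp add: glue_def)
  text \<open>The pieces glued to a common node are the first children of that node.\<close>
  have parent: "\<exists>q\<in>nodes t. \<exists>rest. label_forest q (children (subtree t q)) = fiber \<psi> P (\<psi> (decoration p)) @ rest \<and>
      \<psi> (decoration p) = (if q = [] then None else Some (q, None))" if p: "p \<in> set P" for p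
  proof (cases "\<psi> (decoration p)")
    case None
    have "label_forest [] (children (subtree t [])) = fiber \<psi> P None @ map (gr ?a) R"
      using Z by (simp add: children_t Z_def)
    moreover have "[] \<in> nodes t" by (simp add: nodes_def)
    ultimately show ?thesis using None by auto
  next
    case (Some x)
    have "\<psi> (decoration p) \<in> insert None (Some ` {x \<in> set (labels R). snd x = None})"
      using \<psi> p by (simp add: maps_def PiE_iff roots_def)
    then have x: "x \<in> set (labels R)" "snd x = None" using Some by auto
    then obtain u where u: "u \<in> set (subs R)" "x = decoration u" by (auto simp: labels_def)
    have "gr ?a u \<in> set (subs Z)" unfolding Z[symmetric] using u(1) by (simp add: subs_gr)
    then obtain q where q: "q \<in> nodes t" "q \<noteq> []" "gr ?a u = label_tree q (subtree t q)" using subsZ by blast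
    have "x = (q, decoration (subtree t q))"
      using arg_cong[OF q(3), of decoration] u(2) by simp
    then have xq: "x = (q, None)" using x(2) by simp
    have "label_forest q (children (subtree t q)) = ?a x @ map (gr ?a) (children u)"
      using arg_cong[OF q(3), of children] u(2) by simp
    then show ?thesis using q(1,2) Some xq by auto
  qed
  have piece: "\<exists>q\<in>nodes t. \<exists>rest i. label_forest q (children (subtree t q)) = fiber \<psi> P (\<psi> (decoration p)) @ rest \<and>
      \<psi> (decoration p) = (if q = [] then None else Some (q, None)) \<and>
      i < length (fiber \<psi> P (\<psi> (decoration p))) \<and> i < length (children (subtree t q)) \<and>
      p = label_tree (q @ [i]) (subtree t (q @ [i]))" if p: "p \<in> set P" for p
  proof -
    obtain q rest where q: "q \<in> nodes t"
      "label_forest q (children (subtree t q)) = fiber \<psi> P (\<psi> (decoration p)) @ rest"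
      "\<psi> (decoration p) = (if q = [] then None else Some (q, None))"
      using parent[OF p] by blast
    have "p \<in> set (fiber \<psi> P (\<psi> (decoration p)))" using p by (simp add: fiber_def)
    then obtain i where i: "i < length (fiber \<psi> P (\<psi> (decoration p)))" "fiber \<psi> P (\<psi> (decoration p)) ! i = p"
      by (meson in_set_conv_nth)
    have len: "i < length (children (subtree t q))"
      using i(1) arg_cong[OF q(2), of length] by simp
    have "p = label_forest q (children (subtree t q)) ! i"
      unfolding q(2) using i by (simp add: nth_append)
    then have "p = label_tree (q @ [i]) (subtree t (q @ [i]))" using len by (simp add: subtree_append)
    with q i(1) len show ?thesis by blast
  qed
  have addr: "fst (decoration p) \<in> nodes t \<and> fst (decoration p) \<noteq> [] \<and>
      p = label_tree (fst (decoration p)) (subtree t (fst (decoration p)))" if p: "p \<in> set P" for p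
  proof -
    obtain q i where q: "q \<in> nodes t" "i < length (children (subtree t q))"
      "p = label_tree (q @ [i]) (subtree t (q @ [i]))"
      using piece[OF p] by blast
    have "q @ [i] \<in> nodes t" using q(1,2) by (simp add: nodes_append) (simp add: nodes_def)
    then show ?thesis using arg_cong[OF q(3), of decoration] q(3) by simp
  qed
  show pieces: "cut_pieces t l = P"
    unfolding cut_pieces_def l_def list.map_comp comp_def using addr by (intro map_idI) auto
  have inP: "x \<in> set (labels P) \<longleftrightarrow> (\<exists>e\<in>?c. prefix e (fst x) \<and> fst x \<in> nodes t \<and> snd x = deco t (fst x))" for x
  proof -
    have "x \<in> set (labels_tree p) \<longleftrightarrow> prefix (fst (decoration p)) (fst x) \<and> fst x \<in> nodes t \<and> snd x = deco t (fst x)"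
      if p: "p \<in> set P" for p
      using labels_piece[of "fst (decoration p)" x] addr[OF p] by simp
    then show ?thesis unfolding set_labels[of P] l_def by auto
  qed
  have RC: "set (labels R) \<inter> ?C = {}"
  proof (rule ccontr)
    assume "\<not> ?thesis"
    then obtain x where x: "x \<in> set (labels R)" "fst x \<in> ?c" by blast
    then have "x \<in> set (labels Z)" using labZ by blast
    then have "x \<in> set (labels P)" using inP x(2) labelsZ by blast
    then show False using x(1) disj by blast
  qed
  have "roots (fiber \<psi> P v) \<subseteq> ?C" for v
    by (auto simp: fiber_def roots_def l_def)
  \<comment> \<open>All glued trees have their roots in \<open>?C\<close> and no label of
    \<open>R\<close> lies there, so pruning removes exactly the glued trees.\<close>
  then have "prunes ?C Z = R"
    unfolding Z[symmetric] by (simp only: prunes_simps prunes_none append_Nil) (rule prunes_gr[OF _ RC])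
  then show "cut_rest t l = R" by (simp add: cut_rest_def children_t Z_def)
  have rootinj: "p = p'" if "p \<in> set P" "p' \<in> set P" "fst (decoration p) = fst (decoration p')" for p p'
    using addr[OF that(1)] addr[OF that(2)] that(3) by simp
  have dl: "distinct l"
    unfolding l_def using distinct_labels_distinct[OF dP] rootinj by (simp add: distinct_map inj_on_def)
  have edges: "?c \<subseteq> edges t" using addr by (auto simp: l_def edges_def)
  \<comment> \<open>If one piece were rooted inside another, the two would share a label.\<close>
  have anti: "e = e'" if "e \<in> ?c" "e' \<in> ?c" "prefix e e'" for e e'
  proof -
    have "\<exists>p\<in>set P. e = fst (decoration p)" "\<exists>p\<in>set P. e' = fst (decoration p)"
      using that(1,2) unfolding l_def by auto
    then obtain p p' where p: "p \<in> set P" "e = fst (decoration p)" "p' \<in> set P" "e' = fst (decoration p')"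
      by blast
    have d: "snd (decoration p') = deco t e'"
      using arg_cong[OF conjunct2[OF conjunct2[OF addr[OF p(3)]]], of decoration] p(4) by (simp add: deco_def
          prod_eq_iff)
    have "decoration p' \<in> set (labels_tree (label_tree e (subtree t e)))"
      using labels_piece[of e "decoration p'"] addr[OF p(1)] addr[OF p(3)] that(3) p(2,4) d by simp
    then have "decoration p' \<in> set (labels_tree p)" using addr[OF p(1)] p(2) by simp
    then have "p = p'" using roots_disjoint[OF dP p(1,3)] labels_root[of p'] by blast
    then show ?thesis using p(2,4) by simp
  qed
  have leafc: "card {e \<in> ?c. prefix e q} \<le> 1" for q
  proof -
    have fin: "finite {e \<in> ?c. prefix e q}" by simp
    show ?thesis unfolding One_nat_def card_le_Suc0_iff_eq[OF fin]
    proof (intro ballI)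
      fix e e' assume "e \<in> {e \<in> ?c. prefix e q}" "e' \<in> {e \<in> ?c. prefix e q}"
      then have e: "e \<in> ?c" "prefix e q" "e' \<in> ?c" "prefix e' q" by auto
      then have "prefix e e' \<or> prefix e' e" using prefix_same_cases by blast
      then show "e = e'" using anti[OF e(1,3)] anti[OF e(3,1)] by blast
    qed
  qed
  \<comment> \<open>By \<open>piece\<close>, the pieces with a common parent are its first children,
    so every left sibling of a piece is again a piece.\<close>
  have leftc: "v @ [j] \<in> ?c" if "v @ [i] \<in> ?c" "j < i" for v i j
  proof -
    have "\<exists>p\<in>set P. v @ [i] = fst (decoration p)" using that(1) unfolding l_def by auto
    then obtain p where p: "p \<in> set P" "v @ [i] = fst (decoration p)" by blast
    obtain q rest k where q: "label_forest q (children (subtree t q)) = fiber \<psi> P (\<psi> (decoration p)) @ rest"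
      "k < length (fiber \<psi> P (\<psi> (decoration p)))" "k < length (children (subtree t q))"
      "p = label_tree (q @ [k]) (subtree t (q @ [k]))"
      using piece[OF p(1)] by blast
    have vq: "v = q" "i = k" using p(2) arg_cong[OF q(4), of decoration] by auto
    have j: "j < length (fiber \<psi> P (\<psi> (decoration p)))" "j < length (children (subtree t q))"
      using that(2) vq q(2,3) by auto
    have "fiber \<psi> P (\<psi> (decoration p)) ! j = label_forest q (children (subtree t q)) ! j"
      unfolding q(1) using j(1) by (simp add: nth_append)
    also have "\<dots> = label_tree (q @ [j]) (children (subtree t q) ! j)" using j(2) by simp
    finally have "fst (decoration (fiber \<psi> P (\<psi> (decoration p)) ! j)) = v @ [j]" by (simp add: vq)
    moreover have "fiber \<psi> P (\<psi> (decoration p)) ! j \<in> set P"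
      using nth_mem[OF j(1)] by (simp add: fiber_def)
    ultimately show ?thesis unfolding l_def by force
  qed
  \<comment> \<open>One end of the liana puts its number into \<open>P\<close>; disjointness of the
    numbers of \<open>P\<close> and \<open>R\<close> forces the other end into \<open>P\<close>
    too.\<close>
  have lianac: "\<exists>e\<in>?c. prefix e w" if vw: "liana t v w" and e: "\<exists>e\<in>?c. prefix e v" for v w
  proof -
    obtain i where i: "v \<in> nodes t" "w \<in> nodes t" "deco t v = Some i" "deco t w = Some i"
      using vw unfolding liana_def by blast
    have "(v, Some i) \<in> set (labels P)" using inP[of "(v, Some i)"] e i by auto
    then have "i \<in> nums P" unfolding nums_def by force
    then have "i \<notin> nums R" using nums by blast
    then have "(w, Some i) \<notin> set (labels R)" unfolding nums_def by force
    moreover have "w \<noteq> []" using i(4) by (auto simp: t_def Bplus_def deco_def)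
    then have "(w, Some i) \<in> set (labels Z)" using labelsZ[of "(w, Some i)"] i by simp
    ultimately have "(w, Some i) \<in> set (labels P)" using labZ by blast
    then show ?thesis using inP[of "(w, Some i)"] by auto
  qed
  \<comment> \<open>Pieces with a common parent form one fibre, and that fibre is an initial segment
    of the children in their planar order.\<close>
  have "sorted_wrt (\<lambda>e e'. butlast e = butlast e' \<longrightarrow> last e < last e') l"
  proof (rule sorted_wrt_fibers)
    fix v :: "nat list"
    let ?o = "if v = [] then None else Some (v, None)"
    have o: "butlast (fst (decoration p)) = v \<longleftrightarrow> \<psi> (decoration p) = ?o" if p: "p \<in> set P" for p
    proof -
      obtain q i where q: "\<psi> (decoration p) = (if q = [] then None else Some (q, None))"
        "p = label_tree (q @ [i]) (subtree t (q @ [i]))"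
        using piece[OF p] by blast
      have "butlast (fst (decoration p)) = q" using arg_cong[OF q(2), of decoration] by simp
      then show ?thesis using q(1) by auto
    qed
    have fil: "filter (\<lambda>e. butlast e = v) l = map (\<lambda>p. fst (decoration p)) (fiber \<psi> P ?o)"
      unfolding l_def filter_map fiber_def using o by (intro arg_cong[where f = "map _"] filter_cong) auto
    show "sorted_wrt (\<lambda>e e'. last e < last e') (filter (\<lambda>e. butlast e = v) l)"
    proof (cases "fiber \<psi> P ?o = []")
      case True
      then show ?thesis unfolding fil by simp
    next
      case False
      then obtain p where p: "p \<in> set P" "\<psi> (decoration p) = ?o"
        by (auto simp: fiber_def filter_empty_conv)
      obtain q rest where q: "label_forest q (children (subtree t q)) = fiber \<psi> P ?o @ rest"
        using piece[OF p(1)] unfolding p(2) by blast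
      have "fst (decoration (fiber \<psi> P ?o ! j)) = q @ [j]" if j: "j < length (fiber \<psi> P ?o)" for j
      proof -
        have "j < length (children (subtree t q))" using j arg_cong[OF q, of length] by simp
        moreover have "fiber \<psi> P ?o ! j = label_forest q (children (subtree t q)) ! j"
          unfolding q using j by (simp add: nth_append)
        ultimately show ?thesis by simp
      qed
      then show ?thesis unfolding fil sorted_wrt_iff_nth_less by simp
    qed
  qed
  moreover have "admissible t ?c"
    unfolding admissible_def using edges leafc leftc lianac by blast
  ultimately show "l \<in> ordered_cuts t"
    using dl by (simp add: ordered_cuts_def cut_orders_def)
qed

end

lemma cut_pieces_inj: "cut_pieces t l = cut_pieces t l' \<Longrightarrow> l = l'"
proof -
  have "map (\<lambda>p. fst (decoration p)) (cut_pieces t l) = l" for l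
    by (simp add: cut_pieces_def comp_def)
  then show "cut_pieces t l = cut_pieces t l' \<Longrightarrow> l = l'" by metis
qed

text \<open>The map can be read off from the result: a root of \<open>F\<close> either is a root of
  the grafted forest or is a child of the node to which it was sent.\<close>

lemma glue_inj:
  assumes dis: "distinct (labels F @ labels G)" and \<phi>: "\<phi> \<in> maps F G" and \<psi>: "\<psi> \<in> maps F G"
    and eq: "glue \<phi> F G = glue \<psi> F G"
  shows "\<phi> = \<psi>"
proof -
  have dG: "distinct (labels G)" and disj: "set (labels F) \<inter> set (labels G) = {}" using dis by auto
  have dZ: "distinct (labels (glue \<psi> F G))"
    using dis maps_mset[OF \<psi> dG] by (metis mset_append mset_eq_imp_distinct_iff)
  have rG: "r \<notin> set (labels G)" if "r \<in> roots F" for r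
    using that disj roots_labels[of F] by blast
  have "\<psi> r = \<phi> r" if r: "r \<in> roots F" for r
  proof (cases "\<phi> r")
    case None
    then have "r \<in> roots (glue \<psi> F G)" unfolding eq[symmetric] roots_glue using r by blast
    then show ?thesis using rG[OF r] roots_labels[of G] None unfolding roots_glue by auto
  next
    case (Some x)
    have "\<phi> r \<in> insert None (Some ` set (labels G))" using maps_range[OF \<phi>] r by blast
    then have x: "x \<in> set (labels G)" using Some by auto
    then obtain u where u: "u \<in> set (subs G)" "decoration u = x" by (auto simp: labels_def)
    have sub: "gr (\<lambda>x. fiber \<chi> F (Some x)) u \<in> set (subs (glue \<chi> F G))" for \<chi>
      unfolding glue_def using u(1) by (simp add: subs_gr)
    have "gr (\<lambda>x. fiber \<phi> F (Some x)) u = gr (\<lambda>x. fiber \<psi> F (Some x)) u"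
      by (rule subs_inj[OF dZ sub[of \<phi>, unfolded eq] sub[of \<psi>]]) simp
    from arg_cong[OF this, of children]
    have ch: "fiber \<phi> F (Some x) @ map (gr (\<lambda>x. fiber \<phi> F (Some x))) (children u) =
        fiber \<psi> F (Some x) @ map (gr (\<lambda>x. fiber \<psi> F (Some x))) (children u)"
      by (simp add: u(2))
    obtain s where s: "s \<in> set F" "decoration s = r" using r by (auto simp: roots_def)
    then have "s \<in> set (fiber \<phi> F (Some x))" using Some by (simp add: fiber_def)
    then have "s \<in> set (fiber \<psi> F (Some x) @ map (gr (\<lambda>x. fiber \<psi> F (Some x))) (children u))"
      unfolding ch[symmetric] by simp
    \<comment> \<open>Equal labels force equal subtrees, hence equal children of the node
      \<open>x\<close>. The tree \<open>s\<close> must therefore be in the fibre of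
      \<open>\<psi>\<close>, since its root label does not belong to \<open>G\<close>.\<close>
    then consider "s \<in> set (fiber \<psi> F (Some x))" | v where "v \<in> set (children u)" "decoration s = decoration v"
      by auto
    then show ?thesis
    proof cases
      case 1
      then show ?thesis using s(2) Some by (simp add: fiber_def)
    next
      case (2 v)
      then have "v \<in> set (subs G)" using subs_trans[OF u(1)] subs_self[of "children u"] by blast
      then have "r \<in> set (labels G)" using 2(2) s(2) by (auto simp: labels_def)
      then show ?thesis using rG[OF r] by blast
    qed
  qed
  then show ?thesis
    using \<phi> \<psi> unfolding maps_def by (intro PiE_ext) auto
qed

text \<open>An instance of \<open>card_duality\<close>: grafting maps are the constructions, ordered
  cuts of the representative of \<open>\<zeta>\<close> are the decompositions. \<open>push\<close>
  moves grafting maps along the relabelling in both directions.\<close>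

lemma GL_MKW_dual:
  "coeff (GL_basis \<pi> \<eta>) \<zeta> = (coeff (MKW_basis \<zeta>) (\<pi>, \<eta>) :: 'k::field)"
proof -
  obtain F G H :: "nat list lforest"
    where FG: "valid F" "valid G" "cls F = \<pi>" "cls G = \<eta>" "apart F G"
    by (rule representatives3[of \<pi> \<eta> \<pi>])
  note FG' = FG(1,2,5)
  let ?f = "rep_ef \<zeta>"
  let ?t = "Bplus ?f" and ?Z = "label_forest [] ?f" and ?A = "set (labels (F @ G))"
  note ex = rep_ef_props(1)[of \<zeta>]
  have clsZ: "cls ?Z = \<zeta>" by (simp add: cls_def rep_ef_props)
  note dG = valid_distinct[OF FG(2)]
  have dFG: "distinct (labels F @ labels G)" using valid_distinct[OF valid_append[OF FG']] by simp
  have "card {\<phi> \<in> maps F G. cls (glue \<phi> F G) = cls ?Z} =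
    card {l \<in> ordered_cuts ?t. cls (cut_pieces ?t l) = cls F \<and> cls (cut_rest ?t l) = cls G}"
  proof (rule card_duality[OF FG' valid_label_forest[OF ex]])
    show "valid (glue \<phi> F G)" "set (labels (glue \<phi> F G)) = ?A" if "\<phi> \<in> maps F G" for \<phi>
      using valid_glue[OF FG' that] set_labels_glue[OF that dG] by simp_all
    show "inj_on (\<lambda>\<phi>. glue \<phi> F G) (maps F G)"
      by (rule inj_onI) (rule glue_inj[OF dFG])
    show "valid (cut_pieces ?t l)" "valid (cut_rest ?t l)" "apart (cut_pieces ?t l) (cut_rest ?t l)"
      if "l \<in> ordered_cuts ?t" for l
      by (rule cut_glue[OF ex that])+
    show "l = l'" if "cut_pieces ?t l = cut_pieces ?t l'" for l l'
      by (rule cut_pieces_inj[OF that])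
    show "\<exists>l\<in>ordered_cuts ?t. cut_pieces ?t l = relabel h F \<and> cut_rest ?t l = relabel h G"
      if \<phi>: "\<phi> \<in> maps F G" and inj: "inj_on h ?A" and rel: "relabelling h ?A"
        and hZ: "relabel h (glue \<phi> F G) = ?Z" for \<phi> h
    proof -
      let ?P = "relabel h F" and ?R = "relabel h G"
      note push = push_props[OF inj rel]
      have \<psi>: "push h F \<phi> \<in> maps ?P ?R" by (rule bij_betw_apply[OF push(1) \<phi>])
      have glue: "glue (push h F \<phi>) ?P ?R = ?Z" using push(2)[OF \<phi>] hZ by simp
      have "distinct (map h (labels (F @ G)))"
        using dFG inj by (simp only: distinct_map labels_simps simp_thms)
      then have dis: "distinct (labels ?P @ labels ?R)" by simp
      obtain \<sigma> where s: "inj_on \<sigma> (nums (F @ G))" "\<forall>x\<in>?A. snd (h x) = map_option \<sigma> (snd x)"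
        using rel unfolding relabelling_def nums_def by blast
      have "nums ?P = \<sigma> ` nums F" "nums ?R = \<sigma> ` nums G"
        by (rule nums_relabel, use s(2) in simp)+
      then have "nums ?P \<inter> nums ?R = \<sigma> ` (nums F \<inter> nums G)"
        using inj_on_image_Int[OF s(1), of "nums F" "nums G"] by simp
      then have nums: "nums ?P \<inter> nums ?R = {}" using FG(5) by (simp add: apart_def)
      show ?thesis
        using glue_cut[OF ex dis nums \<psi> glue] by blast
    qed
    show "\<exists>\<phi>\<in>maps F G. relabel h (glue \<phi> F G) = ?Z"
      if l: "l \<in> ordered_cuts ?t" and inj: "inj_on h ?A" and rel: "relabelling h ?A"
        and P: "cut_pieces ?t l = relabel h F" and R: "cut_rest ?t l = relabel h G" for l h
    proof -
      note push = push_props[OF inj rel]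
      obtain \<psi> where \<psi>: "\<psi> \<in> maps (relabel h F) (relabel h G)"
        "glue \<psi> (relabel h F) (relabel h G) = ?Z"
        using cut_glue(1)[OF ex l] unfolding P R by blast
      then obtain \<phi> where \<phi>: "\<phi> \<in> maps F G" "\<psi> = push h F \<phi>"
        using bij_betw_imp_surj_on[OF push(1)] by blast
      then show ?thesis using push(2)[OF \<phi>(1)] \<psi>(2) by metis
    qed
  qed
  then show ?thesis
    unfolding FG(3,4)[symmetric] GL_basis_labelled[OF FG'] MKW_basis_cuts
    by (simp add: lookup_sum_basis clsZ)
qed

section \<open>Assembling the two dual Hopf algebras\<close>

lemma adj_GL_MKW: "adj (GL_prod :: (ef \<times> ef \<Rightarrow>\<^sub>0 'k::field) \<Rightarrow> _) MKW"
proof (rule adjI_basis)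
  fix a b show "coeff (GL_prod (basis a)) b = (coeff (MKW (basis b)) a :: 'k)"
    by (cases a) (simp add: GL_MKW_dual)
qed simp_all

lemma adj_shuffle_deshuffle: "adj (shuffle_prod :: (ef \<times> ef \<Rightarrow>\<^sub>0 'k::field) \<Rightarrow> _) deshuffle"
proof (rule adjI_basis)
  fix a b show "coeff (shuffle_prod (basis a)) b = (coeff (deshuffle (basis b)) a :: 'k)"
    by (cases a) (simp add: shuffle_deshuffle_dual)
qed simp_all

lemma pairing_unit: "pairing EF_unit x = EF_counit x" "EF_counit x = pairing x EF_unit"
  by (simp_all add: EF_unit_def EF_counit_def)

lemma shuffle_bialgebra: "bialgebra shuffle_prod EF_unit MKW EF_counit"
  by (rule bialgebra_transpose[OF GL_bialgebra _ _ adj_shuffle_deshuffle adj_sym[OF adj_GL_MKW] pairing_unit])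
      simp_all

lemma connected_axioms:
  fixes mult :: "(ef \<times> ef \<Rightarrow>\<^sub>0 'k::field) \<Rightarrow> (ef \<Rightarrow>\<^sub>0 'k)"
  assumes B: "bialgebra mult EF_unit comult EF_counit"
    and d: "\<And>a b c. (b, c) \<in> supp (comult (basis a)) \<Longrightarrow> num_nodes b + num_nodes c = num_nodes a"
  shows "connected_bialgebra mult EF_unit comult EF_counit num_nodes empty_forest"
  by (intro connected_bialgebra.intro B connected_bialgebra_axioms.intro)
    (auto simp: EF_unit_def EF_counit_basis num_nodes_zero d neq0_conv[symmetric] simp del: neq0_conv)

lemma GL_connected: "connected_bialgebra GL_prod EF_unit deshuffle EF_counit num_nodes empty_forest"
  by (rule connected_axioms[OF GL_bialgebra]) (simp add: num_nodes_deshuffle)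

text \<open>The terms of the Munthe-Kaas--Wright coproduct are, by duality, those of the
  Grossman--Larson product, which preserves the number of nodes.\<close>

lemma shuffle_connected: "connected_bialgebra shuffle_prod EF_unit MKW EF_counit num_nodes empty_forest"
proof (rule connected_axioms[OF shuffle_bialgebra])
  fix a b c assume "(b, c) \<in> supp (MKW (basis a) :: _ \<Rightarrow>\<^sub>0 'a)"
  then have "a \<in> supp (GL_basis b c :: _ \<Rightarrow>\<^sub>0 'a)"
    by (simp add: in_keys_iff GL_MKW_dual)
  then show "num_nodes b + num_nodes c = num_nodes a" by (rule num_nodes_GL)
qed

theorem theorem4p6:
  shows "\<exists>antipode antipode'.
    hopf_algebra (shuffle_prod :: (ef \<times> ef \<Rightarrow>\<^sub>0 'k::field) \<Rightarrow> (ef \<Rightarrow>\<^sub>0 'k)) EF_unit MKW EF_counit antipode \<and>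
    hopf_algebra (GL_prod :: (ef \<times> ef \<Rightarrow>\<^sub>0 'k) \<Rightarrow> (ef \<Rightarrow>\<^sub>0 'k)) EF_unit deshuffle EF_counit antipode' \<and>
    dual_hopf_algebras
      (shuffle_prod :: (ef \<times> ef \<Rightarrow>\<^sub>0 'k) \<Rightarrow> (ef \<Rightarrow>\<^sub>0 'k)) EF_unit MKW EF_counit antipode
      GL_prod EF_unit deshuffle EF_counit antipode'"
  using connected_bialgebra.hopf[OF shuffle_connected] connected_bialgebra.hopf[OF GL_connected]
    dual_hopf[OF shuffle_connected GL_connected adj_shuffle_deshuffle adj_sym[OF adj_GL_MKW] pairing_unit]
  by blast

end
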